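(* Let $M$ be a smooth manifold of dimension $m\geq 2$ and let $\varepsilon$ be a locally variational source form on $\mathbb{R}\times T^2M$, with chart coefficients $\varepsilon_i=A_i+B_{ij}\ddot x^j$. Then the chart expressions $$\kappa=-\sum_{l=1}^m\left(\int_0^{\dot x^l}B_{jl}(x^p,0,\ldots,0,\nu,\dot x^{l+1},\ldots,\dot x^m)\,d\nu\right)dx^j$$ and $$\omega=\frac14\left(\frac{\partial A_i}{\partial\dot x^j}-\frac{\partial A_j}{\partial\dot x^i}\right)_{(x^p,0)}dx^i\wedge dx^j$$ define, respectively, a global differential $1$-form $\kappa$ on $TM$ and a global differential $2$-form $\omega$ on $TM$; that is, the expressions associated with any two charts on $M$ coincide on the overlap of the associated charts on $TM$.
   Context: Einstein summation over repeated indices is used; all functions and forms are smooth. $TM$ is the tangent bundle and $T^2M$ is the manifold of second-order velocities ($2$-jets at $0\in\mathbb{R}$ of curves in $M$). A chart $(V,\psi)$, $\psi=(x^i)$, on $M$ induces charts with coordinates $(x^i,\dot x^i)$ on $V^1\subset TM$ and $(x^i,\dot x^i,\ddot x^i)$ on $V^2\subset T^2M$, where $V^1$, $V^2$ are the preimages of $V$; $t$ is the coordinate on $\mathbb{R}$. The subscript $(x^p,0)$ means evaluation at $\dot x=0$. A source form on $\mathbb{R}\times T^2M$ is a $2$-form $\varepsilon$ with chart expression $\varepsilon=\varepsilon_i\,\omega^i\wedge dt$, $\omega^i=dx^i-\dot x^i dt$, in every chart; throughout, $\varepsilon_i=\varepsilon_i(x^j,\dot x^j,\ddot x^j)$ are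 functions on $V^2$ (independent of $t$). It is locally variational if in charts $(V,\psi)$ covering $M$ there is a function $\mathscr{L}:\mathbb{R}\times V^2\to\mathbb{R}$ with $\varepsilon_i=\frac{\partial\mathscr{L}}{\partial x^i}-\frac{d}{dt}\frac{\partial\mathscr{L}}{\partial\dot x^i}+\frac{d^2}{dt^2}\frac{\partial\mathscr{L}}{\partial\ddot x^i}$, $d/dt$ being the total derivative. It is a known fact that $\varepsilon$ is locally variational iff in every chart $\varepsilon_i=A_i+B_{ij}\ddot x^j$ with $A_i,B_{ij}$ functions of $(x^k,\dot x^k)$ on $V^1$ satisfying the Helmholtz conditions $$B_{ij}=B_{ji},\quad \frac{\partial B_{ik}}{\partial\dot x^j}=\frac{\partial B_{jk}}{\partial\dot x^i},\quad \frac{\partial A_i}{\partial\dot x^j}+\frac{\partial A_j}{\partial\dot x^i}-2\frac{\partial B_{ij}}{\partial x^k}\dot x^k=0,$$ $$\frac{\partial A_i}{\partial x^j}-\frac{\partial A_j}{\partial x^i}-\frac12\frac{\partial}{\partial x^k}\left(\frac{\partial A_i}{\partial\dot x^j}-\frac{\partial A_j}{\partial\dot x^i}\right)\dot x^k=0.$$ *)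

theory Defs
  imports "HOL-Analysis.Analysis"
begin

section \<open>Smooth maps between Euclidean spaces\<close>

text \<open>Only used on open sets. In finite dimension, continuity of all iterated
  directional derivatives is the usual $C^k$ condition.\<close>

primrec Ck_on :: "nat \<Rightarrow> 'a::real_normed_vector set \<Rightarrow> ('a \<Rightarrow> 'b::real_normed_vector) \<Rightarrow> bool" where
  "Ck_on 0 S f \<longleftrightarrow> continuous_on S f"
| "Ck_on (Suc k) S f \<longleftrightarrow>
     (\<forall>x\<in>S. f differentiable (at x)) \<and> (\<forall>v. Ck_on k S (\<lambda>x. frechet_derivative f (at x) v))"

definition smooth_on :: "'a::real_normed_vector set \<Rightarrow> ('a \<Rightarrow> 'b::real_normed_vector) \<Rightarrow> bool" where
  "smooth_on S f \<longleftrightarrow> (\<forall>k. Ck_on k S f)"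


section \<open>Smooth manifolds\<close>

text \<open>A chart is a pair of its domain and its coordinate map; the values of the
  coordinate map outside the domain carry no meaning.\<close>

type_synonym ('a, 'e) chart = "'a set \<times> ('a \<Rightarrow> 'e)"

definition is_chart :: "'a topology \<Rightarrow> ('a, 'e::euclidean_space) chart \<Rightarrow> bool" where
  "is_chart X = (\<lambda>(V, \<psi>). openin X V \<and> open (\<psi> ` V) \<and>
     homeomorphic_map (subtopology X V) (top_of_set (\<psi> ` V)) \<psi>)"

definition compatible_charts ::
  "('a, 'e::euclidean_space) chart \<Rightarrow> ('a, 'e) chart \<Rightarrow> bool" where
  "compatible_charts = (\<lambda>(V, \<psi>) (W, \<phi>).
     smooth_on (\<psi> ` (V \<inter> W)) (\<phi> \<circ> inv_into V \<psi>) \<and>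
     smooth_on (\<phi> ` (V \<inter> W)) (\<psi> \<circ> inv_into W \<phi>))"

definition smooth_atlas :: "'a topology \<Rightarrow> ('a, 'e::euclidean_space) chart set \<Rightarrow> bool" where
  "smooth_atlas X \<A> \<longleftrightarrow>
     (\<forall>c\<in>\<A>. is_chart X c) \<and> topspace X = (\<Union>c\<in>\<A>. fst c) \<and>
     (\<forall>c\<in>\<A>. \<forall>d\<in>\<A>. compatible_charts c d)"

text \<open>The second argument is the maximal atlas, i.e. the set of all charts of the manifold.\<close>

definition smooth_manifold :: "'a topology \<Rightarrow> ('a, 'e::euclidean_space) chart set \<Rightarrow> bool" where
  "smooth_manifold X \<A> \<longleftrightarrow>
     Hausdorff_space X \<and> second_countable X \<and> smooth_atlas X \<A> \<and>
     (\<forall>c. is_chart X c \<and> (\<forall>d\<in>\<A>. compatible_charts c d) \<longrightarrow> c \<in> \<A>)"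


section \<open>Jets of curves\<close>

text \<open>Curves need only be meaningful near $0$; they are represented by total functions.\<close>

definition smooth_curve :: "('p, 'e::euclidean_space) chart set \<Rightarrow> (real \<Rightarrow> 'p) \<Rightarrow> bool" where
  "smooth_curve \<A> \<gamma> \<longleftrightarrow>
     (\<exists>(V, \<psi>)\<in>\<A>. \<exists>e>0. \<gamma> ` {-e<..<e} \<subseteq> V \<and> smooth_on {-e<..<e} (\<psi> \<circ> \<gamma>))"

definition nth_vderiv :: "nat \<Rightarrow> (real \<Rightarrow> 'e::real_normed_vector) \<Rightarrow> real \<Rightarrow> 'e" where
  "nth_vderiv r = (\<lambda>f t. vector_derivative f (at t)) ^^ r"

definition same_jet ::
  "('p, 'e::euclidean_space) chart set \<Rightarrow> nat \<Rightarrow> (real \<Rightarrow> 'p) \<Rightarrow> (real \<Rightarrow> 'p) \<Rightarrow> bool" where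
  "same_jet \<A> k \<gamma> \<delta> \<longleftrightarrow> \<gamma> 0 = \<delta> 0 \<and>
     (\<forall>(V, \<psi>)\<in>\<A>. \<gamma> 0 \<in> V \<longrightarrow>
        (\<forall>r\<le>k. nth_vderiv r (\<psi> \<circ> \<gamma>) 0 = nth_vderiv r (\<psi> \<circ> \<delta>) 0))"

type_synonym 'p jet = "(real \<Rightarrow> 'p) set"

definition jet :: "('p, 'e::euclidean_space) chart set \<Rightarrow> nat \<Rightarrow> (real \<Rightarrow> 'p) \<Rightarrow> 'p jet" where
  "jet \<A> k \<gamma> = {\<delta>. smooth_curve \<A> \<delta> \<and> same_jet \<A> k \<gamma> \<delta>}"

text \<open>\<^term>\<open>jets \<A> 1\<close> is the tangent bundle and \<^term>\<open>jets \<A> 2\<close> the manifold of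
  second-order velocities.\<close>

definition jets :: "('p, 'e::euclidean_space) chart set \<Rightarrow> nat \<Rightarrow> 'p jet set" where
  "jets \<A> k = jet \<A> k ` {\<gamma>. smooth_curve \<A> \<gamma>}"

definition jet_base :: "'p jet \<Rightarrow> 'p" where
  "jet_base j = (SOME \<gamma>. \<gamma> \<in> j) 0"

definition jet_coord :: "('p \<Rightarrow> 'e::real_normed_vector) \<Rightarrow> nat \<Rightarrow> 'p jet \<Rightarrow> 'e" where
  "jet_coord f r j = nth_vderiv r (f \<circ> (SOME \<gamma>. \<gamma> \<in> j)) 0"

lemma some_in_jet:
  assumes "smooth_curve \<A> \<gamma>"
  shows "(SOME \<delta>. \<delta> \<in> jet \<A> k \<gamma>) \<in> jet \<A> k \<gamma>"
proof -
  have "\<gamma> \<in> jet \<A> k \<gamma>"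
    using assms unfolding jet_def same_jet_def by blast
  then show ?thesis
    by (rule someI[where P = "\<lambda>\<delta>. \<delta> \<in> jet \<A> k \<gamma>"])
qed

lemma jet_base_jet:
  assumes "smooth_curve \<A> \<gamma>"
  shows "jet_base (jet \<A> k \<gamma>) = \<gamma> 0"
proof -
  have "same_jet \<A> k \<gamma> (SOME \<delta>. \<delta> \<in> jet \<A> k \<gamma>)"
    using some_in_jet[OF assms, of k] unfolding jet_def by blast
  then show ?thesis
    unfolding jet_base_def same_jet_def by (elim conjE) (rule sym)
qed

lemma jet_coord_jet:
  assumes "smooth_curve \<A> \<gamma>" "(V, \<psi>) \<in> \<A>" "\<gamma> 0 \<in> V" "r \<le> k"
  shows "jet_coord \<psi> r (jet \<A> k \<gamma>) = nth_vderiv r (\<psi> \<circ> \<gamma>) 0"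
proof -
  have "same_jet \<A> k \<gamma> (SOME \<delta>. \<delta> \<in> jet \<A> k \<gamma>)"
    using some_in_jet[OF assms(1), of k] unfolding jet_def by blast
  then show ?thesis
    using assms(2-4) unfolding jet_coord_def same_jet_def by fastforce
qed


section \<open>Induced charts\<close>

definition tangent_chart ::
  "('a, 'e::euclidean_space) chart set \<Rightarrow> ('a, 'e) chart \<Rightarrow> ('a jet, 'e \<times> 'e) chart" where
  "tangent_chart \<A> = (\<lambda>(V, \<psi>).
     ({j \<in> jets \<A> 1. jet_base j \<in> V}, \<lambda>j. (jet_coord \<psi> 0 j, jet_coord \<psi> 1 j)))"

definition tangent_atlas ::
  "('a, 'e::euclidean_space) chart set \<Rightarrow> ('a jet, 'e \<times> 'e) chart set" where
  "tangent_atlas \<A> = tangent_chart \<A> ` \<A>"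

definition T2_chart ::
  "('a, 'e::euclidean_space) chart set \<Rightarrow> ('a, 'e) chart \<Rightarrow> ('a jet, 'e \<times> 'e \<times> 'e) chart" where
  "T2_chart \<A> = (\<lambda>(V, \<psi>).
     ({j \<in> jets \<A> 2. jet_base j \<in> V},
      \<lambda>j. (jet_coord \<psi> 0 j, jet_coord \<psi> 1 j, jet_coord \<psi> 2 j)))"

definition time_chart :: "('p, 'f) chart \<Rightarrow> (real \<times> 'p, real \<times> 'f) chart" where
  "time_chart = (\<lambda>(W, \<phi>). (UNIV \<times> W, \<lambda>(t, q). (t, \<phi> q)))"

text \<open>The atlas of induced charts on the product of the real line with the manifold of
  second-order velocities.\<close>

definition time_T2_atlas ::
  "('a, 'e::euclidean_space) chart set \<Rightarrow> (real \<times> 'a jet, real \<times> 'e \<times> 'e \<times> 'e) chart set" where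
  "time_T2_atlas \<A> = (\<lambda>c. time_chart (T2_chart \<A> c)) ` \<A>"


section \<open>Differential forms\<close>

text \<open>Tangent vectors of a manifold with atlas \<open>\<A>\<close> are the elements of \<^term>\<open>jets \<A> 1\<close>.
  The vector \<^term>\<open>jet_coord \<psi> 1 u\<close> consists of the components of \<open>u\<close> in the chart \<open>\<psi>\<close>.
  Values of a form on other sets of curves, or on pairs of tangent vectors at distinct points,
  carry no meaning.\<close>

definition one_form ::
  "('p, 'f::euclidean_space) chart set \<Rightarrow> ('p jet \<Rightarrow> real) \<Rightarrow> bool" where
  "one_form \<A> \<alpha> \<longleftrightarrow> (\<forall>(V, \<psi>)\<in>\<A>. \<exists>a :: 'f \<Rightarrow> 'f \<Rightarrow> real.
     (\<forall>x\<in>\<psi> ` V. linear (a x)) \<and>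
     (\<forall>v. smooth_on (\<psi> ` V) (\<lambda>x. a x v)) \<and>
     (\<forall>u\<in>jets \<A> 1. jet_base u \<in> V \<longrightarrow> \<alpha> u = a (\<psi> (jet_base u)) (jet_coord \<psi> 1 u)))"

definition two_form ::
  "('p, 'f::euclidean_space) chart set \<Rightarrow> ('p jet \<Rightarrow> 'p jet \<Rightarrow> real) \<Rightarrow> bool" where
  "two_form \<A> \<alpha> \<longleftrightarrow> (\<forall>(V, \<psi>)\<in>\<A>. \<exists>a :: 'f \<Rightarrow> 'f \<Rightarrow> 'f \<Rightarrow> real.
     (\<forall>x\<in>\<psi> ` V. bilinear (a x) \<and> (\<forall>v. a x v v = 0)) \<and>
     (\<forall>v w. smooth_on (\<psi> ` V) (\<lambda>x. a x v w)) \<and>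
     (\<forall>u\<in>jets \<A> 1. \<forall>w\<in>jets \<A> 1. jet_base u \<in> V \<and> jet_base w = jet_base u \<longrightarrow>
        \<alpha> u w = a (\<psi> (jet_base u)) (jet_coord \<psi> 1 u) (jet_coord \<psi> 1 w)))"

definition differential :: "('p \<Rightarrow> real) \<Rightarrow> 'p jet \<Rightarrow> real" where
  "differential f u = jet_coord f 1 u"

definition wedge :: "('v \<Rightarrow> real) \<Rightarrow> ('v \<Rightarrow> real) \<Rightarrow> 'v \<Rightarrow> 'v \<Rightarrow> real" where
  "wedge \<alpha> \<beta> u v = \<alpha> u * \<beta> v - \<alpha> v * \<beta> u"


section \<open>Source forms\<close>

definition contact_form :: "('a, real ^ 'm) chart \<Rightarrow> 'm \<Rightarrow> (real \<times> 'a jet) jet \<Rightarrow> real" where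
  "contact_form = (\<lambda>(V, \<psi>) i u.
     differential (\<lambda>(t, q). jet_coord \<psi> 0 q $ i) u
       - jet_coord \<psi> 1 (snd (jet_base u)) $ i * differential fst u)"

text \<open>The form \<open>\<epsilon>\<close> equals $\varepsilon_i\,\omega^i\wedge dt$ over the chart, where $\varepsilon_i$
  is the function \<open>e i\<close> of the coordinates $(x,\dot x,\ddot x)$, which does not involve $t$.\<close>

definition source_expr ::
  "('a, real ^ 'm) chart set \<Rightarrow> ('a, real ^ 'm) chart \<Rightarrow>
   ((real \<times> 'a jet) jet \<Rightarrow> (real \<times> 'a jet) jet \<Rightarrow> real) \<Rightarrow>
   ('m::finite \<Rightarrow> (real ^ 'm) \<times> (real ^ 'm) \<times> (real ^ 'm) \<Rightarrow> real) \<Rightarrow> bool" where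
  "source_expr \<A> c \<epsilon> e \<longleftrightarrow>
     (\<forall>u\<in>jets (time_T2_atlas \<A>) 1. \<forall>w\<in>jets (time_T2_atlas \<A>) 1.
        jet_base w = jet_base u \<and> snd (jet_base u) \<in> fst (T2_chart \<A> c) \<longrightarrow>
        \<epsilon> u w = (\<Sum>i\<in>UNIV. e i (snd (T2_chart \<A> c) (snd (jet_base u)))
                     * wedge (contact_form c i) (differential fst) u w))"

definition source_form ::
  "('a, real ^ 'm) chart set \<Rightarrow>
   ((real \<times> 'a jet) jet \<Rightarrow> (real \<times> 'a jet) jet \<Rightarrow> real) \<Rightarrow> bool" where
  "source_form \<A> \<epsilon> \<longleftrightarrow>
     two_form (time_T2_atlas \<A>) \<epsilon> \<and> (\<forall>c\<in>\<A>. \<exists>e. source_expr \<A> c \<epsilon> e)"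


section \<open>Euler-Lagrange expressions and local variationality\<close>

text \<open>The total derivative
  $\frac{d}{dt} = \partial_t + \dot x^k\,\partial_{x^k} + \ddot x^k\,\partial_{\dot x^k} + \dots$
  on functions of $(t,x,\dot x,\ddot x)$ and of $(t,x,\dot x,\ddot x,x^{(3)})$, respectively.\<close>

definition total_deriv2 ::
  "(real \<times> 'e \<times> 'e \<times> 'e \<Rightarrow> real) \<Rightarrow> real \<times> 'e \<times> 'e \<times> 'e \<times> 'e::real_normed_vector \<Rightarrow> real" where
  "total_deriv2 F = (\<lambda>(t, x, x1, x2, x3).
     frechet_derivative F (at (t, x, x1, x2)) (1, x1, x2, x3))"

definition total_deriv3 ::
  "(real \<times> 'e \<times> 'e \<times> 'e \<times> 'e \<Rightarrow> real) \<Rightarrow>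
   real \<times> 'e \<times> 'e \<times> 'e \<times> 'e \<times> 'e::real_normed_vector \<Rightarrow> real" where
  "total_deriv3 F = (\<lambda>(t, x, x1, x2, x3, x4).
     frechet_derivative F (at (t, x, x1, x2, x3)) (1, x1, x2, x3, x4))"

definition euler_lagrange ::
  "(real \<times> (real ^ 'm) \<times> (real ^ 'm) \<times> (real ^ 'm) \<Rightarrow> real) \<Rightarrow> 'm::finite \<Rightarrow>
   real \<times> (real ^ 'm) \<times> (real ^ 'm) \<times> (real ^ 'm) \<times> (real ^ 'm) \<times> (real ^ 'm) \<Rightarrow> real" where
  "euler_lagrange L i = (\<lambda>(t, x, x1, x2, x3, x4).
     frechet_derivative L (at (t, x, x1, x2)) (0, axis i 1, 0, 0)
     - total_deriv2 (\<lambda>z. frechet_derivative L (at z) (0, 0, axis i 1, 0)) (t, x, x1, x2, x3)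
     + total_deriv3 (total_deriv2 (\<lambda>z. frechet_derivative L (at z) (0, 0, 0, axis i 1)))
         (t, x, x1, x2, x3, x4))"

definition locally_variational ::
  "'a topology \<Rightarrow> ('a, real ^ 'm) chart set \<Rightarrow>
   ((real \<times> 'a jet) jet \<Rightarrow> (real \<times> 'a jet) jet \<Rightarrow> real) \<Rightarrow> bool" where
  "locally_variational X \<A> \<epsilon> \<longleftrightarrow>
     (\<forall>p\<in>topspace X. \<exists>(V, \<psi>)\<in>\<A>. p \<in> V \<and>
        (\<exists>e L. source_expr \<A> (V, \<psi>) \<epsilon> e \<and>
           smooth_on (UNIV \<times> \<psi> ` V \<times> UNIV \<times> UNIV) L \<and>
           (\<forall>i. \<forall>x\<in>\<psi> ` V. \<forall>t x1 x2 x3 x4.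
              e i (x, x1, x2) = euler_lagrange L i (t, x, x1, x2, x3, x4))))"


section \<open>The chart expressions\<close>

text \<open>For coordinates $\dot x$ this is $(0,\dots,0,\nu,\dot x^{l+1},\dots,\dot x^m)$.\<close>

definition tail_vec :: "'m \<Rightarrow> real \<Rightarrow> (real, 'm::{finite,linorder}) vec \<Rightarrow> (real, 'm) vec" where
  "tail_vec l \<nu> v = (\<chi> k. if k < l then 0 else if k = l then \<nu> else v $ k)"

definition kappa_chart ::
  "('a, (real, 'm) vec) chart \<Rightarrow>
   ('m::{finite,linorder} \<Rightarrow> 'm \<Rightarrow> (real, 'm) vec \<times> (real, 'm) vec \<Rightarrow> real) \<Rightarrow>
   'a jet jet \<Rightarrow> real" where
  "kappa_chart = (\<lambda>(V, \<psi>) B u.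
     let x = jet_coord \<psi> 0 (jet_base u); v = jet_coord \<psi> 1 (jet_base u)
     in - (\<Sum>j\<in>UNIV. (\<Sum>l\<in>UNIV. LBINT \<nu>=0..ereal (v $ l). B j l (x, tail_vec l \<nu> v))
             * differential (\<lambda>q. jet_coord \<psi> 0 q $ j) u))"

definition omega_chart ::
  "('a, real ^ 'm) chart \<Rightarrow> ('m::finite \<Rightarrow> (real ^ 'm) \<times> (real ^ 'm) \<Rightarrow> real) \<Rightarrow>
   'a jet jet \<Rightarrow> 'a jet jet \<Rightarrow> real" where
  "omega_chart = (\<lambda>(V, \<psi>) A u w.
     let x = jet_coord \<psi> 0 (jet_base u)
     in 1 / 4 * (\<Sum>i\<in>UNIV. \<Sum>j\<in>UNIV.
          (frechet_derivative (A i) (at (x, 0)) (0, axis j 1)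
           - frechet_derivative (A j) (at (x, 0)) (0, axis i 1))
          * wedge (differential (\<lambda>q. jet_coord \<psi> 0 q $ i))
                  (differential (\<lambda>q. jet_coord \<psi> 0 q $ j)) u w))"

end

theory Submission
  imports Defs
begin

text \<open>
  Let $f$ be the transition map between two charts, $J = Df(x)$, and $H = D^2f(x)$. Velocities
  transform by $J$ and accelerations by $a \mapsto Ja + H(v,v)$. Evaluating the source form on a pair
  of tangent vectors with $dt$-components $0$ and $1$ isolates its coefficients, and comparing the two
  charts gives the transformation laws \<open>A_transform\<close> and \<open>B_transform\<close>: the matrix $B$ is
  a covariant tensor, with the velocity argument moved by the linear map $J$, while $A$ is a covector
  up to the correction $B(J\cdot, H(v,v))$.

  The correction is quadratic in $v$ near $0$. Hence it does not contribute to
  $\partial A_i/\partial\dot x^j$ at $\dot x = 0$, and these numbers form a tensor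
  (\<open>A_form_transform\<close>). The form $\omega$ is a multiple of its antisymmetrization, so it is
  independent of the chart.

  The expression for $\kappa$ integrates the covector field $B_{jl}\,d\dot x^l$ on the tangent space
  at $x$ along a staircase from $0$ to $v$. Staircases are not preserved by $J$, but straight segments
  starting at $0$ are, so it is enough to replace one path by the other. That is allowed as soon as
  the covector field is closed, that is, $\partial B_{jl}/\partial\dot x^k$ is symmetric in $k$ and
  $l$ (\<open>staircase_integral_eq_radial_potential\<close>). The straight path also shows that the
  coefficients of $\kappa$ are smooth, because they are integrals over $[0,1]$ depending smoothly on
  the parameters $(x, v)$.

  Closedness is where variationality enters. Let $L$ be a Lagrangian for the source form in some chart
  and $Q_i = \partial L/\partial\ddot x^i$. The Euler-Lagrange expression of $L$ formally depends on
  the derivatives of third and fourth order. As these must drop out, $Q_i$ does not depend on the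
  accelerations, and $\partial Q_i/\partial\dot x^j$ is symmetric in $i$ and $j$. The part linear in
  the accelerations then expresses $B$ by derivatives of $L$ and $Q$ (\<open>B_formula\<close>), from which
  closedness is read off (\<open>B_closed\<close>). Such a chart exists around every point, and the
  tensor law carries closedness to all other charts (\<open>B_closed_in_every_chart\<close>).
\<close>

section \<open>Directional derivatives of smooth maps\<close>

abbreviation dir_deriv ::
  "'a \<Rightarrow> ('a::real_normed_vector \<Rightarrow> 'b::real_normed_vector) \<Rightarrow> 'a \<Rightarrow> 'b" where
  "dir_deriv v f \<equiv> \<lambda>x. frechet_derivative f (at x) v"

lemma frechet_derivative_cong_open:
  assumes "open S" "x \<in> S" "\<And>y. y \<in> S \<Longrightarrow> f y = g y"
  shows "frechet_derivative f (at x) = frechet_derivative g (at x)"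
proof -
  have "(f has_derivative F) (at x) \<longleftrightarrow> (g has_derivative F) (at x)" for F
    using has_derivative_transform_within_open[OF _ assms(1,2), of f F UNIV g]
      has_derivative_transform_within_open[OF _ assms(1,2), of g F UNIV f] assms(3) by auto
  then show ?thesis
    unfolding frechet_derivative_def by simp
qed

lemma differentiable_cong_open:
  assumes "open S" "x \<in> S" "\<And>y. y \<in> S \<Longrightarrow> f y = g y" "f differentiable (at x)"
  shows "g differentiable (at x)"
  using assms(4) has_derivative_transform_within_open[OF _ assms(1,2), of f _ UNIV g] assms(3)
  unfolding differentiable_def by blast

lemma Ck_on_cong:
  assumes "open S" "Ck_on k S f" "\<And>x. x \<in> S \<Longrightarrow> f x = g x"
  shows "Ck_on k S g"
  using assms(2,3)
proof (induction k arbitrary: f g)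
  case 0
  then show ?case by (simp cong: continuous_on_cong)
next
  case (Suc k)
  have "g differentiable (at x)" if "x \<in> S" for x
    using differentiable_cong_open[OF assms(1) that Suc.prems(2)] Suc.prems(1) that by auto
  moreover have "Ck_on k S (dir_deriv v g)" for v
  proof (rule Suc.IH)
    show "Ck_on k S (dir_deriv v f)" using Suc.prems(1) by simp
    show "dir_deriv v f x = dir_deriv v g x" if "x \<in> S" for x
      using frechet_derivative_cong_open[OF assms(1) that Suc.prems(2)] by simp
  qed
  ultimately show ?case by simp
qed

text \<open>The recursion in \<^const>\<open>Ck_on\<close> refers to the derivative selected by
  \<^const>\<open>frechet_derivative\<close>. On an open set any explicitly given derivative may take its place,
  so that closure properties can be proved from the usual differentiation rules.\<close>

lemma Ck_on_SucI:
  assumes "open S" "\<And>x. x \<in> S \<Longrightarrow> (f has_derivative F x) (at x)"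
    and "\<And>v. Ck_on k S (\<lambda>x. F x v)"
  shows "Ck_on (Suc k) S f"
proof -
  have "Ck_on k S (dir_deriv v f)" for v
  proof (rule Ck_on_cong[OF assms(1) assms(3)])
    show "F x v = dir_deriv v f x" if "x \<in> S" for x
      using frechet_derivative_at[OF assms(2)[OF that]] by simp
  qed
  moreover have "f differentiable (at x)" if "x \<in> S" for x
    using assms(2)[OF that] unfolding differentiable_def by blast
  ultimately show ?thesis by simp
qed

lemma Ck_on_SucD:
  assumes "Ck_on (Suc k) S f" "x \<in> S"
  shows "(f has_derivative (\<lambda>v. dir_deriv v f x)) (at x)"
proof -
  have "f differentiable (at x)" using assms by simp
  then show ?thesis by (simp add: frechet_derivative_works)
qed

lemma Ck_on_Suc_imp_Ck_on: "Ck_on (Suc k) S f \<Longrightarrow> Ck_on k S f"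
proof (induction k arbitrary: f)
  case 0
  then show ?case
    by (auto intro!: continuous_at_imp_continuous_on differentiable_imp_continuous_within)
next
  case (Suc k)
  have "Ck_on k S (dir_deriv v f)" for v
    using Suc.IH[of "dir_deriv v f"] Suc.prems Ck_on.simps(2)[of "Suc k" S f] by blast
  then show ?case
    using Suc.prems by simp
qed

lemma Ck_on_imp_continuous_on: "Ck_on k S f \<Longrightarrow> continuous_on S f"
proof (induction k)
  case (Suc k)
  then show ?case using Ck_on_Suc_imp_Ck_on by blast
qed simp

lemma Ck_on_subset: "Ck_on k S f \<Longrightarrow> R \<subseteq> S \<Longrightarrow> Ck_on k R f"
  by (induction k arbitrary: f) (auto intro: continuous_on_subset)

lemma Ck_on_const [simp]: "Ck_on k S (\<lambda>x. c)"
  by (induction k arbitrary: c) simp_all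

lemma Ck_on_bounded_linear_compose:
  assumes "bounded_linear T" "open S" "Ck_on k S f"
  shows "Ck_on k S (\<lambda>x. T (f x))"
  using assms(3)
proof (induction k arbitrary: f)
  case 0
  then show ?case by (simp add: bounded_linear.continuous_on[OF assms(1)])
next
  case (Suc k)
  show ?case
  proof (rule Ck_on_SucI[OF assms(2)])
    show "((\<lambda>x. T (f x)) has_derivative (\<lambda>v. T (dir_deriv v f x))) (at x)" if "x \<in> S" for x
      using bounded_linear.has_derivative[OF assms(1) Ck_on_SucD[OF Suc.prems that]] .
    show "Ck_on k S (\<lambda>x. T (dir_deriv v f x))" for v
      using Suc by simp
  qed
qed

lemma Ck_on_bounded_linear:
  assumes "bounded_linear T" "open S"
  shows "Ck_on k S T"
proof (cases k)
  case 0
  then show ?thesis by (simp add: linear_continuous_on[OF assms(1)])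
next
  case (Suc j)
  then show ?thesis
    using Ck_on_SucI[OF assms(2), of T "\<lambda>_. T"] assms(1)
    by (simp add: bounded_linear_imp_has_derivative del: Ck_on.simps(2))
qed

lemma Ck_on_add:
  assumes "open S" "Ck_on k S f" "Ck_on k S g"
  shows "Ck_on k S (\<lambda>x. f x + g x)"
  using assms(2,3)
proof (induction k arbitrary: f g)
  case (Suc k)
  show ?case
  proof (rule Ck_on_SucI[OF assms(1)])
    show "((\<lambda>x. f x + g x) has_derivative (\<lambda>v. dir_deriv v f x + dir_deriv v g x)) (at x)"
      if "x \<in> S" for x
      using has_derivative_add[OF Ck_on_SucD[OF Suc.prems(1) that] Ck_on_SucD[OF Suc.prems(2) that]] .
    show "Ck_on k S (\<lambda>x. dir_deriv v f x + dir_deriv v g x)" for v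
      using Suc by simp
  qed
qed (simp add: continuous_on_add)

lemma Ck_on_sum:
  assumes "open S" "\<And>i. i \<in> I \<Longrightarrow> Ck_on k S (f i)"
  shows "Ck_on k S (\<lambda>x. \<Sum>i\<in>I. f i x)"
  using assms(2) by (induction I rule: infinite_finite_induct) (auto intro: Ck_on_add[OF assms(1)])

lemma Ck_on_scaleR:
  assumes "open S" "Ck_on k S f" "Ck_on k S g"
  shows "Ck_on k S (\<lambda>x. f x *\<^sub>R g x)"
  using assms(2,3)
proof (induction k arbitrary: f g)
  case (Suc k)
  show ?case
  proof (rule Ck_on_SucI[OF assms(1)])
    show "((\<lambda>x. f x *\<^sub>R g x) has_derivative
        (\<lambda>v. f x *\<^sub>R dir_deriv v g x + dir_deriv v f x *\<^sub>R g x)) (at x)" if "x \<in> S" for x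
      using has_derivative_scaleR[OF Ck_on_SucD[OF Suc.prems(1) that] Ck_on_SucD[OF Suc.prems(2) that]] .
    show "Ck_on k S (\<lambda>x. f x *\<^sub>R dir_deriv v g x + dir_deriv v f x *\<^sub>R g x)" for v
      using Suc.prems Ck_on_Suc_imp_Ck_on[OF Suc.prems(1)] Ck_on_Suc_imp_Ck_on[OF Suc.prems(2)]
      by (intro Ck_on_add[OF assms(1)] Suc.IH) auto
  qed
qed (simp add: continuous_on_scaleR)

lemma linear_expand_Basis:
  fixes v :: "'c::euclidean_space"
  assumes "linear F"
  shows "F v = (\<Sum>b\<in>Basis. (v \<bullet> b) *\<^sub>R F b)"
  using linear_sum[OF assms, of "\<lambda>b. (v \<bullet> b) *\<^sub>R b" Basis]
  by (simp add: euclidean_representation linear_scale[OF assms])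

text \<open>The chain rule yields a derivative of \<open>f\<close> in a direction that varies with the point.
  Expanding that direction in a basis leaves derivatives in fixed directions, to which the induction
  hypothesis applies.\<close>

lemma Ck_on_compose:
  fixes g :: "'a::real_normed_vector \<Rightarrow> 'c::euclidean_space"
  assumes "open S" "open U" "Ck_on k U f" "Ck_on k S g" "\<And>x. x \<in> S \<Longrightarrow> g x \<in> U"
  shows "Ck_on k S (\<lambda>x. f (g x))"
  using assms(3,4)
proof (induction k arbitrary: f)
  case 0
  then show ?case using assms(5) by (auto intro: continuous_on_compose2)
next
  case (Suc k)
  let ?F = "\<lambda>x v. \<Sum>b\<in>Basis. (dir_deriv v g x \<bullet> b) *\<^sub>R dir_deriv b f (g x)"
  show ?case
  proof (rule Ck_on_SucI[OF assms(1)])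
    fix x assume x: "x \<in> S"
    have f: "(f has_derivative (\<lambda>v. dir_deriv v f (g x))) (at (g x))"
      using Ck_on_SucD[OF Suc.prems(1)] assms(5) x by blast
    have "((\<lambda>x. f (g x)) has_derivative (\<lambda>v. dir_deriv (dir_deriv v g x) f (g x))) (at x)"
      using has_derivative_compose[OF Ck_on_SucD[OF Suc.prems(2) x] f] .
    moreover have "dir_deriv (dir_deriv v g x) f (g x) = ?F x v" for v
      using linear_expand_Basis[OF has_derivative_linear[OF f]] .
    ultimately show "((\<lambda>x. f (g x)) has_derivative ?F x) (at x)"
      by simp
  next
    fix v
    show "Ck_on k S (\<lambda>x. ?F x v)"
    proof (intro Ck_on_sum Ck_on_scaleR assms(1))
      fix b :: 'c
      show "Ck_on k S (\<lambda>x. dir_deriv v g x \<bullet> b)"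
        by (rule Ck_on_bounded_linear_compose[OF bounded_linear_inner_left assms(1)])
          (use Suc.prems(2) in simp)
      show "Ck_on k S (\<lambda>x. dir_deriv b f (g x))"
        using Suc.prems(1) Ck_on_Suc_imp_Ck_on[OF Suc.prems(2)] by (intro Suc.IH) auto
    qed
  qed
qed

lemma smooth_on_has_derivative:
  assumes "smooth_on S f" "x \<in> S"
  shows "(f has_derivative (\<lambda>v. dir_deriv v f x)) (at x)"
  using assms Ck_on_SucD[of 0 S f x] unfolding smooth_on_def by blast

lemma smooth_on_dir_deriv: "smooth_on S f \<Longrightarrow> smooth_on S (dir_deriv v f)"
  unfolding smooth_on_def using Ck_on.simps(2)[of _ S f] by blast

lemma smooth_on_imp_continuous_on: "smooth_on S f \<Longrightarrow> continuous_on S f"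
  unfolding smooth_on_def using Ck_on.simps(1) by blast

lemma smooth_on_cong:
  "open S \<Longrightarrow> smooth_on S f \<Longrightarrow> (\<And>x. x \<in> S \<Longrightarrow> f x = g x) \<Longrightarrow> smooth_on S g"
  unfolding smooth_on_def using Ck_on_cong by blast

lemma smooth_on_subset: "smooth_on S f \<Longrightarrow> R \<subseteq> S \<Longrightarrow> smooth_on R f"
  unfolding smooth_on_def using Ck_on_subset by blast

lemma smooth_on_const: "smooth_on S (\<lambda>x. c)"
  unfolding smooth_on_def by simp

lemma smooth_on_bounded_linear: "bounded_linear T \<Longrightarrow> open S \<Longrightarrow> smooth_on S T"
  unfolding smooth_on_def using Ck_on_bounded_linear by blast

lemma smooth_on_add:
  "open S \<Longrightarrow> smooth_on S f \<Longrightarrow> smooth_on S g \<Longrightarrow> smooth_on S (\<lambda>x. f x + g x)"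
  unfolding smooth_on_def using Ck_on_add by blast

lemma smooth_on_sum:
  "open S \<Longrightarrow> (\<And>i. i \<in> I \<Longrightarrow> smooth_on S (f i)) \<Longrightarrow> smooth_on S (\<lambda>x. \<Sum>i\<in>I. f i x)"
  unfolding smooth_on_def by (simp add: Ck_on_sum)

lemma smooth_on_scaleR:
  "open S \<Longrightarrow> smooth_on S f \<Longrightarrow> smooth_on S g \<Longrightarrow> smooth_on S (\<lambda>x. f x *\<^sub>R g x)"
  unfolding smooth_on_def using Ck_on_scaleR by blast

lemma smooth_on_mult:
  fixes f g :: "'a::real_normed_vector \<Rightarrow> real"
  shows "open S \<Longrightarrow> smooth_on S f \<Longrightarrow> smooth_on S g \<Longrightarrow> smooth_on S (\<lambda>x. f x * g x)"
  using smooth_on_scaleR[of S f g] by simp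

lemma smooth_on_minus:
  fixes f g :: "'a::real_normed_vector \<Rightarrow> real"
  shows "open S \<Longrightarrow> smooth_on S f \<Longrightarrow> smooth_on S g \<Longrightarrow> smooth_on S (\<lambda>x. f x - g x)"
  using smooth_on_add[of S f "\<lambda>x. (-1) * g x"] smooth_on_mult[of S "\<lambda>x. -1" g]
  by (simp add: smooth_on_const)

lemma smooth_on_compose:
  fixes g :: "'a::real_normed_vector \<Rightarrow> 'c::euclidean_space"
  shows "open S \<Longrightarrow> open U \<Longrightarrow> smooth_on U f \<Longrightarrow> smooth_on S g \<Longrightarrow> (\<And>x. x \<in> S \<Longrightarrow> g x \<in> U) \<Longrightarrow>
    smooth_on S (\<lambda>x. f (g x))"
  unfolding smooth_on_def using Ck_on_compose by blast

section \<open>Symmetry of second derivatives and integrals with parameters\<close>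

text \<open>The mean value theorem, applied once along \<open>v\<close> and once along \<open>w\<close>. The second
  difference is symmetric in \<open>v\<close> and \<open>w\<close>, whereas the derivative on the right depends on the
  order; this is what makes mixed derivatives agree.\<close>

lemma second_difference_mean_value:
  fixes f :: "'a::real_normed_vector \<Rightarrow> real"
  assumes "smooth_on S f" "0 < h"
    and S: "\<And>s t. 0 \<le> s \<Longrightarrow> s \<le> h \<Longrightarrow> 0 \<le> t \<Longrightarrow> t \<le> h \<Longrightarrow> x + s *\<^sub>R v + t *\<^sub>R w \<in> S"
  obtains s t where "0 < s" "s < h" "0 < t" "t < h"
    and "f (x + h *\<^sub>R v + h *\<^sub>R w) - f (x + h *\<^sub>R v) - f (x + h *\<^sub>R w) + f x
      = h * (h * dir_deriv w (dir_deriv v f) (x + s *\<^sub>R v + t *\<^sub>R w))"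
proof -
  let ?d = "\<lambda>s t. dir_deriv v f (x + s *\<^sub>R v + t *\<^sub>R w)"
  have d: "((\<lambda>s. f (x + s *\<^sub>R v + t *\<^sub>R w)) has_real_derivative ?d s t) (at s)"
    if "0 \<le> s" "s \<le> h" "0 \<le> t" "t \<le> h" for s t
  proof -
    have f: "(f has_derivative (\<lambda>u. dir_deriv u f (x + s *\<^sub>R v + t *\<^sub>R w))) (at (x + s *\<^sub>R v + t *\<^sub>R w))"
      using smooth_on_has_derivative[OF assms(1) S[OF that]] .
    have "((\<lambda>s. x + s *\<^sub>R v + t *\<^sub>R w) has_derivative (\<lambda>r. r *\<^sub>R v)) (at s)"
      by (auto intro!: derivative_eq_intros)
    from has_derivative_compose[OF this f] show ?thesis
      by (simp add: has_field_derivative_def linear_scale[OF has_derivative_linear[OF f]]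
          mult_commute_abs)
  qed
  have "\<exists>s>0. s < h \<and> f (x + h *\<^sub>R v + h *\<^sub>R w) - f (x + h *\<^sub>R v + 0 *\<^sub>R w)
      - (f (x + 0 *\<^sub>R v + h *\<^sub>R w) - f (x + 0 *\<^sub>R v + 0 *\<^sub>R w)) = (h - 0) * (?d s h - ?d s 0)"
    by (rule MVT2[OF assms(2)])
      (auto intro!: DERIV_diff d simp: assms(2) less_imp_le simp del: scaleR_zero_left)
  then obtain s where s: "0 < s" "s < h" and
    1: "f (x + h *\<^sub>R v + h *\<^sub>R w) - f (x + h *\<^sub>R v) - (f (x + h *\<^sub>R w) - f x) = h * (?d s h - ?d s 0)"
    by auto
  have e: "((\<lambda>t. ?d s t) has_real_derivative dir_deriv w (dir_deriv v f) (x + s *\<^sub>R v + t *\<^sub>R w)) (at t)"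
    if "0 \<le> t" "t \<le> h" for t
  proof -
    let ?p = "x + s *\<^sub>R v + t *\<^sub>R w"
    have f: "(dir_deriv v f has_derivative (\<lambda>u. dir_deriv u (dir_deriv v f) ?p)) (at ?p)"
      using smooth_on_has_derivative[OF smooth_on_dir_deriv[OF assms(1)] S[OF _ _ that]] s by simp
    have "((\<lambda>t. x + s *\<^sub>R v + t *\<^sub>R w) has_derivative (\<lambda>r. r *\<^sub>R w)) (at t)"
      by (auto intro!: derivative_eq_intros)
    from has_derivative_compose[OF this f] show ?thesis
      by (simp add: has_field_derivative_def linear_scale[OF has_derivative_linear[OF f]]
          mult_commute_abs)
  qed
  have "\<exists>t>0. t < h \<and> ?d s h - ?d s 0
      = (h - 0) * dir_deriv w (dir_deriv v f) (x + s *\<^sub>R v + t *\<^sub>R w)"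
    by (rule MVT2[OF assms(2)]) (use e in auto)
  then obtain t where "0 < t" "t < h"
    and "?d s h - ?d s 0 = h * dir_deriv w (dir_deriv v f) (x + s *\<^sub>R v + t *\<^sub>R w)"
    by auto
  with s 1 that show ?thesis by (simp add: algebra_simps)
qed

text \<open>Schwarz's theorem: both mixed derivatives are limits of the same second difference quotient.\<close>

lemma dir_deriv_commute:
  fixes f :: "'a::real_normed_vector \<Rightarrow> real"
  assumes "open S" "smooth_on S f" "x \<in> S"
  shows "dir_deriv v (dir_deriv w f) x = dir_deriv w (dir_deriv v f) x"
proof (rule ccontr)
  let ?f = "dir_deriv v (dir_deriv w f)" and ?g = "dir_deriv w (dir_deriv v f)"
  assume ne: "?f x \<noteq> ?g x"
  define e where "e = \<bar>?f x - ?g x\<bar> / 2"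
  have e: "0 < e" using ne by (simp add: e_def)
  have cont: "continuous_on S ?f" "continuous_on S ?g"
    by (intro smooth_on_imp_continuous_on smooth_on_dir_deriv assms(2))+
  obtain d0 where d0: "0 < d0" "ball x d0 \<subseteq> S"
    using assms(1,3) openE by blast
  obtain d1 where d1: "0 < d1" "\<And>y. y \<in> S \<Longrightarrow> dist y x < d1 \<Longrightarrow> dist (?f y) (?f x) < e"
    using cont(1) assms(3) e unfolding continuous_on_iff by metis
  obtain d2 where d2: "0 < d2" "\<And>y. y \<in> S \<Longrightarrow> dist y x < d2 \<Longrightarrow> dist (?g y) (?g x) < e"
    using cont(2) assms(3) e unfolding continuous_on_iff by metis
  define d where "d = min d0 (min d1 d2)"
  have d: "0 < d" using d0 d1 d2 by (simp add: d_def)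
  define h where "h = d / (2 * (norm v + norm w + 1))"
  have n: "0 < norm v + norm w + 1" by (simp add: add_nonneg_pos)
  have h: "0 < h" using d n by (simp add: h_def)
  have near: "norm (s *\<^sub>R v + t *\<^sub>R w) < d" if "0 \<le> s" "s \<le> h" "0 \<le> t" "t \<le> h" for s t
  proof -
    have "norm (s *\<^sub>R v + t *\<^sub>R w) \<le> s * norm v + t * norm w"
      using norm_triangle_ineq[of "s *\<^sub>R v" "t *\<^sub>R w"] that by simp
    also have "\<dots> \<le> h * norm v + h * norm w"
      using that by (intro add_mono mult_right_mono) auto
    also have "\<dots> \<le> h * (norm v + norm w + 1)"
      using h by (simp add: algebra_simps)
    also have "\<dots> = d / 2" using n by (simp add: h_def field_simps)
    also have "\<dots> < d" using d by simp
    finally show ?thesis .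
  qed
  have dst: "dist (x + a + b) x = norm (a + b)" for a b :: 'a
    by (simp add: dist_norm add.assoc)
  have inS: "x + s *\<^sub>R v + t *\<^sub>R w \<in> S" if "0 \<le> s" "s \<le> h" "0 \<le> t" "t \<le> h" for s t
    using near[OF that] d0 dst[of "s *\<^sub>R v" "t *\<^sub>R w"] unfolding d_def
    by (auto simp: dist_commute mem_ball subset_iff)
  obtain s t where st: "0 < s" "s < h" "0 < t" "t < h" and
    1: "f (x + h *\<^sub>R v + h *\<^sub>R w) - f (x + h *\<^sub>R v) - f (x + h *\<^sub>R w) + f x
      = h * (h * ?g (x + s *\<^sub>R v + t *\<^sub>R w))"
    using second_difference_mean_value[OF assms(2) h inS] by blast
  have inS': "x + t *\<^sub>R w + s *\<^sub>R v \<in> S" if "0 \<le> t" "t \<le> h" "0 \<le> s" "s \<le> h" for s t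
    using inS[of s t] that by (simp add: algebra_simps)
  obtain t' s' where st': "0 < t'" "t' < h" "0 < s'" "s' < h" and
    2: "f (x + h *\<^sub>R w + h *\<^sub>R v) - f (x + h *\<^sub>R w) - f (x + h *\<^sub>R v) + f x
      = h * (h * ?f (x + t' *\<^sub>R w + s' *\<^sub>R v))"
    using second_difference_mean_value[OF assms(2) h inS'] by blast
  have "f (x + h *\<^sub>R w + h *\<^sub>R v) = f (x + h *\<^sub>R v + h *\<^sub>R w)"
    by (simp add: algebra_simps)
  then have "h * (h * ?g (x + s *\<^sub>R v + t *\<^sub>R w)) = h * (h * ?f (x + t' *\<^sub>R w + s' *\<^sub>R v))"
    using 1 2 by linarith
  then have eq: "?g (x + s *\<^sub>R v + t *\<^sub>R w) = ?f (x + t' *\<^sub>R w + s' *\<^sub>R v)"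
    using h by simp
  have "dist (?g (x + s *\<^sub>R v + t *\<^sub>R w)) (?g x) < e"
    using st inS near[of s t] by (intro d2) (auto simp: dst d_def)
  moreover have "dist (?f (x + t' *\<^sub>R w + s' *\<^sub>R v)) (?f x) < e"
  proof (rule d1(2))
    show "x + t' *\<^sub>R w + s' *\<^sub>R v \<in> S" using st' inS' by simp
    have "dist (x + t' *\<^sub>R w + s' *\<^sub>R v) x = norm (s' *\<^sub>R v + t' *\<^sub>R w)"
      using dst[of "t' *\<^sub>R w" "s' *\<^sub>R v"] by (simp only: add.commute)
    then show "dist (x + t' *\<^sub>R w + s' *\<^sub>R v) x < d1"
      using st' near[of s' t'] by (simp add: d_def)
  qed
  ultimately show False
    using eq ne unfolding e_def dist_real_def by (smt (verit) field_sum_of_halves)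
qed

text \<open>Differentiation under the integral sign. The weight $s^n$ makes the family of integrals closed
  under differentiation, as each derivative along \<open>T1\<close> brings out another factor $s$.\<close>

lemma has_derivative_integral_affine:
  fixes h :: "'a::euclidean_space \<Rightarrow> real" and T0 T1 :: "'c::euclidean_space \<Rightarrow> 'a"
  assumes T: "linear T0" "linear T1" and S: "open S" "x \<in> S"
    and U: "\<And>x s. x \<in> S \<Longrightarrow> 0 \<le> s \<Longrightarrow> s \<le> 1 \<Longrightarrow> T0 x + s *\<^sub>R T1 x \<in> U"
    and h: "Ck_on 1 U h"
  shows "((\<lambda>x. integral {0..1} (\<lambda>s. s ^ n * h (T0 x + s *\<^sub>R T1 x))) has_derivative
    (\<lambda>v. integral {0..1} (\<lambda>s. s ^ n * dir_deriv (T0 v) h (T0 x + s *\<^sub>R T1 x))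
       + integral {0..1} (\<lambda>s. s ^ Suc n * dir_deriv (T1 v) h (T0 x + s *\<^sub>R T1 x)))) (at x)"
proof -
  obtain r where r: "0 < r" "ball x r \<subseteq> S" using S openE by blast
  have h': "(h has_derivative (\<lambda>v. dir_deriv v h y)) (at y)" if "y \<in> U" for y
    using Ck_on_SucD[of 0 U h y] h that by simp
  have lin: "linear (\<lambda>v. dir_deriv v h y)" if "y \<in> U" for y
    using has_derivative_linear[OF h'[OF that]] .
  let ?g = "\<lambda>x s v. s ^ n * dir_deriv (T0 v + s *\<^sub>R T1 v) h (T0 x + s *\<^sub>R T1 x)"
  have blT: "bounded_linear T0" "bounded_linear T1"
    using T linear_conv_bounded_linear by blast+
  have der: "((\<lambda>x. s ^ n * h (T0 x + s *\<^sub>R T1 x)) has_derivative ?g y s) (at y)"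
    if "y \<in> S" "0 \<le> s" "s \<le> 1" for y s
  proof -
    have "((\<lambda>x. T0 x + s *\<^sub>R T1 x) has_derivative (\<lambda>v. T0 v + s *\<^sub>R T1 v)) (at y)"
      by (intro has_derivative_add has_derivative_scaleR_right
          bounded_linear_imp_has_derivative blT)
    from has_derivative_compose[OF this h'[OF U[OF that]]]
    show ?thesis by (rule has_derivative_mult_right)
  qed
  have bl: "bounded_linear (?g y s)" if "y \<in> S" "0 \<le> s" "s \<le> 1" for y s
    using has_derivative_bounded_linear[OF der[OF that]] .
  have contT: "continuous_on R T0" "continuous_on R T1" for R
    using blT linear_continuous_on by blast+
  have contp: "continuous_on (S \<times> {0..1}) (\<lambda>p. T0 (fst p) + snd p *\<^sub>R T1 (fst p))"
    by (intro continuous_intros continuous_on_compose2[OF contT(1)] continuous_on_compose2[OF contT(2)])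
      auto
  have contd: "continuous_on (S \<times> {0..1}) (\<lambda>p. dir_deriv v h (T0 (fst p) + snd p *\<^sub>R T1 (fst p)))" for v
    by (rule continuous_on_compose2[OF _ contp, of U]) (use h U in auto)
  have conth: "continuous_on (S \<times> {0..1}) (\<lambda>p. h (T0 (fst p) + snd p *\<^sub>R T1 (fst p)))"
    by (rule continuous_on_compose2[OF _ contp, of U])
      (use Ck_on_imp_continuous_on[OF h] U in auto)
  note slice = continuous_on_compose2[where f = "\<lambda>s. (y, s)" and s = "{0..1}" for y]
  have geq: "?g y s v = s ^ n * dir_deriv (T0 v) h (T0 y + s *\<^sub>R T1 y)
      + s ^ Suc n * dir_deriv (T1 v) h (T0 y + s *\<^sub>R T1 y)"
    if "y \<in> S" "0 \<le> s" "s \<le> 1" for y s v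
    using linear_add[OF lin[OF U[OF that]]] linear_scale[OF lin[OF U[OF that]]]
    by (simp add: algebra_simps)
  let ?G = "\<lambda>y s. Blinfun (?g y s)"
  have app: "blinfun_apply (?G y s) = ?g y s" if "y \<in> S" "0 \<le> s" "s \<le> 1" for y s
    using bounded_linear_Blinfun_apply[OF bl[OF that]] .
  have sub: "ball x r \<times> cbox 0 1 \<subseteq> S \<times> {0..1::real}" using r by auto
  have contG: "continuous_on (S \<times> {0..1}) (\<lambda>(y, s). ?G y s)"
  proof (rule continuous_on_blinfun_componentwise)
    fix i :: 'c
    have "continuous_on (S \<times> {0..1}) (\<lambda>p. snd p ^ n * dir_deriv (T0 i) h (T0 (fst p) + snd p *\<^sub>R T1 (fst p))
      + snd p ^ Suc n * dir_deriv (T1 i) h (T0 (fst p) + snd p *\<^sub>R T1 (fst p)))"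
      by (intro continuous_intros contd)
    then show "continuous_on (S \<times> {0..1}) (\<lambda>p. blinfun_apply (case p of (y, s) \<Rightarrow> ?G y s) i)"
      by (rule continuous_on_eq) (auto simp add: app geq[symmetric] simp del: power_Suc)
  qed
  have int: "(\<lambda>s. s ^ n * h (T0 y + s *\<^sub>R T1 y)) integrable_on cbox 0 1" if "y \<in> S" for y
    by (rule integrable_continuous)
      (use that in \<open>auto intro!: continuous_intros slice[OF conth, of y, simplified]\<close>)
  have "((\<lambda>x. integral (cbox 0 1) (\<lambda>s. s ^ n * h (T0 x + s *\<^sub>R T1 x))) has_derivative
      blinfun_apply (integral (cbox 0 1) (?G x))) (at x within ball x r)"
  proof (rule leibniz_rule)
    show "((\<lambda>x. s ^ n * h (T0 x + s *\<^sub>R T1 x)) has_derivative blinfun_apply (?G y s)) (at y within ball x r)"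
      if "y \<in> ball x r" "s \<in> cbox 0 1" for y s
    proof -
      have y: "y \<in> S" "0 \<le> s" "s \<le> 1" using that r by auto
      show ?thesis
        unfolding app[OF y] using der[OF y] by (rule has_derivative_at_withinI)
    qed
    show "continuous_on (ball x r \<times> cbox 0 1) (\<lambda>(y, s). ?G y s)"
      using continuous_on_subset[OF contG sub] .
  qed (use int r in auto)
  moreover have "blinfun_apply (integral (cbox 0 1) (?G x)) v =
      integral {0..1} (\<lambda>s. s ^ n * dir_deriv (T0 v) h (T0 x + s *\<^sub>R T1 x))
       + integral {0..1} (\<lambda>s. s ^ Suc n * dir_deriv (T1 v) h (T0 x + s *\<^sub>R T1 x))" for v
  proof -
    have "?G x integrable_on cbox 0 1"
    proof (rule integrable_continuous)
      have "continuous_on {0..1} (\<lambda>s. (\<lambda>(y, s). ?G y s) (x, s))"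
        by (rule slice[OF contG]) (use S in \<open>auto intro!: continuous_intros\<close>)
      then show "continuous_on (cbox 0 1) (?G x)" by (simp add: cbox_interval)
    qed
    then have "blinfun_apply (integral (cbox 0 1) (?G x)) v = integral (cbox 0 1) (\<lambda>s. blinfun_apply (?G x s) v)"
      using blinfun_apply_integral by blast
    also have "\<dots> = integral {0..1} (\<lambda>s. s ^ n * dir_deriv (T0 v) h (T0 x + s *\<^sub>R T1 x)
        + s ^ Suc n * dir_deriv (T1 v) h (T0 x + s *\<^sub>R T1 x))"
      unfolding cbox_interval by (intro integral_cong) (simp add: app[OF S(2)] geq[OF S(2), symmetric] del: power_Suc)
    also have "\<dots> = integral {0..1} (\<lambda>s. s ^ n * dir_deriv (T0 v) h (T0 x + s *\<^sub>R T1 x))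
       + integral {0..1} (\<lambda>s. s ^ Suc n * dir_deriv (T1 v) h (T0 x + s *\<^sub>R T1 x))"
      by (intro integral_add integrable_continuous_real continuous_intros
          slice[OF contd, of x, simplified]) (use S in auto)
    finally show ?thesis .
  qed
  moreover have "at x within ball x r = at x"
    using r by (intro at_within_open) auto
  ultimately show ?thesis
    by (auto simp only: cbox_interval elim!: has_derivative_eq_rhs)
qed

lemma Ck_on_integral_affine:
  fixes h :: "'a::euclidean_space \<Rightarrow> real" and T0 T1 :: "'c::euclidean_space \<Rightarrow> 'a"
  assumes T: "linear T0" "linear T1" and S: "open S"
    and U: "\<And>x s. x \<in> S \<Longrightarrow> 0 \<le> s \<Longrightarrow> s \<le> 1 \<Longrightarrow> T0 x + s *\<^sub>R T1 x \<in> U"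
    and h: "Ck_on (Suc k) U h"
  shows "Ck_on k S (\<lambda>x. integral {0..1} (\<lambda>s. s ^ n * h (T0 x + s *\<^sub>R T1 x)))"
  using h
proof (induction k arbitrary: h n)
  case 0
  then have "Ck_on 1 U h" by simp
  from has_derivative_integral_affine[OF T S _ U this]
  show ?case
    by (auto intro!: continuous_at_imp_continuous_on has_derivative_continuous)
next
  case (Suc k)
  have "continuous_on U (dir_deriv v h)" for v
    by (rule Ck_on_imp_continuous_on[where k = "Suc k"]) (use Ck_on.simps(2)[of "Suc k" U h] Suc.prems in blast)
  then have 1: "Ck_on 1 U h"
    using Suc.prems by simp
  show ?case
  proof (rule Ck_on_SucI[OF S has_derivative_integral_affine[OF T S _ U 1]])
    have "Ck_on (Suc k) U (dir_deriv v h)" for v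
      using Ck_on.simps(2)[of "Suc k" U h] Suc.prems by blast
    then show "Ck_on k S (\<lambda>x. integral {0..1} (\<lambda>s. s ^ n * dir_deriv (T0 v) h (T0 x + s *\<^sub>R T1 x))
       + integral {0..1} (\<lambda>s. s ^ Suc n * dir_deriv (T1 v) h (T0 x + s *\<^sub>R T1 x)))" for v
      by (intro Ck_on_add S Suc.IH)
  qed
qed

lemma smooth_on_integral_affine:
  fixes h :: "'a::euclidean_space \<Rightarrow> real" and T0 T1 :: "'c::euclidean_space \<Rightarrow> 'a"
  assumes T: "linear T0" "linear T1" and S: "open S"
    and U: "\<And>x s. x \<in> S \<Longrightarrow> 0 \<le> s \<Longrightarrow> s \<le> 1 \<Longrightarrow> T0 x + s *\<^sub>R T1 x \<in> U"
    and h: "smooth_on U h"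
  shows "smooth_on S (\<lambda>x. integral {0..1} (\<lambda>s. s ^ n * h (T0 x + s *\<^sub>R T1 x)))"
  using Ck_on_integral_affine[OF T S U] h unfolding smooth_on_def by blast


lemma smooth_on_linear_dir_deriv:
  assumes "smooth_on S f" "x \<in> S"
  shows "linear (\<lambda>v. dir_deriv v f x)"
  using has_derivative_linear[OF smooth_on_has_derivative[OF assms]] .

lemma dir_deriv_eqI: "(f has_derivative F) (at x) \<Longrightarrow> dir_deriv v f x = F v"
  using frechet_derivative_at[of f F x] by simp

text \<open>Linearity in the inner direction, in contrast to the outer one, uses the linearity of the
  derivative at all points near \<open>x\<close>.\<close>

lemma linear_dir_deriv_dir_deriv:
  assumes "open S" "smooth_on S f" "x \<in> S"
  shows "linear (\<lambda>v. dir_deriv u (dir_deriv v f) x)"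
proof (rule linearI)
  have d: "(dir_deriv v f has_derivative (\<lambda>u. dir_deriv u (dir_deriv v f) x)) (at x)" for v
    using smooth_on_has_derivative[OF smooth_on_dir_deriv[OF assms(2)] assms(3)] .
  fix v w :: 'a and r :: real
  have "dir_deriv u (dir_deriv (v + w) f) x = dir_deriv u (\<lambda>y. dir_deriv v f y + dir_deriv w f y) x"
    using frechet_derivative_cong_open[OF assms(1,3), of "dir_deriv (v + w) f" "\<lambda>y. dir_deriv v f y + dir_deriv w f y"]
      linear_add[OF smooth_on_linear_dir_deriv[OF assms(2)]] by simp
  also have "\<dots> = dir_deriv u (dir_deriv v f) x + dir_deriv u (dir_deriv w f) x"
    by (rule dir_deriv_eqI[OF has_derivative_add[OF d d]])
  finally show "dir_deriv u (dir_deriv (v + w) f) x = dir_deriv u (dir_deriv v f) x + dir_deriv u (dir_deriv w f) x" .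
  have "dir_deriv u (dir_deriv (r *\<^sub>R v) f) x = dir_deriv u (\<lambda>y. r *\<^sub>R dir_deriv v f y) x"
    using frechet_derivative_cong_open[OF assms(1,3), of "dir_deriv (r *\<^sub>R v) f" "\<lambda>y. r *\<^sub>R dir_deriv v f y"]
      linear_scale[OF smooth_on_linear_dir_deriv[OF assms(2)]] by simp
  also have "\<dots> = r *\<^sub>R dir_deriv u (dir_deriv v f) x"
    by (rule dir_deriv_eqI[OF has_derivative_scaleR_right[OF d]])
  finally show "dir_deriv u (dir_deriv (r *\<^sub>R v) f) x = r *\<^sub>R dir_deriv u (dir_deriv v f) x" .
qed

text \<open>The product rule when the base point \<open>\<pi> q\<close> and the direction \<open>\<tau> q\<close> both move. Total
  derivatives and the velocity and acceleration components of transition maps have this shape.\<close>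

lemma has_derivative_dir_deriv:
  fixes f :: "'a::euclidean_space \<Rightarrow> 'b::real_normed_vector"
  assumes S: "open S" "smooth_on S f" and N: "open N" "p \<in> N" "\<And>q. q \<in> N \<Longrightarrow> \<pi> q \<in> S"
    and \<pi>: "(\<pi> has_derivative \<pi>') (at p)" and \<tau>: "(\<tau> has_derivative \<tau>') (at p)"
  shows "((\<lambda>q. dir_deriv (\<tau> q) f (\<pi> q)) has_derivative
    (\<lambda>w. dir_deriv (\<pi>' w) (dir_deriv (\<tau> p) f) (\<pi> p) + dir_deriv (\<tau>' w) f (\<pi> p))) (at p)"
proof -
  have p: "\<pi> p \<in> S" using N by blast
  have "((\<lambda>q. \<Sum>b\<in>Basis. (\<tau> q \<bullet> b) *\<^sub>R dir_deriv b f (\<pi> q)) has_derivative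
      (\<lambda>w. \<Sum>b\<in>Basis. (\<tau> p \<bullet> b) *\<^sub>R dir_deriv (\<pi>' w) (dir_deriv b f) (\<pi> p)
        + (\<tau>' w \<bullet> b) *\<^sub>R dir_deriv b f (\<pi> p))) (at p)"
    by (intro has_derivative_sum has_derivative_scaleR has_derivative_inner_left \<tau>
        has_derivative_compose[OF \<pi> smooth_on_has_derivative[OF smooth_on_dir_deriv[OF S(2)] p]])
  moreover have "(\<Sum>b\<in>Basis. (\<tau> p \<bullet> b) *\<^sub>R dir_deriv u (dir_deriv b f) (\<pi> p)
        + (w \<bullet> b) *\<^sub>R dir_deriv b f (\<pi> p))
      = dir_deriv u (dir_deriv (\<tau> p) f) (\<pi> p) + dir_deriv w f (\<pi> p)" for u w
    by (simp only: sum.distrib linear_expand_Basis[OF linear_dir_deriv_dir_deriv[OF S p], symmetric]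
        linear_expand_Basis[OF smooth_on_linear_dir_deriv[OF S(2) p], symmetric])
  ultimately have "((\<lambda>q. \<Sum>b\<in>Basis. (\<tau> q \<bullet> b) *\<^sub>R dir_deriv b f (\<pi> q)) has_derivative
      (\<lambda>w. dir_deriv (\<pi>' w) (dir_deriv (\<tau> p) f) (\<pi> p) + dir_deriv (\<tau>' w) f (\<pi> p))) (at p)"
    by simp
  then show ?thesis
    by (rule has_derivative_transform_within_open[OF _ N(1,2)])
      (rule linear_expand_Basis[OF smooth_on_linear_dir_deriv[OF S(2) N(3)], symmetric])
qed


section \<open>Potentials of closed covector fields\<close>

text \<open>The line integral of the covector field $F_l\,dv^l$ along the segment from $0$ to $v$.\<close>

definition radial_potential :: "('m \<Rightarrow> real ^ 'm \<Rightarrow> real) \<Rightarrow> real ^ 'm::finite \<Rightarrow> real" where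
  "radial_potential F v = (\<Sum>l\<in>UNIV. v $ l * integral {0..1} (\<lambda>s. F l (s *\<^sub>R v)))"

lemma vec_expand_axis: "v = (\<Sum>k\<in>UNIV. (v $ k) *\<^sub>R axis k (1::real))"
  by (simp add: vec_eq_iff axis_def if_distrib cong: if_cong)

lemma linear_expand_axis:
  fixes v :: "real ^ 'm::finite"
  assumes "linear F"
  shows "F v = (\<Sum>k\<in>UNIV. v $ k *\<^sub>R F (axis k 1))"
proof -
  have "F v = F (\<Sum>k\<in>UNIV. (v $ k) *\<^sub>R axis k 1)" using vec_expand_axis[of v] by simp
  then show ?thesis by (simp add: linear_sum[OF assms] linear_scale[OF assms])
qed

text \<open>Poincare's lemma. Closedness turns $\sum_l v^l D_h F_l$ into $\sum_l h^l D_v F_l$, after which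
  the integrand of the derivative is $\sum_l h^l \frac{d}{ds}(s F_l(sv))$.\<close>

lemma radial_potential_gradient:
  fixes F :: "'m::finite \<Rightarrow> real ^ 'm \<Rightarrow> real"
  assumes F: "\<And>l. smooth_on UNIV (F l)"
    and closed: "\<And>k l v. dir_deriv (axis k 1) (F l) v = dir_deriv (axis l 1) (F k) v"
  shows "(radial_potential F has_derivative (\<lambda>h. \<Sum>l\<in>UNIV. h $ l * F l v)) (at v)"
proof -
  let ?I = "\<lambda>l v. integral {0..1} (\<lambda>s. F l (s *\<^sub>R v))"
  let ?J = "\<lambda>l h. integral {0..1} (\<lambda>s. s * dir_deriv h (F l) (s *\<^sub>R v))"
  have C1: "Ck_on 1 UNIV (F l)" for l
    using F[of l] unfolding smooth_on_def by blast
  have lin: "linear (\<lambda>h. dir_deriv h (F l) y)" for l y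
    using smooth_on_linear_dir_deriv[OF F] by simp
  have cont: "continuous_on R (\<lambda>s. F l (s *\<^sub>R v))" for l R
    by (rule continuous_on_compose2[OF smooth_on_imp_continuous_on[OF F[of l]]])
      (auto intro!: continuous_intros)
  have contd: "continuous_on R (\<lambda>s. s * dir_deriv h (F l) (s *\<^sub>R v))" for l h R
    by (intro continuous_intros
      continuous_on_compose2[OF smooth_on_imp_continuous_on[OF smooth_on_dir_deriv[OF F[of l]]]])
      (auto intro!: continuous_intros)
  have I: "(?I l has_derivative ?J l) (at v)" for l
    using has_derivative_integral_affine[of "\<lambda>_. 0" "\<lambda>v. v" UNIV v UNIV "F l" 0]
      C1 linear_0[OF lin] linear_zero linear_ident by simp
  have "(radial_potential F has_derivative (\<lambda>h. \<Sum>l\<in>UNIV. v $ l * ?J l h + h $ l * ?I l v)) (at v)"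
    unfolding radial_potential_def
    by (intro has_derivative_sum has_derivative_mult I bounded_linear_imp_has_derivative
        bounded_linear_vec_nth)
  moreover have "(\<Sum>l\<in>UNIV. v $ l * ?J l h + h $ l * ?I l v) = (\<Sum>l\<in>UNIV. h $ l * F l v)" for h
  proof -
    have sym: "(\<Sum>l\<in>UNIV. v $ l * dir_deriv h (F l) y) = (\<Sum>l\<in>UNIV. h $ l * dir_deriv v (F l) y)" for y
    proof -
      have "(\<Sum>l\<in>UNIV. v $ l * dir_deriv h (F l) y)
          = (\<Sum>l\<in>UNIV. \<Sum>k\<in>UNIV. v $ l * (h $ k * dir_deriv (axis k 1) (F l) y))"
        by (subst linear_expand_axis[OF lin]) (simp add: sum_distrib_left)
      also have "\<dots> = (\<Sum>k\<in>UNIV. \<Sum>l\<in>UNIV. v $ l * (h $ k * dir_deriv (axis k 1) (F l) y))"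
        by (rule sum.swap)
      also have "\<dots> = (\<Sum>k\<in>UNIV. \<Sum>l\<in>UNIV. h $ k * (v $ l * dir_deriv (axis l 1) (F k) y))"
        by (intro sum.cong refl) (simp only: closed mult.left_commute)
      also have "\<dots> = (\<Sum>k\<in>UNIV. h $ k * dir_deriv v (F k) y)"
        by (subst linear_expand_axis[OF lin, of _ _ v]) (simp add: sum_distrib_left)
      finally show ?thesis .
    qed
    have int: "(\<lambda>s. s * dir_deriv w (F l) (s *\<^sub>R v)) integrable_on {0..1}"
        "(\<lambda>s. F l (s *\<^sub>R v)) integrable_on {0..1}" for w l
      using integrable_continuous_real[OF contd] integrable_continuous_real[OF cont] by auto
    have "(\<Sum>l\<in>UNIV. v $ l * ?J l h) = integral {0..1} (\<lambda>s. \<Sum>l\<in>UNIV. v $ l * (s * dir_deriv h (F l) (s *\<^sub>R v)))"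
      by (subst integral_sum) (auto intro!: integrable_on_mult_right int)
    also have "\<dots> = integral {0..1} (\<lambda>s. \<Sum>l\<in>UNIV. h $ l * (s * dir_deriv v (F l) (s *\<^sub>R v)))"
      using sym by (simp add: mult.left_commute sum_distrib_left[symmetric])
    also have "\<dots> = (\<Sum>l\<in>UNIV. h $ l * ?J l v)"
      by (subst integral_sum) (auto intro!: integrable_on_mult_right int)
    finally have "(\<Sum>l\<in>UNIV. v $ l * ?J l h + h $ l * ?I l v) = (\<Sum>l\<in>UNIV. h $ l * (?J l v + ?I l v))"
      by (simp add: sum.distrib distrib_left)
    moreover have "?J l v + ?I l v = F l v" for l
    proof -
      have d: "((\<lambda>s. s * F l (s *\<^sub>R v)) has_vector_derivative
          (s * dir_deriv v (F l) (s *\<^sub>R v) + F l (s *\<^sub>R v))) (at s within {0..1})" for s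
      proof -
        have "((\<lambda>s. F l (s *\<^sub>R v)) has_derivative (\<lambda>r. dir_deriv (r *\<^sub>R v) (F l) (s *\<^sub>R v))) (at s)"
          by (rule has_derivative_compose[OF _ smooth_on_has_derivative[OF F UNIV_I]])
            (auto intro!: derivative_eq_intros)
        from has_derivative_mult[OF has_derivative_ident this]
        have "((\<lambda>s. s * F l (s *\<^sub>R v)) has_vector_derivative
          (s * dir_deriv v (F l) (s *\<^sub>R v) + F l (s *\<^sub>R v))) (at s)"
          unfolding has_vector_derivative_def
          by (rule has_derivative_eq_rhs) (auto simp: fun_eq_iff linear_scale[OF lin] algebra_simps)
        then show ?thesis by (rule has_vector_derivative_at_within)
      qed
      have "((\<lambda>s. s * dir_deriv v (F l) (s *\<^sub>R v) + F l (s *\<^sub>R v)) has_integral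
          (1 * F l (1 *\<^sub>R v) - 0 * F l (0 *\<^sub>R v))) {0..1}"
        by (rule fundamental_theorem_of_calculus[OF _ d]) simp
      then show ?thesis
        using integral_add[OF int(1)[where w = v and l = l] int(2)[where l = l]]
        by (simp add: integral_unique)
    qed
    ultimately show ?thesis by simp
  qed
  ultimately show ?thesis by simp
qed

lemma sum_axis: "(\<Sum>k\<in>UNIV. r * axis (l::'m::finite) 1 $ k * c k) = r * (c l :: real)"
proof -
  have "(\<Sum>k\<in>UNIV. r * axis l 1 $ k * c k) = (\<Sum>k\<in>UNIV. if k = l then r * c k else 0)"
    by (intro sum.cong) (auto simp: axis_def)
  then show ?thesis by simp
qed

lemma tail_vec_affine: "tail_vec l \<nu> v = tail_vec l 0 v + \<nu> *\<^sub>R axis l 1"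
  by (simp add: tail_vec_def vec_eq_iff axis_def)

text \<open>Each summand is the increment of the potential along one edge of an axis-parallel path from $0$
  to $v$, so the sum telescopes.\<close>

lemma staircase_integral_eq_radial_potential:
  fixes F :: "'m::{finite,linorder} \<Rightarrow> (real, 'm) vec \<Rightarrow> real"
  assumes F: "\<And>l. smooth_on UNIV (F l)"
    and closed: "\<And>k l v. dir_deriv (axis k 1) (F l) v = dir_deriv (axis l 1) (F k) v"
  shows "(\<Sum>l\<in>UNIV. LBINT \<nu>=0..ereal (v $ l). F l (tail_vec l \<nu> v)) = radial_potential F v"
proof -
  let ?G = "radial_potential F"
  have G: "(?G has_derivative (\<lambda>h. \<Sum>l\<in>UNIV. h $ l * F l y)) (at y)" for y
    using radial_potential_gradient[OF F closed] .
  have step: "(LBINT \<nu>=0..ereal (v $ l). F l (tail_vec l \<nu> v))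
      = ?G (tail_vec l (v $ l) v) - ?G (tail_vec l 0 v)" for l
  proof -
    have contt: "continuous_on R (\<lambda>\<nu>. tail_vec l \<nu> v)" for R
      by (subst tail_vec_affine) (intro continuous_intros)
    have d: "((\<lambda>\<nu>. ?G (tail_vec l \<nu> v)) has_vector_derivative F l (tail_vec l \<nu> v)) (at \<nu> within R)" for \<nu> R
    proof -
      have "((\<lambda>\<nu>. tail_vec l \<nu> v) has_derivative (\<lambda>r. r *\<^sub>R axis l 1)) (at \<nu>)"
        by (subst tail_vec_affine) (auto intro!: derivative_eq_intros)
      from has_derivative_compose[OF this G]
      have "((\<lambda>\<nu>. ?G (tail_vec l \<nu> v)) has_vector_derivative F l (tail_vec l \<nu> v)) (at \<nu>)"
        unfolding has_vector_derivative_def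
        by (rule has_derivative_eq_rhs) (simp add: fun_eq_iff sum_axis)
      then show ?thesis by (rule has_vector_derivative_at_within)
    qed
    show ?thesis
      using interval_integral_FTC_finite[of 0 "v $ l" "\<lambda>\<nu>. F l (tail_vec l \<nu> v)" "\<lambda>\<nu>. ?G (tail_vec l \<nu> v)"]
        continuous_on_compose2[OF smooth_on_imp_continuous_on[OF F[of l]] contt] d
      by (simp add: zero_ereal_def)
  qed
  \<comment> \<open>The edges indexed by an initial segment \<open>S\<close> of the coordinates form the last part of the path; it starts at the point where the coordinates in \<open>S\<close> are still $0$.\<close>
  have telescope: "(\<Sum>l\<in>S. ?G (tail_vec l (v $ l) v) - ?G (tail_vec l 0 v))
      = ?G v - ?G (\<chi> k. if k \<in> S then 0 else v $ k)"
    if "finite S" "\<forall>l\<in>S. \<forall>k<l. k \<in> S" for S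
    using that
  proof (induction S rule: finite_linorder_max_induct)
    case empty
    then show ?case by simp
  next
    case (insert b R)
    have R: "k \<in> R \<longleftrightarrow> k < b" for k
      using insert.hyps insert.prems by (metis insert_iff order.strict_implies_not_eq)
    have "tail_vec b (v $ b) v = (\<chi> k. if k \<in> R then 0 else v $ k)"
      "tail_vec b 0 v = (\<chi> k. if k \<in> insert b R then 0 else v $ k)"
      by (auto simp: tail_vec_def vec_eq_iff R)
    moreover have "(\<Sum>l\<in>R. ?G (tail_vec l (v $ l) v) - ?G (tail_vec l 0 v))
      = ?G v - ?G (\<chi> k. if k \<in> R then 0 else v $ k)"
      using insert.IH R by (meson order.strict_trans)
    ultimately show ?case
      using insert.hyps R[of b] by simp
  qed
  have "(\<chi> k. if k \<in> UNIV then 0 else v $ k) = (0 :: (real, 'm) vec)"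
    by (simp add: vec_eq_iff)
  then show ?thesis
    using telescope[of UNIV] unfolding step by (simp add: radial_potential_def)
qed


section \<open>The acceleration coefficients of an Euler-Lagrange expression\<close>

lemma dir_deriv_cong_open:
  assumes "open S" "x \<in> S" "\<And>y. y \<in> S \<Longrightarrow> f y = g y"
  shows "dir_deriv v f x = dir_deriv v g x"
  using frechet_derivative_cong_open[OF assms] by simp

text \<open>The second total derivative also differentiates the direction $(1,v,a,b)$ of the first one,
  which accounts for the term along $(0,a,b,c)$.\<close>

lemma euler_lagrange_expand:
  fixes L :: "real \<times> (real ^ 'm::finite) \<times> (real ^ 'm) \<times> (real ^ 'm) \<Rightarrow> real"
  assumes U: "open U" and L: "smooth_on (UNIV \<times> U \<times> UNIV) L" and x: "x \<in> U"
  shows "euler_lagrange L i (t, x, v, a, b, c) =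
    dir_deriv (0, axis i 1, 0, 0) L (t, x, v, a)
    - dir_deriv (1, v, a, b) (dir_deriv (0, 0, axis i 1, 0) L) (t, x, v, a)
    + (dir_deriv (1, v, a, b) (dir_deriv (1, v, a, b) (dir_deriv (0, 0, 0, axis i 1) L)) (t, x, v, a)
      + dir_deriv (0, a, b, c) (dir_deriv (0, 0, 0, axis i 1) L) (t, x, v, a))"
proof -
  let ?S = "UNIV \<times> U \<times> UNIV :: (real \<times> (real ^ 'm) \<times> (real ^ 'm) \<times> (real ^ 'm)) set"
  let ?Q = "dir_deriv (0, 0, 0, axis i 1) L"
  let ?N = "UNIV \<times> U \<times> UNIV :: (real \<times> (real ^ 'm) \<times> (real ^ 'm) \<times> (real ^ 'm) \<times> (real ^ 'm)) set"
  let ?pi = "\<lambda>q :: real \<times> (real ^ 'm) \<times> (real ^ 'm) \<times> (real ^ 'm) \<times> (real ^ 'm).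
    (fst q, fst (snd q), fst (snd (snd q)), fst (snd (snd (snd q))))"
  let ?tau = "\<lambda>q :: real \<times> (real ^ 'm) \<times> (real ^ 'm) \<times> (real ^ 'm) \<times> (real ^ 'm). (1::real, snd (snd q))"
  let ?tau' = "\<lambda>q :: real \<times> (real ^ 'm) \<times> (real ^ 'm) \<times> (real ^ 'm) \<times> (real ^ 'm). (0::real, snd (snd q))"
  have "((\<lambda>q. dir_deriv (?tau q) ?Q (?pi q)) has_derivative
    (\<lambda>w. dir_deriv (?pi w) (dir_deriv (?tau (t, x, v, a, b)) ?Q) (?pi (t, x, v, a, b))
       + dir_deriv (?tau' w) ?Q (?pi (t, x, v, a, b)))) (at (t, x, v, a, b))"
  proof (rule has_derivative_dir_deriv)
    show "open ?S" "open ?N" by (intro open_Times open_UNIV U)+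
    show "smooth_on ?S ?Q" using L by (rule smooth_on_dir_deriv)
    show "(?pi has_derivative ?pi) (at (t, x, v, a, b))"
      by (auto intro!: derivative_eq_intros)
    show "(?tau has_derivative ?tau') (at (t, x, v, a, b))"
      by (auto intro!: derivative_eq_intros)
  qed (use x in auto)
  from dir_deriv_eqI[OF this, of "(1, v, a, b, c)"]
  show ?thesis
    unfolding euler_lagrange_def total_deriv2_def total_deriv3_def by (simp add: case_prod_unfold)
qed

text \<open>The right-hand side of \<open>affine_EL\<close> formally depends on the time \<open>t\<close> and on the third
  and fourth derivatives \<open>b\<close> and \<open>c\<close>, the left-hand side does not. All consequences below come
  from comparing coefficients.\<close>

locale second_order_lagrangian =
  fixes U :: "(real ^ 'm::finite) set"
    and L :: "real \<times> (real ^ 'm) \<times> (real ^ 'm) \<times> (real ^ 'm) \<Rightarrow> real"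
    and A :: "'m \<Rightarrow> (real ^ 'm) \<times> (real ^ 'm) \<Rightarrow> real"
    and B :: "'m \<Rightarrow> 'm \<Rightarrow> (real ^ 'm) \<times> (real ^ 'm) \<Rightarrow> real"
  assumes open_U: "open U"
    and smooth_L: "smooth_on (UNIV \<times> U \<times> UNIV) L"
    and affine_EL: "x \<in> U \<Longrightarrow> A i (x, v) + (\<Sum>j\<in>UNIV. B i j (x, v) * a $ j)
      = euler_lagrange L i (t, x, v, a, b, c)"
begin

abbreviation S :: "(real \<times> (real ^ 'm) \<times> (real ^ 'm) \<times> (real ^ 'm)) set" where
  "S \<equiv> UNIV \<times> U \<times> UNIV"

abbreviation deriv_x :: "'m \<Rightarrow> (real \<times> (real ^ 'm) \<times> (real ^ 'm) \<times> (real ^ 'm) \<Rightarrow> real) \<Rightarrow> _" where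
  "deriv_x i \<equiv> dir_deriv (0, axis i 1, 0, 0)"

abbreviation deriv_v :: "'m \<Rightarrow> (real \<times> (real ^ 'm) \<times> (real ^ 'm) \<times> (real ^ 'm) \<Rightarrow> real) \<Rightarrow> _" where
  "deriv_v i \<equiv> dir_deriv (0, 0, axis i 1, 0)"

text \<open>The highest momentum $\partial L/\partial\ddot x^i$.\<close>

definition Q :: "'m \<Rightarrow> real \<times> (real ^ 'm) \<times> (real ^ 'm) \<times> (real ^ 'm) \<Rightarrow> real" where
  "Q i = dir_deriv (0, 0, 0, axis i 1) L"

lemma open_S: "open S"
  by (intro open_Times open_UNIV open_U)

lemma smooth_Q: "smooth_on S (Q i)"
  unfolding Q_def using smooth_L by (rule smooth_on_dir_deriv)

lemma EL_expand:
  assumes "x \<in> U"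
  shows "A i (x, v) + (\<Sum>j\<in>UNIV. B i j (x, v) * a $ j) =
    deriv_x i L (t, x, v, a) - dir_deriv (1, v, a, b) (deriv_v i L) (t, x, v, a)
    + (dir_deriv (1, v, a, b) (dir_deriv (1, v, a, b) (Q i)) (t, x, v, a)
      + dir_deriv (0, a, b, c) (Q i) (t, x, v, a))"
  using affine_EL[OF assms] euler_lagrange_expand[OF open_U smooth_L assms] unfolding Q_def by simp

text \<open>Comparison of the terms with the fourth derivative \<open>c\<close>.\<close>

lemma Q_indep_acceleration:
  assumes "z \<in> S"
  shows "dir_deriv (0, 0, 0, c) (Q i) z = 0"
proof -
  obtain t x v a where z: "z = (t, x, v, a)" "x \<in> U" using assms by (cases z) auto
  have "dir_deriv (0, a, 0, c) (Q i) z = dir_deriv (0, a, 0, 0) (Q i) z"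
    using EL_expand[OF z(2), of i v a t 0 c] EL_expand[OF z(2), of i v a t 0 0] z(1) by simp
  moreover have "dir_deriv (0, a, 0, c) (Q i) z = dir_deriv (0, a, 0, 0) (Q i) z + dir_deriv (0, 0, 0, c) (Q i) z"
    using linear_add[OF smooth_on_linear_dir_deriv[OF smooth_Q[of i] assms], of "(0, a, 0, 0)" "(0, 0, 0, c)"]
    by simp
  ultimately show ?thesis by simp
qed

lemma deriv_Q_indep_acceleration:
  assumes "z \<in> S"
  shows "dir_deriv u (dir_deriv (0, 0, 0, c) (Q i)) z = 0"
    and "dir_deriv (0, 0, 0, c) (dir_deriv u (Q i)) z = 0"
proof -
  show "dir_deriv u (dir_deriv (0, 0, 0, c) (Q i)) z = 0"
    using dir_deriv_cong_open[OF open_S assms, of "dir_deriv (0, 0, 0, c) (Q i)" "\<lambda>_. 0"]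
      Q_indep_acceleration by simp
  then show "dir_deriv (0, 0, 0, c) (dir_deriv u (Q i)) z = 0"
    using dir_deriv_commute[OF open_S smooth_Q assms] by simp
qed

lemma deriv2_Q_indep_acceleration:
  assumes "z \<in> S"
  shows "dir_deriv (0, 0, 0, c) (dir_deriv w (dir_deriv u (Q i))) z = 0"
proof -
  have "dir_deriv w (dir_deriv (0, 0, 0, c) (dir_deriv u (Q i))) z = 0"
    using dir_deriv_cong_open[OF open_S assms, of "dir_deriv (0, 0, 0, c) (dir_deriv u (Q i))" "\<lambda>_. 0"]
      deriv_Q_indep_acceleration(2) by simp
  then show ?thesis
    using dir_deriv_commute[OF open_S smooth_on_dir_deriv[OF smooth_Q] assms] by simp
qed

lemma mixed_L_Q:
  assumes "z \<in> S"
  shows "dir_deriv (0, 0, 0, axis j 1) (dir_deriv u L) z = dir_deriv u (Q j) z"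
  unfolding Q_def using dir_deriv_commute[OF open_S smooth_L assms] .

text \<open>Comparison of the terms with the third derivative \<open>b\<close>: it enters through
  $\frac{d}{dt}\frac{\partial L}{\partial\dot x^i}$ and through $\frac{d^2}{dt^2}Q_i$.\<close>

lemma Q_closed:
  assumes "z \<in> S"
  shows "deriv_v i (Q j) z = deriv_v j (Q i) z"
proof -
  obtain t x v a where z: "z = (t, x, v, a)" "x \<in> U" using assms by (cases z) auto
  let ?b = "axis j (1::real)" and ?P = "deriv_v i L"
  have linP: "linear (\<lambda>u. dir_deriv u ?P z)"
    using smooth_on_linear_dir_deriv[OF smooth_on_dir_deriv[OF smooth_L] assms] .
  have linQ: "linear (\<lambda>u. dir_deriv u (Q i) z)"
    using smooth_on_linear_dir_deriv[OF smooth_Q assms] .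
  have b: "(1, v, a, ?b) = (1, v, a, 0) + (0 :: real, 0 :: real ^ 'm, 0 :: real ^ 'm, ?b)"
    "(0, a, ?b, 0) = (0 :: real, a, 0, 0) + (0, 0 :: real ^ 'm, ?b, 0 :: real ^ 'm)"
    by simp_all
  have "dir_deriv (1, v, a, ?b) (dir_deriv (1, v, a, ?b) (Q i)) z
      = dir_deriv (1, v, a, 0) (dir_deriv (1, v, a, 0) (Q i)) z"
  proof -
    have "dir_deriv w (dir_deriv (1, v, a, ?b) (Q i)) z = dir_deriv w (dir_deriv (1, v, a, 0) (Q i)) z" for w
      unfolding b(1) linear_add[OF linear_dir_deriv_dir_deriv[OF open_S smooth_Q assms]]
      by (simp add: deriv_Q_indep_acceleration(1)[OF assms])
    moreover have "dir_deriv (1, v, a, ?b) (dir_deriv w (Q i)) z = dir_deriv (1, v, a, 0) (dir_deriv w (Q i)) z" for w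
      unfolding b(1) linear_add[OF smooth_on_linear_dir_deriv[OF smooth_on_dir_deriv[OF smooth_Q] assms]]
      by (simp add: deriv_Q_indep_acceleration(2)[OF assms])
    ultimately show ?thesis by simp
  qed
  moreover have "dir_deriv (1, v, a, ?b) ?P z = dir_deriv (1, v, a, 0) ?P z + dir_deriv (0, 0, 0, ?b) ?P z"
    unfolding b(1) linear_add[OF linP] ..
  moreover have "dir_deriv (0, a, ?b, 0) (Q i) z = dir_deriv (0, a, 0, 0) (Q i) z + deriv_v j (Q i) z"
    unfolding b(2) linear_add[OF linQ] ..
  ultimately have "dir_deriv (0, 0, 0, ?b) ?P z = deriv_v j (Q i) z"
    using EL_expand[OF z(2), of i v a t ?b 0] EL_expand[OF z(2), of i v a t 0 0] z(1) by simp
  then show ?thesis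
    using mixed_L_Q[OF assms] by simp
qed

text \<open>Comparison of the terms linear in the acceleration, which is restricted to the line
  $a = s\,e_j$ so that both sides become functions of one real variable.\<close>

lemma B_formula:
  assumes x: "x \<in> U"
  shows "B i j (x, v) = deriv_x i (Q j) (t, x, v, 0) + deriv_x j (Q i) (t, x, v, 0)
    - deriv_v j (deriv_v i L) (t, x, v, 0) + dir_deriv (1, v, 0, 0) (deriv_v j (Q i)) (t, x, v, 0)"
proof -
  let ?T = "(1, v, 0, 0) :: real \<times> (real ^ 'm) \<times> (real ^ 'm) \<times> (real ^ 'm)"
  let ?V = "(0, 0, axis j 1, 0) :: real \<times> (real ^ 'm) \<times> (real ^ 'm) \<times> (real ^ 'm)"
  let ?X = "(0, axis j 1, 0, 0) :: real \<times> (real ^ 'm) \<times> (real ^ 'm) \<times> (real ^ 'm)"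
  let ?A = "(0, 0, 0, axis j 1) :: real \<times> (real ^ 'm) \<times> (real ^ 'm) \<times> (real ^ 'm)"
  let ?z = "\<lambda>s. (t, x, v, s *\<^sub>R axis j 1) :: real \<times> (real ^ 'm) \<times> (real ^ 'm) \<times> (real ^ 'm)"
  have zS: "?z s \<in> S" for s using x by simp
  have z': "(?z has_derivative (\<lambda>r. r *\<^sub>R ?A)) (at s)" for s
    by (auto intro!: derivative_eq_intros simp: zero_prod_def)
  have d: "((\<lambda>s. f (?z s)) has_real_derivative dir_deriv ?A f (?z s)) (at s)" if "smooth_on S f" for f s
    using has_derivative_compose[OF z' smooth_on_has_derivative[OF that zS]]
    unfolding has_field_derivative_def
    by (rule has_derivative_eq_rhs)
      (simp add: fun_eq_iff linear_scale[OF smooth_on_linear_dir_deriv[OF that zS]] del: scaleR_Pair)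
  note sm = smooth_on_dir_deriv
  \<comment> \<open>The direction of the total derivative along this line is \<open>?T + s *\<^sub>R ?V\<close>.\<close>
  have M: "A i (x, v) + s * B i j (x, v) = deriv_x i L (?z s)
      - (dir_deriv ?T (deriv_v i L) (?z s) + s * dir_deriv ?V (deriv_v i L) (?z s))
      + (dir_deriv ?T (dir_deriv ?T (Q i)) (?z s) + s * dir_deriv ?T (dir_deriv ?V (Q i)) (?z s)
        + s * dir_deriv ?V (dir_deriv ?T (Q i)) (?z s)
        + s * (s * dir_deriv ?V (dir_deriv ?V (Q i)) (?z s))
        + s * dir_deriv ?X (Q i) (?z s))" for s
  proof -
    have tau: "(1, v, s *\<^sub>R axis j 1, 0) = ?T + s *\<^sub>R ?V" "(0, s *\<^sub>R axis j 1, 0, 0) = s *\<^sub>R ?X"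
      by simp_all
    have 1: "dir_deriv (?T + s *\<^sub>R ?V) f (?z s) = dir_deriv ?T f (?z s) + s * dir_deriv ?V f (?z s)"
      if "smooth_on S f" for f
      using linear_add[OF smooth_on_linear_dir_deriv[OF that zS]]
        linear_scale[OF smooth_on_linear_dir_deriv[OF that zS]] by (simp del: add_Pair scaleR_Pair)
    have 2: "dir_deriv w (dir_deriv (?T + s *\<^sub>R ?V) (Q i)) (?z s)
        = dir_deriv w (dir_deriv ?T (Q i)) (?z s) + s * dir_deriv w (dir_deriv ?V (Q i)) (?z s)" for w
      using linear_add[OF linear_dir_deriv_dir_deriv[OF open_S smooth_Q zS]]
        linear_scale[OF linear_dir_deriv_dir_deriv[OF open_S smooth_Q zS]] by (simp del: add_Pair scaleR_Pair)
    have "(\<Sum>k\<in>UNIV. B i k (x, v) * (s *\<^sub>R axis j 1 :: real ^ 'm) $ k) = s * B i j (x, v)"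
      using sum_axis[of s j "\<lambda>k. B i k (x, v)"] by (simp add: mult.commute)
    then have "A i (x, v) + s * B i j (x, v) = deriv_x i L (?z s)
      - dir_deriv (?T + s *\<^sub>R ?V) (deriv_v i L) (?z s)
      + (dir_deriv (?T + s *\<^sub>R ?V) (dir_deriv (?T + s *\<^sub>R ?V) (Q i)) (?z s)
        + dir_deriv (s *\<^sub>R ?X) (Q i) (?z s))"
      using EL_expand[OF x, of i v "s *\<^sub>R axis j 1" t 0 0] unfolding tau by simp
    also have "dir_deriv (s *\<^sub>R ?X) (Q i) (?z s) = s * dir_deriv ?X (Q i) (?z s)"
      using linear_scale[OF smooth_on_linear_dir_deriv[OF smooth_Q zS]] by (simp del: scaleR_Pair)
    finally show ?thesis
      unfolding 1[OF sm[OF smooth_L]] 2 1[OF sm[OF smooth_Q]] by (simp add: algebra_simps)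
  qed
  have lhs: "((\<lambda>s. A i (x, v) + s * B i j (x, v)) has_real_derivative B i j (x, v)) (at 0)"
    by (auto intro!: derivative_eq_intros)
  have rhs: "((\<lambda>s. A i (x, v) + s * B i j (x, v)) has_real_derivative
      dir_deriv ?A (deriv_x i L) (?z 0)
      - (dir_deriv ?A (dir_deriv ?T (deriv_v i L)) (?z 0) + dir_deriv ?V (deriv_v i L) (?z 0))
      + (dir_deriv ?A (dir_deriv ?T (dir_deriv ?T (Q i))) (?z 0) + dir_deriv ?T (dir_deriv ?V (Q i)) (?z 0)
        + dir_deriv ?V (dir_deriv ?T (Q i)) (?z 0)
        + dir_deriv ?X (Q i) (?z 0))) (at 0)"
    unfolding M
    by (rule derivative_eq_intros d sm smooth_L smooth_Q refl | simp)+
  have "B i j (x, v) = dir_deriv ?A (deriv_x i L) (?z 0)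
      - (dir_deriv ?A (dir_deriv ?T (deriv_v i L)) (?z 0) + dir_deriv ?V (deriv_v i L) (?z 0))
      + (dir_deriv ?A (dir_deriv ?T (dir_deriv ?T (Q i))) (?z 0) + dir_deriv ?T (dir_deriv ?V (Q i)) (?z 0)
        + dir_deriv ?V (dir_deriv ?T (Q i)) (?z 0)
        + dir_deriv ?X (Q i) (?z 0))"
    using DERIV_unique[OF lhs rhs] .
  moreover have "dir_deriv ?A (deriv_x i L) (?z 0) = deriv_x i (Q j) (?z 0)"
    by (rule mixed_L_Q[OF zS])
  moreover have "dir_deriv ?A (dir_deriv ?T (deriv_v i L)) (?z 0) = dir_deriv ?T (dir_deriv ?V (Q i)) (?z 0)"
  proof -
    have "dir_deriv ?A (dir_deriv ?T (deriv_v i L)) (?z 0) = dir_deriv ?T (dir_deriv ?A (deriv_v i L)) (?z 0)"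
      by (rule dir_deriv_commute[OF open_S sm[OF smooth_L] zS])
    also have "\<dots> = dir_deriv ?T (dir_deriv ?V (Q i)) (?z 0)"
      by (rule dir_deriv_cong_open[OF open_S zS]) (simp only: mixed_L_Q Q_closed[of _ i j])
    finally show ?thesis .
  qed
  moreover have "dir_deriv ?A (dir_deriv ?T (dir_deriv ?T (Q i))) (?z 0) = 0"
    by (rule deriv2_Q_indep_acceleration[OF zS])
  moreover have "dir_deriv ?V (dir_deriv ?T (Q i)) (?z 0) = dir_deriv ?T (dir_deriv ?V (Q i)) (?z 0)"
    by (rule dir_deriv_commute[OF open_S smooth_Q zS])
  ultimately show ?thesis by simp
qed

text \<open>In the derivative of the formula for $B_{ij}$ with respect to $\dot x^k$, the terms
  containing $Q_j$ are symmetric in $j$ and $k$ because $\partial Q_j/\partial\dot x^k$ is, the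
  terms containing $\frac{\partial^2 Q_i}{\partial\dot x^k\partial x^j}$ and
  $\frac{\partial^2 Q_i}{\partial x^k\partial\dot x^j}$ are exchanged, and the remaining ones are
  symmetric by Schwarz's theorem.\<close>

lemma B_closed:
  assumes x: "x \<in> U"
  shows "dir_deriv (axis k 1) (\<lambda>v. B i j (x, v)) v = dir_deriv (axis j 1) (\<lambda>v. B i k (x, v)) v"
proof -
  let ?z = "\<lambda>v. (0, x, v, 0) :: real \<times> (real ^ 'm) \<times> (real ^ 'm) \<times> (real ^ 'm)"
  let ?V = "\<lambda>h. (0, 0, h, 0) :: real \<times> (real ^ 'm) \<times> (real ^ 'm) \<times> (real ^ 'm)"
  have zS: "?z v \<in> S" for v using x by simp
  note sm = smooth_on_dir_deriv
  have z': "(?z has_derivative ?V) (at v)"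
    by (auto intro!: derivative_eq_intros simp: zero_prod_def)
  have d: "((\<lambda>v. f (?z v)) has_derivative (\<lambda>h. dir_deriv (?V h) f (?z v))) (at v)" if "smooth_on S f" for f
    using has_derivative_compose[OF z' smooth_on_has_derivative[OF that zS]] .
  have dT: "((\<lambda>v. dir_deriv (1, v, 0, 0) f (?z v)) has_derivative
      (\<lambda>h. dir_deriv (?V h) (dir_deriv (1, v, 0, 0) f) (?z v) + dir_deriv (0, h, 0, 0) f (?z v))) (at v)"
    if "smooth_on S f" for f
    by (rule has_derivative_dir_deriv[OF open_S that open_UNIV UNIV_I zS z'])
      (auto intro!: derivative_eq_intros simp: zero_prod_def)
  have deriv: "dir_deriv (axis k 1) (\<lambda>v. B i j (x, v)) v =
      deriv_v k (deriv_x i (Q j)) (?z v) + deriv_v k (deriv_x j (Q i)) (?z v) - deriv_v k (deriv_v j (deriv_v i L)) (?z v)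
      + (deriv_v k (dir_deriv (1, v, 0, 0) (deriv_v j (Q i))) (?z v) + deriv_x k (deriv_v j (Q i)) (?z v))" for j k
    unfolding B_formula[OF x, of i j _ 0]
    by (rule dir_deriv_eqI)
      (intro has_derivative_add has_derivative_diff d dT sm smooth_Q smooth_L)
  have 1: "deriv_v k (deriv_x i (Q j)) (?z v) = deriv_x i (deriv_v k (Q j)) (?z v)" for i j k
    by (rule dir_deriv_commute[OF open_S smooth_Q zS])
  have 2: "deriv_x i (deriv_v k (Q j)) (?z v) = deriv_x i (deriv_v j (Q k)) (?z v)" for i j k
    by (rule dir_deriv_cong_open[OF open_S zS Q_closed])
  have 3: "deriv_v k (deriv_v j (deriv_v i L)) (?z v) = deriv_v j (deriv_v k (deriv_v i L)) (?z v)"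
    by (rule dir_deriv_commute[OF open_S sm[OF smooth_L] zS])
  have 4: "deriv_v k (dir_deriv (1, v, 0, 0) (deriv_v j (Q i))) (?z v)
      = deriv_v j (dir_deriv (1, v, 0, 0) (deriv_v k (Q i))) (?z v)"
  proof -
    have "deriv_v k (dir_deriv (1, v, 0, 0) (deriv_v j (Q i))) (?z v)
        = dir_deriv (1, v, 0, 0) (deriv_v k (deriv_v j (Q i))) (?z v)" for k j
      by (rule dir_deriv_commute[OF open_S sm[OF smooth_Q] zS])
    moreover have "dir_deriv (1, v, 0, 0) (deriv_v k (deriv_v j (Q i))) (?z v)
        = dir_deriv (1, v, 0, 0) (deriv_v j (deriv_v k (Q i))) (?z v)"
      by (rule dir_deriv_cong_open[OF open_S zS dir_deriv_commute[OF open_S smooth_Q]])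
    ultimately show ?thesis by simp
  qed
  show ?thesis
    unfolding deriv using 1 2 3 4 by simp
qed

end


section \<open>Tangent vectors in charts\<close>

lemma nth_vderiv_simps:
  "nth_vderiv 0 f t = f t"
  "nth_vderiv (Suc 0) f t = vector_derivative f (at t)"
  "nth_vderiv 2 f t = vector_derivative (\<lambda>t. vector_derivative f (at t)) (at t)"
  by (simp_all add: nth_vderiv_def numeral_2_eq_2)

lemma smooth_on_has_vector_derivative:
  fixes g :: "real \<Rightarrow> 'b::real_normed_vector"
  assumes "smooth_on I g" "t \<in> I"
  shows "(g has_vector_derivative dir_deriv 1 g t) (at t)"
proof -
  have eq: "(\<lambda>r. dir_deriv r g t) = (\<lambda>r. r *\<^sub>R dir_deriv 1 g t)"
  proof (rule ext)
    fix r
    show "dir_deriv r g t = r *\<^sub>R dir_deriv 1 g t"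
      using linear_scale[OF smooth_on_linear_dir_deriv[OF assms], of r 1]
      by (simp only: real_scaleR_def mult_1_right)
  qed
  show ?thesis
    unfolding has_vector_derivative_def
    by (rule has_derivative_eq_rhs[OF smooth_on_has_derivative[OF assms] eq])
qed

lemma vector_derivative_eqI:
  assumes "(g has_vector_derivative d) (at t)" "open I" "t \<in> I" "\<And>s. s \<in> I \<Longrightarrow> f s = g s"
  shows "vector_derivative f (at t) = d"
proof -
  have "(f has_vector_derivative d) (at t)"
    by (rule has_vector_derivative_transform_within_open[OF assms(1-3)]) (simp add: assms(4))
  then show ?thesis by (rule vector_derivative_at)
qed

text \<open>The curve on which \<^const>\<open>jet_base\<close> and \<^const>\<open>jet_coord\<close> evaluate a jet.\<close>

definition rep_curve :: "'p jet \<Rightarrow> real \<Rightarrow> 'p" where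
  "rep_curve u = (SOME \<gamma>. \<gamma> \<in> u)"

lemma jet_base_rep_curve: "jet_base u = rep_curve u 0"
  by (simp add: jet_base_def rep_curve_def)

lemma jet_coord_rep_curve: "jet_coord f r u = nth_vderiv r (f \<circ> rep_curve u) 0"
  by (simp add: jet_coord_def rep_curve_def)

lemma smooth_rep_curve: "u \<in> jets \<B> k \<Longrightarrow> smooth_curve \<B> (rep_curve u)"
  unfolding jets_def rep_curve_def using some_in_jet[of \<B> _ k] by (auto simp: jet_def)

text \<open>A condition on an atlas under which a curve that is smooth in one chart has a velocity in every
  other chart. The open set \<open>N\<close> expresses, inside the first chart, that points near \<open>p\<close>
  belong to the second chart, so a topology on the underlying set does not have to be mentioned.\<close>

definition differentiable_transitions :: "('p, 'f::euclidean_space) chart set \<Rightarrow> bool" where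
  "differentiable_transitions \<B> \<longleftrightarrow> (\<forall>c\<in>\<B>. \<forall>d\<in>\<B>. \<forall>p\<in>fst c \<inter> fst d. \<exists>N F. open N \<and> snd c p \<in> N \<and>
     F differentiable (at (snd c p)) \<and> (\<forall>q\<in>fst c. snd c q \<in> N \<longrightarrow> q \<in> fst d \<and> snd d q = F (snd c q)))"

lemma smooth_curve_has_velocity:
  assumes \<B>: "differentiable_transitions \<B>" and \<gamma>: "smooth_curve \<B> \<gamma>" and d: "d \<in> \<B>" "\<gamma> 0 \<in> fst d"
  obtains I v where "open I" "0 \<in> I" "\<gamma> ` I \<subseteq> fst d" "((snd d \<circ> \<gamma>) has_vector_derivative v) (at 0)"
proof -
  obtain c e where c: "c \<in> \<B>" and e: "0 < e" "\<gamma> ` {-e<..<e} \<subseteq> fst c" "smooth_on {-e<..<e} (snd c \<circ> \<gamma>)"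
    using \<gamma> unfolding smooth_curve_def by auto
  have "\<gamma> 0 \<in> fst c \<inter> fst d" using e d by auto
  then obtain N F where N: "open N" "snd c (\<gamma> 0) \<in> N" and F: "F differentiable (at (snd c (\<gamma> 0)))"
    and eq: "\<And>q. q \<in> fst c \<Longrightarrow> snd c q \<in> N \<Longrightarrow> q \<in> fst d \<and> snd d q = F (snd c q)"
    using \<B> c d unfolding differentiable_transitions_def by metis
  define I where "I = {-e<..<e} \<inter> (snd c \<circ> \<gamma>) -` N"
  have I: "open I"
    unfolding I_def using continuous_open_preimage[OF smooth_on_imp_continuous_on[OF e(3)] _ N(1)] by simp
  have 0: "0 \<in> I" using e(1) N(2) by (simp add: I_def)
  have sub: "\<gamma> t \<in> fst d \<and> (snd d \<circ> \<gamma>) t = F ((snd c \<circ> \<gamma>) t)" if "t \<in> I" for t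
  proof -
    have "\<gamma> t \<in> fst c" using that e(2) unfolding I_def by blast
    then show ?thesis using that eq[of "\<gamma> t"] by (simp add: I_def)
  qed
  have g: "((snd c \<circ> \<gamma>) has_derivative (\<lambda>r. dir_deriv r (snd c \<circ> \<gamma>) 0)) (at 0)"
    using smooth_on_has_derivative[OF e(3), of 0] e(1) by simp
  have "(F has_derivative frechet_derivative F (at ((snd c \<circ> \<gamma>) 0))) (at ((snd c \<circ> \<gamma>) 0))"
    using F by (simp add: frechet_derivative_works)
  from has_derivative_compose[OF g this]
  have "(\<lambda>t. F ((snd c \<circ> \<gamma>) t)) differentiable (at 0)"
    unfolding differentiable_def by blast
  then have "((\<lambda>t. F ((snd c \<circ> \<gamma>) t)) has_vector_derivative vector_derivative (\<lambda>t. F ((snd c \<circ> \<gamma>) t)) (at 0)) (at 0)"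
    by (simp add: vector_derivative_works)
  then have "((snd d \<circ> \<gamma>) has_vector_derivative vector_derivative (\<lambda>t. F ((snd c \<circ> \<gamma>) t)) (at 0)) (at 0)"
    using has_vector_derivative_transform_within_open[OF _ I 0] sub by metis
  then show thesis using that I 0 sub by blast
qed

text \<open>The chain rule for tangent vectors. With a linear projection for \<open>G\<close> it reads off
  components of a tangent vector, with a transition map for \<open>G\<close> it changes charts.\<close>

lemma jet_coord_chain:
  assumes \<B>: "differentiable_transitions \<B>" and u: "u \<in> jets \<B> 1"
    and c: "c \<in> \<B>" "jet_base u \<in> fst c"
    and N: "open N" "snd c (jet_base u) \<in> N" "\<And>q. q \<in> fst c \<Longrightarrow> snd c q \<in> N \<Longrightarrow> g q = G (snd c q)"
    and G: "(G has_derivative G') (at (snd c (jet_base u)))"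
  shows "jet_coord g 1 u = G' (jet_coord (snd c) 1 u)"
proof -
  let ?\<gamma> = "rep_curve u"
  obtain I v where I: "open I" "0 \<in> I" "?\<gamma> ` I \<subseteq> fst c" and v: "((snd c \<circ> ?\<gamma>) has_vector_derivative v) (at 0)"
    using smooth_curve_has_velocity[OF \<B> smooth_rep_curve[OF u] c(1)] c(2)
    by (auto simp: jet_base_rep_curve)
  have v': "jet_coord (snd c) 1 u = v"
    using vector_derivative_at[OF v] by (simp add: jet_coord_rep_curve nth_vderiv_simps)
  have "isCont (snd c \<circ> ?\<gamma>) 0"
    using has_vector_derivative_continuous[OF v] by simp
  then have "\<forall>\<^sub>F t in nhds 0. (snd c \<circ> ?\<gamma>) t \<in> N"
    using N(1,2) jet_base_rep_curve[of u]
    by (simp add: continuous_at_open eventually_nhds)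
  moreover have "\<forall>\<^sub>F t in nhds 0. t \<in> I"
    using I(1,2) eventually_nhds by blast
  ultimately have "\<forall>\<^sub>F t in nhds 0. (G \<circ> (snd c \<circ> ?\<gamma>)) t = (g \<circ> ?\<gamma>) t"
    by eventually_elim (use N(3) I(3) in auto)
  then obtain J where J: "open J" "0 \<in> J" "\<And>t. t \<in> J \<Longrightarrow> (G \<circ> (snd c \<circ> ?\<gamma>)) t = (g \<circ> ?\<gamma>) t"
    unfolding eventually_nhds by blast
  have lin: "linear G'" using has_derivative_linear[OF G] .
  have "((G \<circ> (snd c \<circ> ?\<gamma>)) has_derivative (\<lambda>r. G' (r *\<^sub>R v))) (at 0)"
    using has_derivative_compose[OF v[unfolded has_vector_derivative_def], of G G'] G jet_base_rep_curve[of u]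
    by (simp add: o_def)
  then have "((G \<circ> (snd c \<circ> ?\<gamma>)) has_vector_derivative G' v) (at 0)"
    by (simp add: has_vector_derivative_def linear_scale[OF lin])
  then have "((g \<circ> ?\<gamma>) has_vector_derivative G' v) (at 0)"
    by (rule has_vector_derivative_transform_within_open[OF _ J(1,2)]) (rule J(3))
  then show ?thesis
    using vector_derivative_at v' by (simp add: jet_coord_rep_curve nth_vderiv_simps)
qed


section \<open>Transition maps and their prolongation to jets\<close>

definition overlap :: "('a, 'e) chart \<Rightarrow> ('a, 'e) chart \<Rightarrow> 'e set" where
  "overlap c d = snd c ` (fst c \<inter> fst d)"

definition transition :: "('a, 'e) chart \<Rightarrow> ('a, 'e) chart \<Rightarrow> 'e \<Rightarrow> 'e" where
  "transition c d = snd d \<circ> inv_into (fst c) (snd c)"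

locale manifold =
  fixes X :: "'a topology" and \<A> :: "('a, 'e::euclidean_space) chart set"
  assumes manifold: "smooth_manifold X \<A>"
begin

lemma is_chart: "c \<in> \<A> \<Longrightarrow> is_chart X c"
  using manifold by (simp add: smooth_manifold_def smooth_atlas_def)

lemma open_chart_image: "c \<in> \<A> \<Longrightarrow> open (snd c ` fst c)"
  using is_chart[of c] by (auto simp: is_chart_def)

lemma inj_on_chart:
  assumes "c \<in> \<A>"
  shows "inj_on (snd c) (fst c)"
proof -
  have "homeomorphic_map (subtopology X (fst c)) (top_of_set (snd c ` fst c)) (snd c)"
    "fst c \<subseteq> topspace X"
    using is_chart[OF assms] openin_subset[of X "fst c"] by (auto simp: is_chart_def split_beta)
  then show ?thesis
    using homeomorphic_imp_injective_map by (metis inf.absorb_iff2 topspace_subtopology)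
qed

lemma open_overlap:
  assumes "c \<in> \<A>" "d \<in> \<A>"
  shows "open (overlap c d)"
proof -
  have h: "homeomorphic_map (subtopology X (fst c)) (top_of_set (snd c ` fst c)) (snd c)"
    and "openin X (fst d)"
    using is_chart[OF assms(1)] is_chart[OF assms(2)] by (auto simp: is_chart_def)
  then have "openin (subtopology X (fst c)) (fst c \<inter> fst d)"
    by (simp add: openin_subtopology_Int2)
  then have "openin (top_of_set (snd c ` fst c)) (overlap c d)"
    using homeomorphic_imp_open_map[OF h] by (simp add: open_map_def overlap_def)
  then show ?thesis
    using open_chart_image[OF assms(1)] openin_open_trans by blast
qed

lemma smooth_transition:
  assumes "c \<in> \<A>" "d \<in> \<A>"
  shows "smooth_on (overlap c d) (transition c d)"
proof -
  have "compatible_charts c d"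
    using manifold assms by (simp add: smooth_manifold_def smooth_atlas_def)
  then show ?thesis
    by (auto simp: compatible_charts_def overlap_def transition_def)
qed

lemma transition_chart: "c \<in> \<A> \<Longrightarrow> p \<in> fst c \<Longrightarrow> transition c d (snd c p) = snd d p"
  by (simp add: transition_def inv_into_f_f[OF inj_on_chart])

lemma mem_overlapD: "c \<in> \<A> \<Longrightarrow> p \<in> fst c \<Longrightarrow> snd c p \<in> overlap c d \<Longrightarrow> p \<in> fst d"
  using inj_on_chart[of c] by (auto simp: overlap_def inj_on_def)

lemma smooth_curve_in_chart:
  assumes \<gamma>: "smooth_curve \<A> \<gamma>" and d: "d \<in> \<A>" "\<gamma> 0 \<in> fst d"
  obtains e where "0 < e" "\<gamma> ` {-e<..<e} \<subseteq> fst d" "smooth_on {-e<..<e} (snd d \<circ> \<gamma>)"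
proof -
  obtain c e where c: "c \<in> \<A>" and e: "0 < e" "\<gamma> ` {-e<..<e} \<subseteq> fst c" "smooth_on {-e<..<e} (snd c \<circ> \<gamma>)"
    using \<gamma> unfolding smooth_curve_def by auto
  define I where "I = {-e<..<e} \<inter> (snd c \<circ> \<gamma>) -` overlap c d"
  have "open I"
    unfolding I_def
    using continuous_open_preimage[OF smooth_on_imp_continuous_on[OF e(3)] _ open_overlap[OF c d(1)]] by simp
  moreover have "0 \<in> I"
  proof -
    have "\<gamma> 0 \<in> fst c" using e by auto
    then show ?thesis using e(1) d by (simp add: I_def overlap_def)
  qed
  ultimately obtain e' where e': "0 < e'" "ball 0 e' \<subseteq> I" using openE by blast
  have I: "{-e'<..<e'} \<subseteq> I" using e'(2) by (auto simp: ball_def dist_real_def abs_less_iff subset_iff)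
  have mem: "\<gamma> t \<in> fst c" "\<gamma> t \<in> fst d" if "t \<in> I" for t
  proof -
    show "\<gamma> t \<in> fst c" using that e(2) unfolding I_def by blast
    then show "\<gamma> t \<in> fst d" using that mem_overlapD[OF c, of "\<gamma> t" d] by (simp add: I_def)
  qed
  have "smooth_on {-e'<..<e'} (\<lambda>t. transition c d ((snd c \<circ> \<gamma>) t))"
    by (rule smooth_on_compose[OF _ open_overlap[OF c d(1)] smooth_transition[OF c d(1)]
          smooth_on_subset[OF e(3)]]) (use I in \<open>auto simp: I_def\<close>)
  then have "smooth_on {-e'<..<e'} (snd d \<circ> \<gamma>)"
    by (rule smooth_on_cong[rotated])
      (use I mem transition_chart[OF c, of _ d] in \<open>auto simp del: split_paired_All\<close>)
  then show thesis using that e'(1) I mem(2) by blast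
qed

lemma jet_coord_0:
  assumes "q \<in> jets \<A> k" "c \<in> \<A>" "jet_base q \<in> fst c"
  shows "jet_coord (snd c) 0 q = snd c (jet_base q)"
  by (simp add: jet_coord_rep_curve jet_base_rep_curve nth_vderiv_simps)

text \<open>The first two derivatives of $f \circ g$, where $g$ is the representing curve in the chart
  \<open>c\<close> and $f$ the transition map.\<close>

lemma jet_coord_transition:
  assumes q: "q \<in> jets \<A> k" and c: "c \<in> \<A>" "jet_base q \<in> fst c" and d: "d \<in> \<A>" "jet_base q \<in> fst d"
  shows "jet_coord (snd d) 0 q = transition c d (jet_coord (snd c) 0 q)"
    and "jet_coord (snd d) 1 q = dir_deriv (jet_coord (snd c) 1 q) (transition c d) (jet_coord (snd c) 0 q)"
    and "jet_coord (snd d) 2 q =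
      dir_deriv (jet_coord (snd c) 1 q) (dir_deriv (jet_coord (snd c) 1 q) (transition c d)) (jet_coord (snd c) 0 q)
      + dir_deriv (jet_coord (snd c) 2 q) (transition c d) (jet_coord (snd c) 0 q)"
proof -
  let ?\<gamma> = "rep_curve q" and ?f = "transition c d"
  let ?g = "snd c \<circ> ?\<gamma>" and ?h = "snd d \<circ> ?\<gamma>"
  have \<gamma>: "smooth_curve \<A> ?\<gamma>" using smooth_rep_curve[OF q] .
  obtain e where e: "0 < e" "?\<gamma> ` {-e<..<e} \<subseteq> fst c" "smooth_on {-e<..<e} ?g"
    using smooth_curve_in_chart[OF \<gamma> c(1)] c(2) jet_base_rep_curve[of q] by metis
  obtain e' where e': "0 < e'" "?\<gamma> ` {-e'<..<e'} \<subseteq> fst d"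
    using smooth_curve_in_chart[OF \<gamma> d(1)] d(2) jet_base_rep_curve[of q] by metis
  define I where "I = {-e<..<e} \<inter> {-e'<..<e'}"
  have I: "open I" "0 \<in> I" using e e' by (auto simp: I_def)
  have mem: "?\<gamma> t \<in> fst c" "?\<gamma> t \<in> fst d" if "t \<in> I" for t
    using that e(2) e'(2) by (auto simp: I_def)
  have ov: "?g t \<in> overlap c d" if "t \<in> I" for t
    using mem[OF that] by (auto simp: overlap_def)
  have h: "?h t = ?f (?g t)" if "t \<in> I" for t
    using transition_chart[OF c(1) mem(1)[OF that]] by simp
  have g: "smooth_on I ?g" unfolding I_def by (rule smooth_on_subset[OF e(3)]) blast
  have g1: "(?g has_vector_derivative dir_deriv 1 ?g t) (at t)" if "t \<in> I" for t
    using smooth_on_has_vector_derivative[OF g that] .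
  have g2: "(dir_deriv 1 ?g has_vector_derivative dir_deriv 1 (dir_deriv 1 ?g) 0) (at 0)"
    using smooth_on_has_vector_derivative[OF smooth_on_dir_deriv[OF g] I(2)] .
  have gv: "vector_derivative ?g (at t) = dir_deriv 1 ?g t" if "t \<in> I" for t
    using vector_derivative_at[OF g1[OF that]] .
  have f: "(?f has_derivative (\<lambda>w. dir_deriv w ?f (?g t))) (at (?g t))" if "t \<in> I" for t
    using smooth_on_has_derivative[OF smooth_transition[OF c(1) d(1)] ov[OF that]] .
  have flin: "linear (\<lambda>w. dir_deriv w ?f (?g t))" if "t \<in> I" for t
    using has_derivative_linear[OF f[OF that]] .
  have h1: "vector_derivative ?h (at t) = dir_deriv (dir_deriv 1 ?g t) ?f (?g t)" if t: "t \<in> I" for t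
  proof -
    have "((\<lambda>s. ?f (?g s)) has_vector_derivative dir_deriv (dir_deriv 1 ?g t) ?f (?g t)) (at t)"
      using has_derivative_compose[OF g1[OF t, unfolded has_vector_derivative_def] f[OF t]]
      by (simp only: has_vector_derivative_def linear_scale[OF flin[OF t]])
    then show ?thesis by (rule vector_derivative_eqI[OF _ I(1) t h])
  qed
  have c0: "jet_coord (snd c) 0 q = ?g 0" and c1: "jet_coord (snd c) 1 q = dir_deriv 1 ?g 0"
    using gv[OF I(2)] by (simp_all add: jet_coord_rep_curve nth_vderiv_simps)
  have c2: "jet_coord (snd c) 2 q = dir_deriv 1 (dir_deriv 1 ?g) 0"
    unfolding jet_coord_rep_curve nth_vderiv_simps
    by (rule vector_derivative_eqI[OF g2 I gv])
  show "jet_coord (snd d) 0 q = ?f (jet_coord (snd c) 0 q)"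
    unfolding c0 using h[OF I(2)] by (simp add: jet_coord_rep_curve nth_vderiv_simps)
  show "jet_coord (snd d) 1 q = dir_deriv (jet_coord (snd c) 1 q) ?f (jet_coord (snd c) 0 q)"
    unfolding c0 c1 using h1[OF I(2)] by (simp add: jet_coord_rep_curve nth_vderiv_simps)
  have "((\<lambda>t. dir_deriv (dir_deriv 1 ?g t) ?f (?g t)) has_derivative
      (\<lambda>r. dir_deriv (r *\<^sub>R dir_deriv 1 ?g 0) (dir_deriv (dir_deriv 1 ?g 0) ?f) (?g 0)
        + dir_deriv (r *\<^sub>R dir_deriv 1 (dir_deriv 1 ?g) 0) ?f (?g 0))) (at 0)"
    by (rule has_derivative_dir_deriv[OF open_overlap[OF c(1) d(1)] smooth_transition[OF c(1) d(1)] I ov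
          g1[OF I(2), unfolded has_vector_derivative_def] g2[unfolded has_vector_derivative_def]])
  then have "((\<lambda>t. dir_deriv (dir_deriv 1 ?g t) ?f (?g t)) has_vector_derivative
      dir_deriv (dir_deriv 1 ?g 0) (dir_deriv (dir_deriv 1 ?g 0) ?f) (?g 0)
        + dir_deriv (dir_deriv 1 (dir_deriv 1 ?g) 0) ?f (?g 0)) (at 0)"
    unfolding has_vector_derivative_def
    by (rule has_derivative_eq_rhs)
      (simp add: fun_eq_iff scaleR_add_right del: comp_apply add: linear_scale[OF flin[OF I(2)]]
        linear_scale[OF smooth_on_linear_dir_deriv[OF smooth_on_dir_deriv[OF smooth_transition[OF c(1) d(1)]] ov[OF I(2)]]])
  then show "jet_coord (snd d) 2 q =
      dir_deriv (jet_coord (snd c) 1 q) (dir_deriv (jet_coord (snd c) 1 q) ?f) (jet_coord (snd c) 0 q)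
      + dir_deriv (jet_coord (snd c) 2 q) ?f (jet_coord (snd c) 0 q)"
    unfolding c0 c1 c2 unfolding jet_coord_rep_curve nth_vderiv_simps
    by (rule vector_derivative_eqI[OF _ I h1])
qed

text \<open>The curve with coordinates $x + tv + \frac12 t^2 a$ has the prescribed 2-jet.\<close>

lemma exists_2_jet:
  assumes c: "c \<in> \<A>" and x: "x \<in> snd c ` fst c"
  obtains q where "q \<in> jets \<A> 2" "jet_base q \<in> fst c"
    "jet_coord (snd c) 0 q = x" "jet_coord (snd c) 1 q = v" "jet_coord (snd c) 2 q = a"
proof -
  define p where "p t = x + t *\<^sub>R v + (t\<^sup>2 / 2) *\<^sub>R a" for t :: real
  define \<gamma> where "\<gamma> t = inv_into (fst c) (snd c) (p t)" for t
  have smp: "smooth_on UNIV p"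
  proof -
    have id: "smooth_on UNIV (\<lambda>t::real. t)"
      by (rule smooth_on_bounded_linear[OF bounded_linear_ident open_UNIV])
    have "smooth_on UNIV (\<lambda>t::real. x + t *\<^sub>R v + (t * (t * (1 / 2))) *\<^sub>R a)"
      by (intro smooth_on_add smooth_on_scaleR smooth_on_mult smooth_on_const id open_UNIV)
    then show ?thesis
      by (rule smooth_on_cong[OF open_UNIV]) (simp add: p_def power2_eq_square)
  qed
  have "open (p -` (snd c ` fst c))"
    using open_vimage[OF open_chart_image[OF c] smooth_on_imp_continuous_on[OF smp]] .
  moreover have "0 \<in> p -` (snd c ` fst c)" using x by (simp add: p_def)
  ultimately obtain e where e: "0 < e" "ball 0 e \<subseteq> p -` (snd c ` fst c)" using openE by blast
  have p: "p t \<in> snd c ` fst c" if "t \<in> {-e<..<e}" for t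
    using that e(2) by (auto simp: ball_def dist_real_def abs_less_iff subset_iff)
  have cg: "(snd c \<circ> \<gamma>) t = p t" "\<gamma> t \<in> fst c" if "t \<in> {-e<..<e}" for t
    using p[OF that] by (simp_all add: \<gamma>_def f_inv_into_f inv_into_into)
  have "smooth_on {-e<..<e} (snd c \<circ> \<gamma>)"
    by (rule smooth_on_cong[OF _ smooth_on_subset[OF smp]]) (use cg in auto)
  then have \<gamma>: "smooth_curve \<A> \<gamma>"
    unfolding smooth_curve_def using c e(1) cg(2) by (intro bexI[of _ c]) (auto simp: split_beta)
  define q where "q = jet \<A> 2 \<gamma>"
  have q: "q \<in> jets \<A> 2" using \<gamma> by (simp add: jets_def q_def)
  have I: "open {-e<..<e}" "0 \<in> {-e<..<e}" using e by auto
  have base: "jet_base q = \<gamma> 0" using jet_base_jet[OF \<gamma>] by (simp add: q_def)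
  have jc: "jet_coord (snd c) r q = nth_vderiv r (snd c \<circ> \<gamma>) 0" if "r \<le> 2" for r
    using jet_coord_jet[OF \<gamma>, of "fst c" "snd c" r 2] c cg(2)[OF I(2)] that by (simp add: q_def)
  have p1: "(p has_vector_derivative v + t *\<^sub>R a) (at t)" for t
    unfolding p_def by (auto intro!: derivative_eq_intros)
  have p2: "((\<lambda>t. v + t *\<^sub>R a) has_vector_derivative a) (at 0)"
    by (auto intro!: derivative_eq_intros)
  have d1: "vector_derivative (snd c \<circ> \<gamma>) (at t) = v + t *\<^sub>R a" if "t \<in> {-e<..<e}" for t
    by (rule vector_derivative_eqI[OF p1 I(1) that cg(1)])
  show thesis
  proof (rule that[OF q])
    show "jet_base q \<in> fst c" using base cg(2)[OF I(2)] by simp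
    show "jet_coord (snd c) 0 q = x" using jc[of 0] cg(1)[OF I(2)] by (simp add: nth_vderiv_simps p_def)
    show "jet_coord (snd c) 1 q = v" using jc[of 1] d1[OF I(2)] by (simp add: nth_vderiv_simps)
    show "jet_coord (snd c) 2 q = a"
      using jc[of 2] vector_derivative_eqI[OF p2 I d1] by (simp add: nth_vderiv_simps)
  qed
qed

end


section \<open>Tangent vectors of the tangent bundle and of the second-order jets\<close>

lemma tangent_chart_simps:
  "fst (tangent_chart \<A> c) = {j \<in> jets \<A> 1. jet_base j \<in> fst c}"
  "snd (tangent_chart \<A> c) j = (jet_coord (snd c) 0 j, jet_coord (snd c) 1 j)"
  by (simp_all add: tangent_chart_def split_beta)

lemma T2_chart_simps:
  "fst (T2_chart \<A> c) = {j \<in> jets \<A> 2. jet_base j \<in> fst c}"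
  "snd (T2_chart \<A> c) j = (jet_coord (snd c) 0 j, jet_coord (snd c) 1 j, jet_coord (snd c) 2 j)"
  by (simp_all add: T2_chart_def split_beta)

lemma time_chart_simps:
  "fst (time_chart c) = UNIV \<times> fst c"
  "snd (time_chart c) p = (fst p, snd c (snd p))"
  by (simp_all add: time_chart_def split_beta)

context manifold
begin

lemma overlapI: "q \<in> jets \<A> k \<Longrightarrow> c \<in> \<A> \<Longrightarrow> jet_base q \<in> fst c \<Longrightarrow> jet_base q \<in> fst d \<Longrightarrow>
    jet_coord (snd c) 0 q \<in> overlap c d"
  by (simp add: jet_coord_0 overlap_def)

lemma base_in_chartI: "q \<in> jets \<A> k \<Longrightarrow> c \<in> \<A> \<Longrightarrow> jet_base q \<in> fst c \<Longrightarrow>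
    jet_coord (snd c) 0 q \<in> overlap c d \<Longrightarrow> jet_base q \<in> fst d"
  using mem_overlapD[of c "jet_base q" d] by (simp add: jet_coord_0)

lemma tangent_atlas_transitions: "differentiable_transitions (tangent_atlas \<A>)"
  unfolding differentiable_transitions_def tangent_atlas_def
proof (intro ballI)
  fix c' d' p
  assume "c' \<in> tangent_chart \<A> ` \<A>" "d' \<in> tangent_chart \<A> ` \<A>" and p: "p \<in> fst c' \<inter> fst d'"
  then obtain c d where c: "c \<in> \<A>" "c' = tangent_chart \<A> c" and d: "d \<in> \<A>" "d' = tangent_chart \<A> d"
    by blast
  let ?f = "transition c d"
  let ?F = "\<lambda>z. (?f (fst z), dir_deriv (snd z) ?f (fst z))"
  let ?N = "overlap c d \<times> UNIV :: ('e \<times> 'e) set"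
  have N: "open ?N" using open_overlap[OF c(1) d(1)] by (intro open_Times) auto
  have pN: "snd c' p \<in> ?N"
    using p overlapI[of p 1 c d] c d by (simp add: tangent_chart_simps)
  note sm = smooth_transition[OF c(1) d(1)]
  have "(?f has_derivative (\<lambda>v. dir_deriv v ?f (fst (snd c' p)))) (at (fst (snd c' p)))"
    by (rule smooth_on_has_derivative[OF sm]) (use pN in \<open>auto simp: mem_Times_iff\<close>)
  from has_derivative_compose[OF has_derivative_fst[OF has_derivative_ident] this]
  have 1: "(\<lambda>z. ?f (fst z)) differentiable (at (snd c' p))"
    unfolding differentiable_def by blast
  have "((\<lambda>z. dir_deriv (snd z) ?f (fst z)) has_derivative
      (\<lambda>w. dir_deriv (fst w) (dir_deriv (snd (snd c' p)) ?f) (fst (snd c' p))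
        + dir_deriv (snd w) ?f (fst (snd c' p)))) (at (snd c' p))"
    by (rule has_derivative_dir_deriv[OF open_overlap[OF c(1) d(1)] sm N pN _
          has_derivative_fst[OF has_derivative_ident] has_derivative_snd[OF has_derivative_ident]])
      auto
  then have 2: "(\<lambda>z. dir_deriv (snd z) ?f (fst z)) differentiable (at (snd c' p))"
    unfolding differentiable_def by blast
  have "?F differentiable (at (snd c' p))"
    by (rule differentiable_Pair[OF 1 2])
  moreover have "q \<in> fst d' \<and> snd d' q = ?F (snd c' q)" if "q \<in> fst c'" "snd c' q \<in> ?N" for q
  proof -
    have q: "q \<in> jets \<A> 1" "jet_base q \<in> fst c" "jet_coord (snd c) 0 q \<in> overlap c d"
      using that c by (auto simp: tangent_chart_simps)
    have "jet_base q \<in> fst d" using base_in_chartI[OF q(1) c(1) q(2,3)] .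
    then show ?thesis
      using jet_coord_transition(1,2)[OF q(1) c(1) q(2) d(1)] q(1)
      unfolding c(2) d(2) tangent_chart_simps by simp
  qed
  ultimately show "\<exists>N F. open N \<and> snd c' p \<in> N \<and> F differentiable (at (snd c' p)) \<and>
      (\<forall>q\<in>fst c'. snd c' q \<in> N \<longrightarrow> q \<in> fst d' \<and> snd d' q = F (snd c' q))"
    using N pN by (intro exI[of _ ?N] exI[of _ ?F] conjI ballI impI) simp_all
qed

lemma time_T2_atlas_transitions: "differentiable_transitions (time_T2_atlas \<A>)"
  unfolding differentiable_transitions_def time_T2_atlas_def
proof (intro ballI)
  fix c' d' p
  assume "c' \<in> (\<lambda>c. time_chart (T2_chart \<A> c)) ` \<A>" "d' \<in> (\<lambda>c. time_chart (T2_chart \<A> c)) ` \<A>"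
    and p: "p \<in> fst c' \<inter> fst d'"
  then obtain c d where c: "c \<in> \<A>" "c' = time_chart (T2_chart \<A> c)"
    and d: "d \<in> \<A>" "d' = time_chart (T2_chart \<A> d)"
    by blast
  let ?f = "transition c d"
  let ?x = "\<lambda>z :: real \<times> 'e \<times> 'e \<times> 'e. fst (snd z)"
  let ?v = "\<lambda>z :: real \<times> 'e \<times> 'e \<times> 'e. fst (snd (snd z))"
  let ?a = "\<lambda>z :: real \<times> 'e \<times> 'e \<times> 'e. snd (snd (snd z))"
  let ?F = "\<lambda>z. (fst z, ?f (?x z), dir_deriv (?v z) ?f (?x z),
    dir_deriv (?v z) (dir_deriv (?v z) ?f) (?x z) + dir_deriv (?a z) ?f (?x z))"
  let ?N = "UNIV \<times> overlap c d \<times> UNIV :: (real \<times> 'e \<times> 'e \<times> 'e) set"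
  have O: "open (overlap c d)" by (rule open_overlap[OF c(1) d(1)])
  have N: "open ?N" using O by (intro open_Times open_UNIV)
  have pN: "snd c' p \<in> ?N"
    using p overlapI[of "snd p" 2 c d] c d by (auto simp: time_chart_simps T2_chart_simps)
  note sm = smooth_transition[OF c(1) d(1)]
  have dx: "(?x has_derivative ?x) (at z)" and dv: "(?v has_derivative ?v) (at z)"
    and da: "(?a has_derivative ?a) (at z)" for z
    by (auto intro!: derivative_eq_intros)
  have xN: "z \<in> ?N \<Longrightarrow> ?x z \<in> overlap c d" for z by auto
  have "(?f has_derivative (\<lambda>v. dir_deriv v ?f (?x (snd c' p)))) (at (?x (snd c' p)))"
    using smooth_on_has_derivative[OF sm xN[OF pN]] .
  from has_derivative_compose[OF dx this]
  have 1: "(\<lambda>z. ?f (?x z)) differentiable (at (snd c' p))"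
    unfolding differentiable_def by blast
  have 2: "(\<lambda>z. dir_deriv (\<tau> z) g (?x z)) differentiable (at (snd c' p))"
    if "smooth_on (overlap c d) g" "\<And>z. (\<tau> has_derivative \<tau>) (at z)" for g :: "'e \<Rightarrow> 'e" and \<tau>
    using has_derivative_dir_deriv[OF O that(1) N pN xN dx that(2)] unfolding differentiable_def by blast
  \<comment> \<open>In the second-order term both directions vary; expanding the inner one in a basis reduces it to the case of one varying direction.\<close>
  have "(\<lambda>z. \<Sum>b\<in>Basis. (?v z \<bullet> b) *\<^sub>R dir_deriv (?v z) (dir_deriv b ?f) (?x z)) differentiable (at (snd c' p))"
  proof (rule differentiable_sum[OF finite_Basis], intro ballI)
    fix b :: 'e
    have "(\<lambda>z. ?v z \<bullet> b) differentiable (at (snd c' p))"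
      by (rule differentiableI, rule has_derivative_inner_left, rule dv)
    then show "(\<lambda>z. (?v z \<bullet> b) *\<^sub>R dir_deriv (?v z) (dir_deriv b ?f) (?x z)) differentiable (at (snd c' p))"
      by (rule differentiable_scaleR[OF _ 2[OF smooth_on_dir_deriv[OF sm] dv]])
  qed
  then have 3: "(\<lambda>z. dir_deriv (?v z) (dir_deriv (?v z) ?f) (?x z)) differentiable (at (snd c' p))"
    by (rule differentiable_cong_open[OF N pN, rotated])
      (rule linear_expand_Basis[OF linear_dir_deriv_dir_deriv[OF O sm xN], symmetric])
  have "?F differentiable (at (snd c' p))"
    by (intro differentiable_Pair differentiable_add 1 2 3 sm dv da)
      (auto intro!: differentiableI derivative_eq_intros)
  moreover have "q \<in> fst d' \<and> snd d' q = ?F (snd c' q)" if "q \<in> fst c'" "snd c' q \<in> ?N" for q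
  proof -
    have q: "snd q \<in> jets \<A> 2" "jet_base (snd q) \<in> fst c" "jet_coord (snd c) 0 (snd q) \<in> overlap c d"
      using that c by (auto simp: T2_chart_simps time_chart_simps)
    have "jet_base (snd q) \<in> fst d" using base_in_chartI[OF q(1) c(1) q(2,3)] .
    then show ?thesis
      using jet_coord_transition[OF q(1) c(1) q(2) d(1)] q(1) c d
      by (simp add: T2_chart_simps time_chart_simps mem_Times_iff)
  qed
  ultimately show "\<exists>N F. open N \<and> snd c' p \<in> N \<and> F differentiable (at (snd c' p)) \<and>
      (\<forall>q\<in>fst c'. snd c' q \<in> N \<longrightarrow> q \<in> fst d' \<and> snd d' q = F (snd c' q))"
    using N pN by (intro exI[of _ ?N] exI[of _ ?F] conjI ballI impI) simp_all
qed

text \<open>Taking a coordinate function or the whole base coordinate for \<open>G\<close>, this identifies the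
  differentials $dx^j$ on the tangent bundle with components of tangent vectors.\<close>

lemma tangent_jet_components:
  assumes u: "u \<in> jets (tangent_atlas \<A>) 1" and c: "c \<in> \<A>" "jet_base u \<in> fst (tangent_chart \<A> c)"
    and G: "(G has_derivative G) (at (jet_coord (snd c) 0 (jet_base u)))"
  shows "jet_coord (\<lambda>q. G (jet_coord (snd c) 0 q)) 1 u = G (fst (jet_coord (snd (tangent_chart \<A> c)) 1 u))"
proof (rule jet_coord_chain[OF tangent_atlas_transitions u, of "tangent_chart \<A> c" UNIV])
  show "((\<lambda>z. G (fst z)) has_derivative (\<lambda>z. G (fst z))) (at (snd (tangent_chart \<A> c) (jet_base u)))"
    by (rule has_derivative_compose[OF has_derivative_fst[OF has_derivative_ident]])
      (use G in \<open>simp add: tangent_chart_simps\<close>)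
qed (use c in \<open>auto simp: tangent_atlas_def tangent_chart_simps\<close>)

lemma tangent_jet_transition:
  assumes u: "u \<in> jets (tangent_atlas \<A>) 1" and c: "c \<in> \<A>" "jet_base u \<in> fst (tangent_chart \<A> c)"
    and d: "d \<in> \<A>" "jet_base u \<in> fst (tangent_chart \<A> d)"
  shows "fst (jet_coord (snd (tangent_chart \<A> d)) 1 u) =
    dir_deriv (fst (jet_coord (snd (tangent_chart \<A> c)) 1 u)) (transition c d) (jet_coord (snd c) 0 (jet_base u))"
proof -
  let ?f = "transition c d" and ?x = "jet_coord (snd c) 0 (jet_base u)"
  have base: "jet_base u \<in> jets \<A> 1" "jet_base (jet_base u) \<in> fst c" "jet_base (jet_base u) \<in> fst d"
    using c d by (auto simp: tangent_chart_simps)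
  have x: "?x \<in> overlap c d" using overlapI[OF base(1) c(1) base(2,3)] .
  have "jet_coord (\<lambda>q. jet_coord (snd d) 0 q) 1 u
      = dir_deriv (fst (jet_coord (snd (tangent_chart \<A> c)) 1 u)) ?f ?x"
  proof (rule jet_coord_chain[OF tangent_atlas_transitions u, of "tangent_chart \<A> c" "overlap c d \<times> UNIV"])
    show "open (overlap c d \<times> (UNIV :: 'e set))"
      using open_overlap[OF c(1) d(1)] by (intro open_Times) auto
    show "jet_coord (snd d) 0 q = ?f (fst (snd (tangent_chart \<A> c) q))"
      if "q \<in> fst (tangent_chart \<A> c)" "snd (tangent_chart \<A> c) q \<in> overlap c d \<times> UNIV" for q
      using that jet_coord_transition(1)[of q 1 c d] base_in_chartI[of q 1 c d] c d
      by (auto simp: tangent_chart_simps)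
    show "((\<lambda>z. ?f (fst z)) has_derivative (\<lambda>z. dir_deriv (fst z) ?f ?x)) (at (snd (tangent_chart \<A> c) (jet_base u)))"
      by (rule has_derivative_compose[OF has_derivative_fst[OF has_derivative_ident]])
        (use smooth_on_has_derivative[OF smooth_transition[OF c(1) d(1)] x] in \<open>simp add: tangent_chart_simps\<close>)
  qed (use c x in \<open>auto simp: tangent_atlas_def tangent_chart_simps\<close>)
  moreover have "jet_coord (\<lambda>q. jet_coord (snd d) 0 q) 1 u = fst (jet_coord (snd (tangent_chart \<A> d)) 1 u)"
    using tangent_jet_components[OF u d has_derivative_ident] .
  ultimately show ?thesis by simp
qed

lemma time_jet_components:
  assumes u: "u \<in> jets (time_T2_atlas \<A>) 1" and c: "c \<in> \<A>" "snd (jet_base u) \<in> fst (T2_chart \<A> c)"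
  shows "differential fst u = fst (jet_coord (snd (time_chart (T2_chart \<A> c))) 1 u)"
    and "(G has_derivative G) (at (jet_coord (snd c) 0 (snd (jet_base u)))) \<Longrightarrow>
      jet_coord (\<lambda>p. G (jet_coord (snd c) 0 (snd p))) 1 u
        = G (fst (snd (jet_coord (snd (time_chart (T2_chart \<A> c))) 1 u)))"
proof -
  note chain = jet_coord_chain[OF time_T2_atlas_transitions u, of "time_chart (T2_chart \<A> c)" UNIV]
  show "differential fst u = fst (jet_coord (snd (time_chart (T2_chart \<A> c))) 1 u)"
    unfolding differential_def
  proof (rule chain)
    show "(fst has_derivative fst) (at (snd (time_chart (T2_chart \<A> c)) (jet_base u)))"
      by (rule has_derivative_fst[OF has_derivative_ident])
  qed (use c in \<open>auto simp: time_T2_atlas_def time_chart_simps mem_Times_iff\<close>)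
  assume G: "(G has_derivative G) (at (jet_coord (snd c) 0 (snd (jet_base u))))"
  show "jet_coord (\<lambda>p. G (jet_coord (snd c) 0 (snd p))) 1 u
        = G (fst (snd (jet_coord (snd (time_chart (T2_chart \<A> c))) 1 u)))"
  proof (rule chain)
    show "((\<lambda>z. G (fst (snd z))) has_derivative (\<lambda>z. G (fst (snd z))))
        (at (snd (time_chart (T2_chart \<A> c)) (jet_base u)))"
      by (rule has_derivative_compose[OF has_derivative_fst[OF has_derivative_snd[OF has_derivative_ident]]])
        (use G in \<open>simp add: time_chart_simps T2_chart_simps\<close>)
  qed (use c in \<open>auto simp: time_T2_atlas_def time_chart_simps T2_chart_simps mem_Times_iff\<close>)
qed

lemma time_jet_transition:
  assumes u: "u \<in> jets (time_T2_atlas \<A>) 1" and c: "c \<in> \<A>" "snd (jet_base u) \<in> fst (T2_chart \<A> c)"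
    and d: "d \<in> \<A>" "snd (jet_base u) \<in> fst (T2_chart \<A> d)"
  shows "fst (snd (jet_coord (snd (time_chart (T2_chart \<A> d))) 1 u)) =
    dir_deriv (fst (snd (jet_coord (snd (time_chart (T2_chart \<A> c))) 1 u))) (transition c d)
      (jet_coord (snd c) 0 (snd (jet_base u)))"
proof -
  let ?f = "transition c d" and ?x = "jet_coord (snd c) 0 (snd (jet_base u))"
  let ?c = "time_chart (T2_chart \<A> c)"
  have base: "snd (jet_base u) \<in> jets \<A> 2" "jet_base (snd (jet_base u)) \<in> fst c"
      "jet_base (snd (jet_base u)) \<in> fst d"
    using c d by (auto simp: T2_chart_simps)
  have x: "?x \<in> overlap c d" using overlapI[OF base(1) c(1) base(2,3)] .
  have "jet_coord (\<lambda>p. jet_coord (snd d) 0 (snd p)) 1 u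
      = dir_deriv (fst (snd (jet_coord (snd ?c) 1 u))) ?f ?x"
  proof (rule jet_coord_chain[OF time_T2_atlas_transitions u, of ?c "UNIV \<times> overlap c d \<times> UNIV"])
    show "open (UNIV \<times> overlap c d \<times> UNIV :: (real \<times> 'e \<times> 'e \<times> 'e) set)"
      using open_overlap[OF c(1) d(1)] by (intro open_Times) auto
    show "jet_coord (snd d) 0 (snd q) = ?f (fst (snd (snd ?c q)))"
      if "q \<in> fst ?c" "snd ?c q \<in> UNIV \<times> overlap c d \<times> UNIV" for q
      using that jet_coord_transition(1)[of "snd q" 2 c d] base_in_chartI[of "snd q" 2 c d] c d
      by (auto simp: T2_chart_simps time_chart_simps)
    show "((\<lambda>z. ?f (fst (snd z))) has_derivative (\<lambda>z. dir_deriv (fst (snd z)) ?f ?x)) (at (snd ?c (jet_base u)))"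
      by (rule has_derivative_compose[OF has_derivative_fst[OF has_derivative_snd[OF has_derivative_ident]]])
        (use smooth_on_has_derivative[OF smooth_transition[OF c(1) d(1)] x] in
          \<open>simp add: T2_chart_simps time_chart_simps\<close>)
  qed (use c x in \<open>auto simp: time_T2_atlas_def T2_chart_simps time_chart_simps mem_Times_iff\<close>)
  moreover have "jet_coord (\<lambda>p. jet_coord (snd d) 0 (snd p)) 1 u
      = fst (snd (jet_coord (snd (time_chart (T2_chart \<A> d))) 1 u))"
    using time_jet_components(2)[OF u d has_derivative_ident] .
  ultimately show ?thesis by simp
qed

text \<open>A straight line in coordinates lifts to a curve of jets by choosing a preimage for every
  coordinate triple. The choice is made once, so that all these curves start at the same jet and
  their velocities can be inserted together into a two-form.\<close>

lemma exists_T2_point_with_tangents: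
  assumes c: "c \<in> \<A>" and x: "x \<in> snd c ` fst c"
  obtains q where "q \<in> fst (T2_chart \<A> c)" "snd (T2_chart \<A> c) q = (x, v, a)"
    and "\<And>\<tau> \<zeta>. \<exists>u\<in>jets (time_T2_atlas \<A>) 1. jet_base u = (t, q) \<and>
      jet_coord (snd (time_chart (T2_chart \<A> c))) 1 u = (\<tau>, \<zeta>)"
proof -
  let ?U = "snd c ` fst c" and ?c = "time_chart (T2_chart \<A> c)"
  have "\<exists>q. q \<in> fst (T2_chart \<A> c) \<and> snd (T2_chart \<A> c) q = z" if z: "fst z \<in> ?U" for z :: "'e \<times> 'e \<times> 'e"
    using exists_2_jet[OF c z, of "fst (snd z)" "snd (snd z)"]
    by (metis (mono_tags, lifting) T2_chart_simps mem_Collect_eq prod.collapse)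
  then obtain q where q: "\<And>z. fst z \<in> ?U \<Longrightarrow> q z \<in> fst (T2_chart \<A> c) \<and> snd (T2_chart \<A> c) (q z) = z"
    by metis
  have "\<exists>u\<in>jets (time_T2_atlas \<A>) 1. jet_base u = (t, q (x, v, a)) \<and>
      jet_coord (snd ?c) 1 u = (\<tau>, \<zeta>)" for \<tau> \<zeta>
  proof -
    let ?p = "\<lambda>s. (t, (x, v, a)) + s *\<^sub>R (\<tau>, \<zeta>)"
    define \<gamma> where "\<gamma> s = (t + s * \<tau>, q ((x, v, a) + s *\<^sub>R \<zeta>))" for s
    have "continuous_on UNIV (\<lambda>s. x + s *\<^sub>R fst \<zeta>)" by (intro continuous_intros)
    then have "open ((\<lambda>s. x + s *\<^sub>R fst \<zeta>) -` ?U)"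
      using open_vimage[OF open_chart_image[OF c]] by blast
    moreover have "0 \<in> (\<lambda>s. x + s *\<^sub>R fst \<zeta>) -` ?U" using x by simp
    ultimately obtain e where e: "0 < e" "ball 0 e \<subseteq> (\<lambda>s. x + s *\<^sub>R fst \<zeta>) -` ?U" using openE by blast
    have "x + s *\<^sub>R fst \<zeta> \<in> ?U" if "s \<in> {-e<..<e}" for s
      using that e(2) by (auto simp: ball_def dist_real_def abs_less_iff subset_iff)
    then have cg: "\<gamma> s \<in> fst ?c" "(snd ?c \<circ> \<gamma>) s = ?p s" if "s \<in> {-e<..<e}" for s
      using q[of "(x, v, a) + s *\<^sub>R \<zeta>"] that by (auto simp: \<gamma>_def time_chart_simps plus_prod_def)
    have smp: "smooth_on UNIV ?p"
      by (intro smooth_on_add smooth_on_const open_UNIV smooth_on_bounded_linear bounded_linear_scaleR_left)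
    have "smooth_on {-e<..<e} (snd ?c \<circ> \<gamma>)"
      by (rule smooth_on_cong[OF _ smooth_on_subset[OF smp]]) (use cg(2) in auto)
    moreover have cA: "?c \<in> time_T2_atlas \<A>" using c by (simp add: time_T2_atlas_def)
    ultimately have \<gamma>: "smooth_curve (time_T2_atlas \<A>) \<gamma>"
      unfolding smooth_curve_def using e(1) cg(1)
      by (intro bexI[of _ ?c]) (auto simp: split_beta simp del: o_apply)
    have p1: "(?p has_vector_derivative (\<tau>, \<zeta>)) (at 0)"
      by (auto simp: has_vector_derivative_def intro!: derivative_eq_intros)
    have I: "open {-e<..<e}" "0 \<in> {-e<..<e}" using e(1) by auto
    define u where "u = jet (time_T2_atlas \<A>) 1 \<gamma>"
    have "u \<in> jets (time_T2_atlas \<A>) 1" using \<gamma> by (simp add: u_def jets_def)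
    moreover have "jet_base u = (t, q (x, v, a))"
      using jet_base_jet[OF \<gamma>] by (simp add: u_def \<gamma>_def)
    moreover have "vector_derivative (snd ?c \<circ> \<gamma>) (at 0) = (\<tau>, \<zeta>)"
      by (rule vector_derivative_eqI[OF p1 I]) (rule cg(2))
    then have "jet_coord (snd ?c) 1 u = (\<tau>, \<zeta>)"
      using jet_coord_jet[OF \<gamma>, of "fst ?c" "snd ?c" 1 1] cA cg(1)[OF I(2)]
      by (simp add: u_def nth_vderiv_simps)
    ultimately show ?thesis by blast
  qed
  then show thesis using that[of "q (x, v, a)"] q[of "(x, v, a)"] x by simp
qed

end

section \<open>Source forms in charts\<close>

locale vector_manifold = manifold X \<A> for X :: "'a topology" and \<A> :: "('a, real ^ 'm::finite) chart set"
begin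

text \<open>On vectors with $dt(u) = 0$ and $dt(w) = 1$ the form $\omega^i \wedge dt$ takes the value
  $dx^i(u)$.\<close>

lemma source_expr_eval:
  assumes d: "d \<in> \<A>" and s: "source_expr \<A> d \<epsilon> e"
    and u: "u \<in> jets (time_T2_atlas \<A>) 1" and w: "w \<in> jets (time_T2_atlas \<A>) 1"
    and base: "jet_base w = jet_base u" "snd (jet_base u) \<in> fst (T2_chart \<A> d)"
    and t: "differential fst u = 0" "differential fst w = 1"
  shows "\<epsilon> u w = (\<Sum>i\<in>UNIV. e i (snd (T2_chart \<A> d) (snd (jet_base u)))
      * fst (snd (jet_coord (snd (time_chart (T2_chart \<A> d))) 1 u)) $ i)"
proof -
  have "contact_form d i u = fst (snd (jet_coord (snd (time_chart (T2_chart \<A> d))) 1 u)) $ i" for i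
    using time_jet_components(2)[OF u d base(2)
        bounded_linear_imp_has_derivative[OF bounded_linear_vec_nth[of i]]] t(1)
    by (simp add: contact_form_def case_prod_unfold differential_def)
  then have "wedge (contact_form d i) (differential fst) u w
      = fst (snd (jet_coord (snd (time_chart (T2_chart \<A> d))) 1 u)) $ i" for i
    by (simp add: wedge_def t)
  then show ?thesis
    using s[unfolded source_expr_def] u w base by simp
qed

text \<open>Both sides are the value of the source form on the same pair of tangent vectors.\<close>

lemma source_expr_transform:
  assumes c: "c \<in> \<A>" "source_expr \<A> c \<epsilon> e" and d: "d \<in> \<A>" "source_expr \<A> d \<epsilon> e'"
    and x: "x \<in> overlap c d"
  shows "(\<Sum>i\<in>UNIV. e i (x, v, a) * \<xi> $ i) =
    (\<Sum>i\<in>UNIV. e' i (transition c d x, dir_deriv v (transition c d) x,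
        dir_deriv v (dir_deriv v (transition c d)) x + dir_deriv a (transition c d) x)
      * dir_deriv \<xi> (transition c d) x $ i)"
proof -
  have xc: "x \<in> snd c ` fst c" using x by (auto simp: overlap_def)
  obtain q where q: "q \<in> fst (T2_chart \<A> c)" "snd (T2_chart \<A> c) q = (x, v, a)"
    and tan: "\<And>\<tau> \<zeta>. \<exists>u\<in>jets (time_T2_atlas \<A>) 1. jet_base u = (0, q) \<and>
      jet_coord (snd (time_chart (T2_chart \<A> c))) 1 u = (\<tau>, \<zeta>)"
    using exists_T2_point_with_tangents[OF c(1) xc, of v a 0] by metis
  obtain u where u: "u \<in> jets (time_T2_atlas \<A>) 1" "jet_base u = (0, q)"
    "jet_coord (snd (time_chart (T2_chart \<A> c))) 1 u = (0, \<xi>, 0, 0)" using tan by blast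
  obtain w where w: "w \<in> jets (time_T2_atlas \<A>) 1" "jet_base w = (0, q)"
    "jet_coord (snd (time_chart (T2_chart \<A> c))) 1 w = (1, 0, 0, 0)" using tan by blast
  have t: "differential fst u = 0" "differential fst w = 1"
    using time_jet_components(1)[OF u(1) c(1)] time_jet_components(1)[OF w(1) c(1)] q u w by simp_all
  have q': "q \<in> jets \<A> 2" "jet_base q \<in> fst c" "jet_coord (snd c) 0 q = x"
    "jet_coord (snd c) 1 q = v" "jet_coord (snd c) 2 q = a"
    using q by (auto simp: T2_chart_simps)
  have qd: "jet_base q \<in> fst d"
    using base_in_chartI[OF q'(1) c(1) q'(2)] x q'(3) by simp
  then have qd': "q \<in> fst (T2_chart \<A> d)" using q'(1) by (simp add: T2_chart_simps)
  have "snd (T2_chart \<A> d) q = (transition c d x, dir_deriv v (transition c d) x,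
        dir_deriv v (dir_deriv v (transition c d)) x + dir_deriv a (transition c d) x)"
    using jet_coord_transition[OF q'(1) c(1) q'(2) d(1) qd] q'(3-5) by (simp add: T2_chart_simps)
  moreover have "fst (snd (jet_coord (snd (time_chart (T2_chart \<A> d))) 1 u)) = dir_deriv \<xi> (transition c d) x"
    using time_jet_transition[OF u(1) c(1) _ d(1)] u(2,3) q(1) qd' q'(3) by simp
  ultimately show ?thesis
    using source_expr_eval[OF c u(1) w(1) _ _ t] source_expr_eval[OF d u(1) w(1) _ _ t] u(2,3) w(2) q qd'
    by simp
qed

lemma source_expr_unique:
  assumes c: "c \<in> \<A>" "source_expr \<A> c \<epsilon> e" "source_expr \<A> c \<epsilon> e'" and x: "x \<in> snd c ` fst c"
  shows "e i (x, v, a) = e' i (x, v, a)"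
proof -
  obtain q where q: "q \<in> fst (T2_chart \<A> c)" "snd (T2_chart \<A> c) q = (x, v, a)"
    and tan: "\<And>\<tau> \<zeta>. \<exists>u\<in>jets (time_T2_atlas \<A>) 1. jet_base u = (0, q) \<and>
      jet_coord (snd (time_chart (T2_chart \<A> c))) 1 u = (\<tau>, \<zeta>)"
    using exists_T2_point_with_tangents[OF c(1) x, of v a 0] by metis
  obtain u where u: "u \<in> jets (time_T2_atlas \<A>) 1" "jet_base u = (0, q)"
    "jet_coord (snd (time_chart (T2_chart \<A> c))) 1 u = (0, axis i 1, 0, 0)" using tan by blast
  obtain w where w: "w \<in> jets (time_T2_atlas \<A>) 1" "jet_base w = (0, q)"
    "jet_coord (snd (time_chart (T2_chart \<A> c))) 1 w = (1, 0, 0, 0)" using tan by blast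
  have t: "differential fst u = 0" "differential fst w = 1"
    using time_jet_components(1)[OF u(1) c(1)] time_jet_components(1)[OF w(1) c(1)] q u w by simp_all
  show ?thesis
    using source_expr_eval[OF c(1,2) u(1) w(1) _ _ t] source_expr_eval[OF c(1,3) u(1) w(1) _ _ t] u(2,3) w(2) q
      sum_axis[of 1 i "\<lambda>k. e k (x, v, a)"] sum_axis[of 1 i "\<lambda>k. e' k (x, v, a)"]
    by (simp add: mult.commute)
qed

text \<open>The coefficient $\varepsilon_i$ is a component of the two-form $\varepsilon$ in the induced
  chart.\<close>

lemma source_expr_smooth:
  assumes \<epsilon>: "two_form (time_T2_atlas \<A>) \<epsilon>" and c: "c \<in> \<A>" "source_expr \<A> c \<epsilon> e"
  shows "smooth_on (snd c ` fst c \<times> UNIV) (\<lambda>(x, v). e i (x, v, a))"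
proof -
  let ?c = "time_chart (T2_chart \<A> c)" and ?U = "snd c ` fst c"
  let ?u = "(0, axis i 1, 0, 0) :: real \<times> (real ^ 'm) \<times> (real ^ 'm) \<times> (real ^ 'm)"
  let ?w = "(1, 0, 0, 0) :: real \<times> (real ^ 'm) \<times> (real ^ 'm) \<times> (real ^ 'm)"
  have "?c \<in> time_T2_atlas \<A>" using c by (simp add: time_T2_atlas_def)
  from bspec[OF \<epsilon>[unfolded two_form_def] this] obtain \<alpha>
    where "\<forall>v w. smooth_on (snd ?c ` fst ?c) (\<lambda>z. \<alpha> z v w)"
    and \<alpha>: "\<forall>u\<in>jets (time_T2_atlas \<A>) 1. \<forall>w\<in>jets (time_T2_atlas \<A>) 1. jet_base u \<in> fst ?c \<and>
      jet_base w = jet_base u \<longrightarrow> \<epsilon> u w = \<alpha> (snd ?c (jet_base u)) (jet_coord (snd ?c) 1 u) (jet_coord (snd ?c) 1 w)"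
    unfolding case_prod_unfold by (elim exE conjE)
  then have sm: "smooth_on (snd ?c ` fst ?c) (\<lambda>z. \<alpha> z ?u ?w)" by blast
  have eq: "e i (x, v, a) = \<alpha> (t, x, v, a) ?u ?w \<and> (t, x, v, a) \<in> snd ?c ` fst ?c" if x: "x \<in> ?U" for x v a t
  proof -
    obtain q where q: "q \<in> fst (T2_chart \<A> c)" "snd (T2_chart \<A> c) q = (x, v, a)"
      and tan: "\<And>\<tau> \<zeta>. \<exists>u\<in>jets (time_T2_atlas \<A>) 1. jet_base u = (t, q) \<and>
        jet_coord (snd ?c) 1 u = (\<tau>, \<zeta>)"
      using exists_T2_point_with_tangents[OF c(1) x, of v a t] by metis
    obtain u where u: "u \<in> jets (time_T2_atlas \<A>) 1" "jet_base u = (t, q)"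
      "jet_coord (snd ?c) 1 u = ?u" using tan by blast
    obtain w where w: "w \<in> jets (time_T2_atlas \<A>) 1" "jet_base w = (t, q)"
      "jet_coord (snd ?c) 1 w = ?w" using tan by blast
    have t: "differential fst u = 0" "differential fst w = 1"
      using time_jet_components(1)[OF u(1) c(1)] time_jet_components(1)[OF w(1) c(1)] q u w by simp_all
    have "\<epsilon> u w = e i (x, v, a)"
      using source_expr_eval[OF c(1,2) u(1) w(1) _ _ t] u(2,3) w(2) q
        sum_axis[of 1 i "\<lambda>k. e k (x, v, a)"] by (simp add: mult.commute)
    moreover have tq: "(t, q) \<in> fst ?c" "snd ?c (t, q) = (t, x, v, a)"
      using q by (simp_all add: time_chart_simps)
    moreover have "\<epsilon> u w = \<alpha> (snd ?c (t, q)) ?u ?w"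
      using \<alpha>[rule_format, OF u(1) w(1)] u(2,3) w(2,3) tq(1) by simp
    ultimately show ?thesis by (metis imageI)
  qed
  have O: "open (?U \<times> (UNIV :: (real ^ 'm) set))" "open (UNIV \<times> ?U \<times> UNIV :: (real \<times> (real ^ 'm) \<times> (real ^ 'm) \<times> (real ^ 'm)) set)"
    using open_chart_image[OF c(1)] by (auto intro!: open_Times)
  have "smooth_on (?U \<times> UNIV) (\<lambda>p. (\<lambda>z. \<alpha> z ?u ?w) ((0, 0, 0, a) + (0, fst p, snd p, 0)))"
  proof (rule smooth_on_compose[OF O(1) O(2)])
    show "smooth_on (UNIV \<times> ?U \<times> UNIV) (\<lambda>z. \<alpha> z ?u ?w)"
      by (rule smooth_on_subset[OF sm]) (use eq in auto)
    have "bounded_linear (\<lambda>p :: (real ^ 'm) \<times> (real ^ 'm). (0 :: real, fst p, snd p, 0 :: real ^ 'm))"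
      by (intro bounded_linear_Pair bounded_linear_zero bounded_linear_fst bounded_linear_snd)
    then have "smooth_on (?U \<times> UNIV) (\<lambda>p :: (real ^ 'm) \<times> (real ^ 'm). (0 :: real, fst p, snd p, 0 :: real ^ 'm))"
      by (rule smooth_on_bounded_linear[OF _ O(1)])
    then show "smooth_on (?U \<times> UNIV) (\<lambda>p :: (real ^ 'm) \<times> (real ^ 'm). (0 :: real, 0, 0, a) + (0, fst p, snd p, 0))"
      by (rule smooth_on_add[OF O(1) smooth_on_const])
  qed auto
  then show ?thesis
    by (rule smooth_on_cong[OF O(1)]) (use eq in auto)
qed

end


section \<open>The coefficients of a variational source form\<close>

lemma has_derivative_pairing:
  fixes F :: "'m::finite \<Rightarrow> real ^ 'm \<Rightarrow> real"
  assumes F: "\<And>l. smooth_on UNIV (F l)"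
  shows "((\<lambda>v. \<Sum>l\<in>UNIV. F l v * a $ l) has_derivative (\<lambda>h. \<Sum>l\<in>UNIV. dir_deriv h (F l) v * a $ l)) (at v)"
  by (intro has_derivative_sum has_derivative_mult_left smooth_on_has_derivative[OF F] UNIV_I)

text \<open>Closedness without reference to a basis, a form that is preserved by linear coordinate
  changes.\<close>

lemma closed_pairing_symmetric:
  fixes F :: "'m::finite \<Rightarrow> real ^ 'm \<Rightarrow> real"
  assumes F: "\<And>l. smooth_on UNIV (F l)"
    and closed: "\<And>k l v. dir_deriv (axis k 1) (F l) v = dir_deriv (axis l 1) (F k) v"
  shows "dir_deriv h (\<lambda>v. \<Sum>l\<in>UNIV. F l v * a $ l) v = dir_deriv a (\<lambda>v. \<Sum>l\<in>UNIV. F l v * h $ l) v"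
proof -
  have expand: "dir_deriv h (\<lambda>v. \<Sum>l\<in>UNIV. F l v * a $ l) v
      = (\<Sum>l\<in>UNIV. \<Sum>k\<in>UNIV. h $ k * a $ l * dir_deriv (axis k 1) (F l) v)" for h a
  proof -
    have "dir_deriv h (\<lambda>v. \<Sum>l\<in>UNIV. F l v * a $ l) v = (\<Sum>l\<in>UNIV. dir_deriv h (F l) v * a $ l)"
      by (rule dir_deriv_eqI[OF has_derivative_pairing[OF F]])
    also have "\<dots> = (\<Sum>l\<in>UNIV. (\<Sum>k\<in>UNIV. h $ k *\<^sub>R dir_deriv (axis k 1) (F l) v) * a $ l)"
      by (simp only: linear_expand_axis[OF smooth_on_linear_dir_deriv[OF F UNIV_I], symmetric])
    also have "\<dots> = (\<Sum>l\<in>UNIV. \<Sum>k\<in>UNIV. h $ k * a $ l * dir_deriv (axis k 1) (F l) v)"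
      by (simp add: sum_distrib_left sum_distrib_right mult_ac)
    finally show ?thesis .
  qed
  have "(\<Sum>l\<in>UNIV. \<Sum>k\<in>UNIV. h $ k * a $ l * dir_deriv (axis k 1) (F l) v)
      = (\<Sum>l\<in>UNIV. \<Sum>k\<in>UNIV. h $ l * a $ k * dir_deriv (axis l 1) (F k) v)"
    by (rule sum.swap)
  also have "\<dots> = (\<Sum>l\<in>UNIV. \<Sum>k\<in>UNIV. a $ k * h $ l * dir_deriv (axis k 1) (F l) v)"
    by (intro sum.cong refl) (simp only: closed mult_ac)
  finally show ?thesis unfolding expand .
qed

locale variational_source = vector_manifold X \<A>
  for X :: "'a topology" and \<A> :: "('a, (real, 'm::{finite,linorder}) vec) chart set" +
  fixes \<epsilon> :: "(real \<times> 'a jet) jet \<Rightarrow> (real \<times> 'a jet) jet \<Rightarrow> real"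
    and A :: "('a, (real, 'm) vec) chart \<Rightarrow> 'm \<Rightarrow> (real, 'm) vec \<times> (real, 'm) vec \<Rightarrow> real"
    and B :: "('a, (real, 'm) vec) chart \<Rightarrow> 'm \<Rightarrow> 'm \<Rightarrow> (real, 'm) vec \<times> (real, 'm) vec \<Rightarrow> real"
  assumes source: "source_form \<A> \<epsilon>"
    and variational: "locally_variational X \<A> \<epsilon>"
    and expr: "c \<in> \<A> \<Longrightarrow> source_expr \<A> c \<epsilon> (\<lambda>i (x, v, a). A c i (x, v) + (\<Sum>j\<in>UNIV. B c i j (x, v) * a $ j))"
begin

definition B_pairing where
  "B_pairing c x v \<xi> a = (\<Sum>i\<in>UNIV. \<xi> $ i * (\<Sum>j\<in>UNIV. B c i j (x, v) * a $ j))"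

lemma open_velocity_domain: "c \<in> \<A> \<Longrightarrow> open (snd c ` fst c \<times> (UNIV :: (real, 'm) vec set))"
  using open_chart_image by (intro open_Times) auto

lemma smooth_A:
  assumes "c \<in> \<A>"
  shows "smooth_on (snd c ` fst c \<times> UNIV) (A c i)"
proof -
  have "two_form (time_T2_atlas \<A>) \<epsilon>" using source by (simp add: source_form_def)
  from source_expr_smooth[OF this assms expr[OF assms], of i 0] show ?thesis
    by (rule smooth_on_cong[OF open_velocity_domain[OF assms]]) auto
qed

lemma smooth_B:
  assumes "c \<in> \<A>"
  shows "smooth_on (snd c ` fst c \<times> UNIV) (B c i j)"
proof -
  have "two_form (time_T2_atlas \<A>) \<epsilon>" using source by (simp add: source_form_def)
  note sm = source_expr_smooth[OF this assms expr[OF assms], of i]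
  note O = open_velocity_domain[OF assms]
  have "(\<Sum>l\<in>UNIV. B c i l (x, v) * axis j 1 $ l) = B c i j (x, v)" for x v
    using sum_axis[of 1 j "\<lambda>l. B c i l (x, v)"] by (simp add: mult.commute)
  then show ?thesis
    by (intro smooth_on_cong[OF O smooth_on_minus[OF O sm[of "axis j 1"] sm[of 0]]]) auto
qed

lemma smooth_B_velocity:
  assumes "c \<in> \<A>" "x \<in> snd c ` fst c"
  shows "smooth_on UNIV (\<lambda>v. B c i j (x, v))"
proof -
  have "bounded_linear (\<lambda>v :: (real, 'm) vec. (0 :: (real, 'm) vec, v))"
    by (intro bounded_linear_Pair bounded_linear_zero bounded_linear_ident)
  then have "smooth_on UNIV (\<lambda>v :: (real, 'm) vec. (x, 0 :: (real, 'm) vec) + (0, v))"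
    by (intro smooth_on_add smooth_on_const open_UNIV smooth_on_bounded_linear)
  from smooth_on_compose[OF open_UNIV open_velocity_domain[OF assms(1)] smooth_B[OF assms(1)] this]
  show ?thesis using assms(2) by simp
qed

lemma transition_in_image: "x \<in> overlap c d \<Longrightarrow> c \<in> \<A> \<Longrightarrow> transition c d x \<in> snd d ` fst d"
  by (auto simp: overlap_def transition_chart)

lemma coefficients_transform:
  assumes c: "c \<in> \<A>" and d: "d \<in> \<A>" and x: "x \<in> overlap c d"
  defines "f \<equiv> transition c d"
  shows "(\<Sum>i\<in>UNIV. A c i (x, v) * \<xi> $ i) + B_pairing c x v \<xi> a =
    (\<Sum>i\<in>UNIV. A d i (f x, dir_deriv v f x) * dir_deriv \<xi> f x $ i)
      + B_pairing d (f x) (dir_deriv v f x) (dir_deriv \<xi> f x) (dir_deriv v (dir_deriv v f) x + dir_deriv a f x)"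
proof -
  have "(\<Sum>i\<in>UNIV. (p i + q i) * r i) = (\<Sum>i\<in>UNIV. p i * r i) + (\<Sum>i\<in>UNIV. r i * q i)"
    for p q r :: "'m \<Rightarrow> real"
    unfolding distrib_right sum.distrib by (simp only: mult.commute)
  then show ?thesis
    using source_expr_transform[OF c expr[OF c] d expr[OF d] x, of v a \<xi>]
    unfolding f_def B_pairing_def by simp
qed

lemma B_pairing_add: "B_pairing c x v \<xi> (a + b) = B_pairing c x v \<xi> a + B_pairing c x v \<xi> b"
  by (simp add: B_pairing_def sum.distrib distrib_left)

lemma B_pairing_scaleR: "B_pairing c x v \<xi> (r *\<^sub>R a) = r * B_pairing c x v \<xi> a"
  by (simp add: B_pairing_def sum_distrib_left mult_ac)

lemma B_pairing_zero: "B_pairing c x v \<xi> 0 = 0"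
  by (simp add: B_pairing_def)

lemma linear_transition:
  assumes "c \<in> \<A>" "d \<in> \<A>" "x \<in> overlap c d"
  shows "linear (\<lambda>v. dir_deriv v (transition c d) x)"
  using smooth_on_linear_dir_deriv[OF smooth_transition[OF assms(1,2)] assms(3)] .

text \<open>The term with \<^const>\<open>B_pairing\<close> is due to the acceleration of the second chart, which
  at acceleration $0$ of the first one equals $D^2f(x)(v,v)$.\<close>

lemma A_transform:
  assumes c: "c \<in> \<A>" and d: "d \<in> \<A>" and x: "x \<in> overlap c d"
  defines "f \<equiv> transition c d"
  shows "(\<Sum>i\<in>UNIV. A c i (x, v) * \<xi> $ i) = (\<Sum>i\<in>UNIV. A d i (f x, dir_deriv v f x) * dir_deriv \<xi> f x $ i)
      + B_pairing d (f x) (dir_deriv v f x) (dir_deriv \<xi> f x) (dir_deriv v (dir_deriv v f) x)"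
  using coefficients_transform[OF c d x, of v \<xi> 0] linear_0[OF linear_transition[OF c d x]]
  unfolding f_def by (simp add: B_pairing_zero)

lemma B_transform:
  assumes c: "c \<in> \<A>" and d: "d \<in> \<A>" and x: "x \<in> overlap c d"
  defines "f \<equiv> transition c d"
  shows "B_pairing c x v \<xi> a = B_pairing d (f x) (dir_deriv v f x) (dir_deriv \<xi> f x) (dir_deriv a f x)"
  using coefficients_transform[OF c d x, of v \<xi> a] A_transform[OF c d x, of v \<xi>]
  unfolding f_def by (simp add: B_pairing_add)

lemma B_eq_pairing: "B c i j (x, v) = B_pairing c x v (axis i 1) (axis j 1)"
  using sum_axis[of 1 i "\<lambda>i. \<Sum>l\<in>UNIV. B c i l (x, v) * axis j 1 $ l"] sum_axis[of 1 j "\<lambda>l. B c i l (x, v)"]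
  by (simp add: B_pairing_def mult.commute)

text \<open>Around a given point a Lagrangian is available in one chart \<open>d\<close> only. There
  \<open>B_closed\<close> applies, and for fixed \<open>x\<close> the law \<open>B_transform\<close> is a linear
  substitution in the velocities.\<close>

lemma B_closed_in_every_chart:
  assumes c: "c \<in> \<A>" and x: "x \<in> snd c ` fst c"
  shows "dir_deriv (axis k 1) (\<lambda>v. B c i j (x, v)) v = dir_deriv (axis j 1) (\<lambda>v. B c i k (x, v)) v"
proof -
  obtain p where p: "p \<in> fst c" "x = snd c p" using x by blast
  have "p \<in> topspace X"
    using p(1) is_chart[OF c] openin_subset[of X "fst c"] by (auto simp: is_chart_def split_beta)
  from bspec[OF variational[unfolded locally_variational_def] this]
  obtain d e L where d: "d \<in> \<A>" "p \<in> fst d" and "source_expr \<A> (fst d, snd d) \<epsilon> e"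
    and L: "smooth_on (UNIV \<times> snd d ` fst d \<times> UNIV \<times> UNIV) L"
    and EL: "\<forall>i. \<forall>x\<in>snd d ` fst d. \<forall>t v a b b'. e i (x, v, a) = euler_lagrange L i (t, x, v, a, b, b')"
    unfolding case_prod_unfold by (elim bexE conjE exE)
  then have e: "source_expr \<A> d \<epsilon> e" by simp
  interpret L: second_order_lagrangian "snd d ` fst d" L "A d" "B d"
  proof
    show "open (snd d ` fst d)" using open_chart_image[OF d(1)] .
    show "smooth_on (UNIV \<times> snd d ` fst d \<times> UNIV) L" using L by simp
    show "A d i (x, v) + (\<Sum>j\<in>UNIV. B d i j (x, v) * a $ j) = euler_lagrange L i (t, x, v, a, b, b')"
      if "x \<in> snd d ` fst d" for x i v a t b b'
      using source_expr_unique[OF d(1) expr[OF d(1)] e that, of i v a]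
        EL[rule_format, OF that, of i v a t b b'] by simp
  qed
  let ?f = "transition c d"
  have ov: "x \<in> overlap c d" using p d by (simp add: overlap_def)
  let ?J = "\<lambda>v. dir_deriv v ?f x"
  note y = transition_in_image[OF ov c]
  let ?P = "\<lambda>i a w. \<Sum>j\<in>UNIV. B d i j (?f x, w) * a $ j"
  have J: "(?J has_derivative ?J) (at v)"
    using linear_imp_has_derivative linear_transition[OF c d(1) ov] by blast
  have P: "(?P l a has_derivative (\<lambda>h. dir_deriv h (?P l a) w)) (at w)" for l a w
  proof -
    note P = has_derivative_pairing[of "\<lambda>j w. B d l j (?f x, w)" a w, OF smooth_B_velocity[OF d(1) y]]
    show ?thesis
      by (rule has_derivative_eq_rhs[OF P]) (rule ext, rule dir_deriv_eqI[OF P, symmetric])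
  qed
  have deriv: "dir_deriv (axis k 1) (\<lambda>v. B c i j (x, v)) v
      = (\<Sum>l\<in>UNIV. ?J (axis i 1) $ l * dir_deriv (?J (axis k 1)) (?P l (?J (axis j 1))) (?J v))" for j k
  proof -
    have eq: "(\<lambda>v. B c i j (x, v)) = (\<lambda>v. \<Sum>l\<in>UNIV. ?J (axis i 1) $ l * ?P l (?J (axis j 1)) (?J v))"
      using B_eq_pairing[of c i j x] B_transform[OF c d(1) ov, of _ "axis i 1" "axis j 1"]
      by (simp only: B_pairing_def[of d])
    have "((\<lambda>v. \<Sum>l\<in>UNIV. ?J (axis i 1) $ l * ?P l (?J (axis j 1)) (?J v)) has_derivative
        (\<lambda>h. \<Sum>l\<in>UNIV. ?J (axis i 1) $ l * dir_deriv (?J h) (?P l (?J (axis j 1))) (?J v))) (at v)"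
      by (intro has_derivative_sum has_derivative_mult_right has_derivative_compose[OF J P])
    then show ?thesis unfolding eq by (rule dir_deriv_eqI)
  qed
  have "dir_deriv h (?P l a) w = dir_deriv a (?P l h) w" for h l a w
    by (rule closed_pairing_symmetric[OF smooth_B_velocity[OF d(1) y] L.B_closed[OF y]])
  then show ?thesis unfolding deriv by simp
qed

section \<open>The one-form\<close>

definition kappa_coeff where
  "kappa_coeff c j z = radial_potential (\<lambda>l v. B c j l (fst z, v)) (snd z)"

abbreviation velocity where
  "velocity c u \<equiv> fst (jet_coord (snd (tangent_chart \<A> c)) 1 u)"

lemma differential_coordinate:
  assumes u: "u \<in> jets (tangent_atlas \<A>) 1" and c: "c \<in> \<A>" "jet_base u \<in> fst (tangent_chart \<A> c)"
  shows "differential (\<lambda>q. jet_coord (snd c) 0 q $ j) u = velocity c u $ j"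
  unfolding differential_def
  by (rule tangent_jet_components[OF u c bounded_linear_imp_has_derivative[OF bounded_linear_vec_nth]])

lemma tangent_point_in_image:
  assumes c: "c \<in> \<A>" "q \<in> fst (tangent_chart \<A> c)"
  shows "jet_coord (snd c) 0 q \<in> snd c ` fst c"
  using c jet_coord_0[of q 1 c] by (simp add: tangent_chart_simps)

lemma kappa_chart_eq:
  assumes u: "u \<in> jets (tangent_atlas \<A>) 1" and c: "c \<in> \<A>" "jet_base u \<in> fst (tangent_chart \<A> c)"
  shows "kappa_chart c (B c) u =
    - (\<Sum>j\<in>UNIV. kappa_coeff c j (snd (tangent_chart \<A> c) (jet_base u)) * velocity c u $ j)"
proof -
  let ?x = "jet_coord (snd c) 0 (jet_base u)" and ?v = "jet_coord (snd c) 1 (jet_base u)"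
  have x: "?x \<in> snd c ` fst c" using tangent_point_in_image[OF c] .
  have "(\<Sum>l\<in>UNIV. LBINT \<nu>=0..ereal (?v $ l). B c j l (?x, tail_vec l \<nu> ?v))
      = radial_potential (\<lambda>l v. B c j l (?x, v)) ?v" for j
    by (rule staircase_integral_eq_radial_potential[OF smooth_B_velocity[OF c(1) x] B_closed_in_every_chart[OF c(1) x]])
  then show ?thesis
    unfolding kappa_chart_def
    by (simp add: case_prod_unfold Let_def kappa_coeff_def differential_coordinate[OF u c] tangent_chart_simps)
qed

lemma kappa_coeff_integral:
  assumes c: "c \<in> \<A>" and x: "x \<in> snd c ` fst c"
  shows "(\<Sum>j\<in>UNIV. kappa_coeff c j (x, v) * \<xi> $ j) = integral {0..1} (\<lambda>s. B_pairing c x (s *\<^sub>R v) \<xi> v)"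
proof -
  have int: "(\<lambda>s. B c j l (x, s *\<^sub>R v)) integrable_on {0..1}" for j l
  proof (rule integrable_continuous_real)
    show "continuous_on {0..1} (\<lambda>s. B c j l (x, s *\<^sub>R v))"
      by (rule continuous_on_compose2[OF smooth_on_imp_continuous_on[OF smooth_B_velocity[OF c x, of j l]]])
        (auto intro!: continuous_intros)
  qed
  have "integral {0..1} (\<lambda>s. B_pairing c x (s *\<^sub>R v) \<xi> v)
      = (\<Sum>j\<in>UNIV. \<xi> $ j * (\<Sum>l\<in>UNIV. integral {0..1} (\<lambda>s. B c j l (x, s *\<^sub>R v)) * v $ l))"
    unfolding B_pairing_def
    by (simp add: integral_sum integrable_sum integrable_on_mult_right integrable_on_mult_left int)
  then show ?thesis
    by (simp add: kappa_coeff_def radial_potential_def mult.commute)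
qed

text \<open>The differential of the transition map sends the segment from $0$ to $v$ to the corresponding
  segment in the second chart, and \<open>B_transform\<close> identifies the integrands.\<close>

lemma kappa_chart_independent:
  assumes u: "u \<in> jets (tangent_atlas \<A>) 1" and c: "c \<in> \<A>" "jet_base u \<in> fst (tangent_chart \<A> c)"
    and d: "d \<in> \<A>" "jet_base u \<in> fst (tangent_chart \<A> d)"
  shows "kappa_chart c (B c) u = kappa_chart d (B d) u"
proof -
  let ?f = "transition c d"
  let ?x = "jet_coord (snd c) 0 (jet_base u)" and ?v = "jet_coord (snd c) 1 (jet_base u)"
  let ?J = "\<lambda>v. dir_deriv v ?f ?x"
  have base: "jet_base u \<in> jets \<A> 1" "jet_base (jet_base u) \<in> fst c" "jet_base (jet_base u) \<in> fst d"
    using c d by (auto simp: tangent_chart_simps)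
  have x: "?x \<in> overlap c d" using overlapI[OF base(1) c(1) base(2,3)] .
  have xd: "jet_coord (snd d) 0 (jet_base u) = ?f ?x" "jet_coord (snd d) 1 (jet_base u) = ?J ?v"
    using jet_coord_transition(1,2)[OF base(1) c(1) base(2) d(1) base(3)] .
  have \<xi>: "velocity d u = ?J (velocity c u)" using tangent_jet_transition[OF u c d] .
  have "B_pairing d (?f ?x) (s *\<^sub>R ?J ?v) (?J (velocity c u)) (?J ?v)
      = B_pairing c ?x (s *\<^sub>R ?v) (velocity c u) ?v" for s
    using B_transform[OF c(1) d(1) x] linear_scale[OF linear_transition[OF c(1) d(1) x], of s ?v] by simp
  then have "integral {0..1} (\<lambda>s. B_pairing c ?x (s *\<^sub>R ?v) (velocity c u) ?v)
      = integral {0..1} (\<lambda>s. B_pairing d (?f ?x) (s *\<^sub>R ?J ?v) (?J (velocity c u)) (?J ?v))"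
    by simp
  then show ?thesis
    unfolding kappa_chart_eq[OF u c] kappa_chart_eq[OF u d] tangent_chart_simps xd
      kappa_coeff_integral[OF c(1) tangent_point_in_image[OF c]]
      kappa_coeff_integral[OF d(1) transition_in_image[OF x c(1)]] \<xi>
    by simp
qed

lemma smooth_kappa_coeff:
  assumes c: "c \<in> \<A>"
  shows "smooth_on (snd c ` fst c \<times> UNIV) (kappa_coeff c j)"
proof -
  let ?D = "snd c ` fst c \<times> UNIV :: ((real, 'm) vec \<times> (real, 'm) vec) set"
  note O = open_velocity_domain[OF c]
  let ?T0 = "\<lambda>z :: (real, 'm) vec \<times> (real, 'm) vec. (fst z, 0 :: (real, 'm) vec)"
  let ?T1 = "\<lambda>z :: (real, 'm) vec \<times> (real, 'm) vec. (0 :: (real, 'm) vec, snd z)"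
  have T: "linear ?T0" "linear ?T1" by (auto intro!: linearI)
  have "smooth_on ?D (\<lambda>z. integral {0..1} (\<lambda>s. s ^ 0 * B c j l (?T0 z + s *\<^sub>R ?T1 z)))" for l
    by (rule smooth_on_integral_affine[OF T O _ smooth_B[OF c]]) auto
  moreover have "smooth_on ?D (\<lambda>z. snd z $ l)" for l
    by (intro smooth_on_bounded_linear O bounded_linear_compose[OF bounded_linear_vec_nth bounded_linear_snd])
  ultimately have "smooth_on ?D (\<lambda>z. \<Sum>l\<in>UNIV. snd z $ l * integral {0..1} (\<lambda>s. s ^ 0 * B c j l (?T0 z + s *\<^sub>R ?T1 z)))"
    by (intro smooth_on_sum smooth_on_mult O)
  then show ?thesis
    by (rule smooth_on_cong[OF O]) (simp add: kappa_coeff_def radial_potential_def)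
qed

lemma tangent_chart_image: "c \<in> \<A> \<Longrightarrow> snd (tangent_chart \<A> c) ` fst (tangent_chart \<A> c) \<subseteq> snd c ` fst c \<times> UNIV"
  using tangent_point_in_image by (auto simp: tangent_chart_simps(2))

lemma kappa_one_form:
  assumes \<kappa>: "\<And>c u. c \<in> \<A> \<Longrightarrow> u \<in> jets (tangent_atlas \<A>) 1 \<Longrightarrow> jet_base u \<in> fst (tangent_chart \<A> c) \<Longrightarrow>
    \<kappa> u = kappa_chart c (B c) u"
  shows "one_form (tangent_atlas \<A>) \<kappa>"
  unfolding one_form_def
proof (rule ballI)
  fix c' assume "c' \<in> tangent_atlas \<A>"
  then obtain c where c: "c \<in> \<A>" "c' = tangent_chart \<A> c" by (auto simp: tangent_atlas_def)
  define a where "a z w = - (\<Sum>j\<in>UNIV. kappa_coeff c j z * fst w $ j)"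
    for z w :: "(real, 'm) vec \<times> (real, 'm) vec"
  have "linear (a z)" for z
    by (rule linearI) (simp_all add: a_def sum.distrib distrib_left sum_distrib_left mult_ac flip: sum_negf)
  moreover have "smooth_on (snd c' ` fst c') (\<lambda>z. a z w)" for w
  proof -
    note O = open_velocity_domain[OF c(1)]
    have "smooth_on (snd c ` fst c \<times> UNIV) (\<lambda>z. \<Sum>j\<in>UNIV. kappa_coeff c j z * - fst w $ j)"
      by (intro smooth_on_sum smooth_on_mult smooth_on_const O smooth_kappa_coeff c(1))
    then have "smooth_on (snd c ` fst c \<times> UNIV) (\<lambda>z. a z w)"
      by (rule smooth_on_cong[OF O]) (simp add: a_def sum_negf)
    then show ?thesis
      using smooth_on_subset tangent_chart_image[OF c(1)] c(2) by blast
  qed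
  moreover have "\<kappa> u = a (snd c' (jet_base u)) (jet_coord (snd c') 1 u)"
    if "u \<in> jets (tangent_atlas \<A>) 1" "jet_base u \<in> fst c'" for u
    using \<kappa>[OF c(1) that(1)] kappa_chart_eq[OF that(1) c(1)] that(2) c(2) by (simp add: a_def)
  ultimately have "(\<forall>x\<in>snd c' ` fst c'. linear (a x)) \<and> (\<forall>v. smooth_on (snd c' ` fst c') (\<lambda>x. a x v)) \<and>
     (\<forall>u\<in>jets (tangent_atlas \<A>) 1. jet_base u \<in> fst c' \<longrightarrow> \<kappa> u = a (snd c' (jet_base u)) (jet_coord (snd c') 1 u))"
    by blast
  then show "case c' of (V, \<psi>) \<Rightarrow> \<exists>a. (\<forall>x\<in>\<psi> ` V. linear (a x)) \<and> (\<forall>v. smooth_on (\<psi> ` V) (\<lambda>x. a x v)) \<and>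
      (\<forall>u\<in>jets (tangent_atlas \<A>) 1. jet_base u \<in> V \<longrightarrow> \<kappa> u = a (\<psi> (jet_base u)) (jet_coord \<psi> 1 u))"
    unfolding case_prod_unfold by (rule exI[of _ a])
qed

section \<open>The two-form\<close>

definition A_velocity_deriv where
  "A_velocity_deriv c x i j = frechet_derivative (A c i) (at (x, 0)) (0, axis j 1)"

definition A_form where
  "A_form c x \<xi> \<eta> = (\<Sum>i\<in>UNIV. \<Sum>j\<in>UNIV. A_velocity_deriv c x i j * \<xi> $ i * \<eta> $ j)"

lemma A_form_eq:
  assumes c: "c \<in> \<A>" and x: "x \<in> snd c ` fst c"
  shows "A_form c x \<xi> \<eta> = (\<Sum>i\<in>UNIV. dir_deriv (0, \<eta>) (A c i) (x, 0) * \<xi> $ i)"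
proof -
  have lin: "linear (\<lambda>\<eta>. dir_deriv (0, \<eta>) (A c i) (x, 0))" for i
  proof -
    have "(x, 0) \<in> snd c ` fst c \<times> UNIV" using x by simp
    from linear_compose[OF _ smooth_on_linear_dir_deriv[OF smooth_A[OF c] this, of i], of "Pair 0"]
    show ?thesis by (simp only: o_def) (simp add: linearI)
  qed
  have "dir_deriv (0, \<eta>) (A c i) (x, 0) = (\<Sum>j\<in>UNIV. \<eta> $ j * A_velocity_deriv c x i j)" for i
    using linear_expand_axis[OF lin[of i], of \<eta>] by (simp only: A_velocity_deriv_def real_scaleR_def)
  then show ?thesis
    by (simp add: A_form_def sum_distrib_left mult_ac)
qed

lemma bilinear_A_form: "bilinear (A_form c x)"
  unfolding bilinear_def A_form_def
  by (auto intro!: linearI simp: sum.distrib distrib_left distrib_right sum_distrib_left mult_ac)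

text \<open>Along the line $v = s\eta$ the correction term of \<open>A_transform\<close> carries the factor
  $s^2$, so its derivative vanishes at $s = 0$.\<close>

lemma A_form_transform:
  assumes c: "c \<in> \<A>" and d: "d \<in> \<A>" and x: "x \<in> overlap c d"
  defines "f \<equiv> transition c d"
  shows "A_form c x \<xi> \<eta> = A_form d (f x) (dir_deriv \<xi> f x) (dir_deriv \<eta> f x)"
proof -
  let ?J = "\<lambda>v. dir_deriv v f x"
  have xc: "x \<in> snd c ` fst c" using x by (auto simp: overlap_def)
  have y: "f x \<in> snd d ` fst d" using transition_in_image[OF x c] by (simp add: f_def)
  note smf = smooth_transition[OF c d, folded f_def]
  have J: "linear ?J" using linear_transition[OF c d x] by (simp add: f_def)
  have dA: "((\<lambda>s. \<Sum>i\<in>UNIV. A e i (z, s *\<^sub>R h) * k $ i) has_real_derivative A_form e z k h) (at 0)"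
    if e: "e \<in> \<A>" and z: "z \<in> snd e ` fst e" for e z h k
  proof -
    have "((\<lambda>s. A e i (z, s *\<^sub>R h)) has_real_derivative dir_deriv (0, h) (A e i) (z, 0)) (at 0)" for i
    proof -
      have sm: "(A e i has_derivative (\<lambda>w. dir_deriv w (A e i) (z, 0 *\<^sub>R h))) (at (z, 0 *\<^sub>R h))"
        using smooth_on_has_derivative[OF smooth_A[OF e], of "(z, 0)"] z by simp
      have "((\<lambda>s. (z, s *\<^sub>R h)) has_derivative (\<lambda>r. r *\<^sub>R (0, h))) (at 0)"
        by (auto intro!: derivative_eq_intros)
      from has_derivative_compose[OF this sm] show ?thesis
        unfolding has_field_derivative_def
        by (rule has_derivative_eq_rhs)
          (simp add: fun_eq_iff linear_scale[OF has_derivative_linear[OF sm], simplified] del: scaleR_Pair)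
    qed
    then show ?thesis
      unfolding A_form_eq[OF e z] by (intro derivative_intros DERIV_cmult_right)
  qed
  define g where "g s = B_pairing d (f x) (s *\<^sub>R ?J \<eta>) (?J \<xi>) (dir_deriv \<eta> (dir_deriv \<eta> f) x)" for s
  have "g differentiable (at 0)"
  proof -
    have "(\<lambda>s. B d i j (f x, s *\<^sub>R ?J \<eta>)) differentiable (at 0)" for i j
      by (rule differentiableI, rule has_derivative_compose[OF
            bounded_linear_imp_has_derivative[OF bounded_linear_scaleR_left]
            smooth_on_has_derivative[OF smooth_B_velocity[OF d y] UNIV_I]])
    then show ?thesis
      unfolding g_def B_pairing_def by (intro differentiable_sum differentiable_mult ballI) auto
  qed
  then obtain g' where g': "(g has_real_derivative g') (at 0)"
    by (auto simp: real_differentiable_def)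
  have eq: "(\<Sum>i\<in>UNIV. A c i (x, s *\<^sub>R \<eta>) * \<xi> $ i)
      = (\<Sum>i\<in>UNIV. A d i (f x, s *\<^sub>R ?J \<eta>) * ?J \<xi> $ i) + s * (s * g s)" for s
  proof -
    have "dir_deriv (s *\<^sub>R \<eta>) (dir_deriv (s *\<^sub>R \<eta>) f) x = s *\<^sub>R s *\<^sub>R dir_deriv \<eta> (dir_deriv \<eta> f) x"
      using linear_scale[OF linear_dir_deriv_dir_deriv[OF open_overlap[OF c d] smf x]]
        linear_scale[OF smooth_on_linear_dir_deriv[OF smooth_on_dir_deriv[OF smf] x]] by metis
    then show ?thesis
      using A_transform[OF c d x, folded f_def, of "s *\<^sub>R \<eta>" \<xi>] linear_scale[OF J, of s \<eta>]
      by (simp add: B_pairing_scaleR g_def del: scaleR_scaleR)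
  qed
  have "((\<lambda>s. s * (s * g s)) has_real_derivative 0) (at 0)"
    by (auto intro!: derivative_eq_intros g')
  from DERIV_add[OF dA[OF d y] this]
  have "((\<lambda>s. (\<Sum>i\<in>UNIV. A d i (f x, s *\<^sub>R ?J \<eta>) * ?J \<xi> $ i) + s * (s * g s)) has_real_derivative
      A_form d (f x) (?J \<xi>) (?J \<eta>)) (at 0)"
    by simp
  then have "((\<lambda>s. \<Sum>i\<in>UNIV. A c i (x, s *\<^sub>R \<eta>) * \<xi> $ i) has_real_derivative A_form d (f x) (?J \<xi>) (?J \<eta>)) (at 0)"
    unfolding eq .
  from DERIV_unique[OF dA[OF c xc] this] show ?thesis .
qed

text \<open>The double sum contracts an antisymmetrized matrix with an antisymmetrized product, so the
  antisymmetric part is counted twice.\<close>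

lemma omega_chart_eq:
  assumes u: "u \<in> jets (tangent_atlas \<A>) 1" and w: "w \<in> jets (tangent_atlas \<A>) 1"
    and c: "c \<in> \<A>" "jet_base u \<in> fst (tangent_chart \<A> c)" and base: "jet_base w = jet_base u"
  defines "x \<equiv> jet_coord (snd c) 0 (jet_base u)"
  shows "omega_chart c (A c) u w =
    1 / 2 * (A_form c x (velocity c u) (velocity c w) - A_form c x (velocity c w) (velocity c u))"
proof -
  let ?M = "A_velocity_deriv c x" and ?\<xi> = "velocity c u" and ?\<eta> = "velocity c w"
  have swap: "(\<Sum>i\<in>UNIV. \<Sum>j\<in>UNIV. ?M j i * (h $ i * k $ j)) = A_form c x k h" for h k
    unfolding A_form_def by (subst sum.swap) (simp add: mult_ac)
  have "omega_chart c (A c) u w = 1 / 4 * (\<Sum>i\<in>UNIV. \<Sum>j\<in>UNIV. (?M i j - ?M j i) * (?\<xi> $ i * ?\<eta> $ j - ?\<eta> $ i * ?\<xi> $ j))"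
    using differential_coordinate[OF u c] differential_coordinate[OF w c(1)] c(2) base
    by (simp add: omega_chart_def case_prod_unfold Let_def wedge_def A_velocity_deriv_def x_def)
  also have "(\<Sum>i\<in>UNIV. \<Sum>j\<in>UNIV. (?M i j - ?M j i) * (?\<xi> $ i * ?\<eta> $ j - ?\<eta> $ i * ?\<xi> $ j))
      = A_form c x ?\<xi> ?\<eta> - A_form c x ?\<eta> ?\<xi>
        - (\<Sum>i\<in>UNIV. \<Sum>j\<in>UNIV. ?M j i * (?\<xi> $ i * ?\<eta> $ j)) + (\<Sum>i\<in>UNIV. \<Sum>j\<in>UNIV. ?M j i * (?\<eta> $ i * ?\<xi> $ j))"
    unfolding A_form_def by (simp add: algebra_simps sum.distrib sum_subtractf)
  finally show ?thesis unfolding swap by simp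
qed

lemma omega_chart_independent:
  assumes u: "u \<in> jets (tangent_atlas \<A>) 1" and w: "w \<in> jets (tangent_atlas \<A>) 1"
    and c: "c \<in> \<A>" "jet_base u \<in> fst (tangent_chart \<A> c)"
    and d: "d \<in> \<A>" "jet_base u \<in> fst (tangent_chart \<A> d)" and base: "jet_base w = jet_base u"
  shows "omega_chart c (A c) u w = omega_chart d (A d) u w"
proof -
  let ?x = "jet_coord (snd c) 0 (jet_base u)"
  have base': "jet_base u \<in> jets \<A> 1" "jet_base (jet_base u) \<in> fst c" "jet_base (jet_base u) \<in> fst d"
    using c d by (auto simp: tangent_chart_simps)
  have x: "?x \<in> overlap c d" using overlapI[OF base'(1) c(1) base'(2,3)] .
  have xd: "jet_coord (snd d) 0 (jet_base u) = transition c d ?x"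
    using jet_coord_transition(1)[OF base'(1) c(1) base'(2) d(1) base'(3)] .
  have v: "velocity d u = dir_deriv (velocity c u) (transition c d) ?x"
    "velocity d w = dir_deriv (velocity c w) (transition c d) ?x"
    using tangent_jet_transition[OF u c d] tangent_jet_transition[OF w c(1) _ d(1)] c(2) d(2) base by simp_all
  show ?thesis
    unfolding omega_chart_eq[OF u w c base] omega_chart_eq[OF u w d base] xd v A_form_transform[OF c(1) d(1) x] ..
qed

lemma omega_two_form:
  assumes \<omega>: "\<And>c u w. c \<in> \<A> \<Longrightarrow> u \<in> jets (tangent_atlas \<A>) 1 \<Longrightarrow> w \<in> jets (tangent_atlas \<A>) 1 \<Longrightarrow>
    jet_base w = jet_base u \<Longrightarrow> jet_base u \<in> fst (tangent_chart \<A> c) \<Longrightarrow> \<omega> u w = omega_chart c (A c) u w"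
  shows "two_form (tangent_atlas \<A>) \<omega>"
  unfolding two_form_def
proof (rule ballI)
  fix c' assume "c' \<in> tangent_atlas \<A>"
  then obtain c where c: "c \<in> \<A>" "c' = tangent_chart \<A> c" by (auto simp: tangent_atlas_def)
  define a where "a z h k = 1 / 2 * (A_form c (fst z) (fst h) (fst k) - A_form c (fst z) (fst k) (fst h))"
    for z h k :: "(real, 'm) vec \<times> (real, 'm) vec"
  have "bilinear (a z)" for z
    using bilinear_A_form[of c "fst z"] unfolding bilinear_def[of "a z"]
    by (auto intro!: linearI simp: a_def bilinear_ladd bilinear_radd bilinear_lmul bilinear_rmul field_simps)
  moreover have "a z h h = 0" for z h by (simp add: a_def)
  moreover have "smooth_on (snd c' ` fst c') (\<lambda>z. a z h k)" for h k
  proof -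
    let ?D = "snd c ` fst c \<times> UNIV :: ((real, 'm) vec \<times> (real, 'm) vec) set"
    note O = open_velocity_domain[OF c(1)]
    have M: "smooth_on ?D (\<lambda>z. A_velocity_deriv c (fst z) i j)" for i j
    proof -
      have "bounded_linear (\<lambda>z :: (real, 'm) vec \<times> (real, 'm) vec. (fst z, 0 :: (real, 'm) vec))"
        by (intro bounded_linear_Pair bounded_linear_zero bounded_linear_fst)
      from smooth_on_compose[OF O O smooth_on_dir_deriv[OF smooth_A[OF c(1)]] smooth_on_bounded_linear[OF this O]]
      show ?thesis unfolding A_velocity_deriv_def by auto
    qed
    have "smooth_on ?D (\<lambda>z. A_form c (fst z) \<xi> \<eta>)" for \<xi> \<eta>
      unfolding A_form_def by (intro smooth_on_sum smooth_on_mult smooth_on_const O M)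
    then have "smooth_on ?D (\<lambda>z. a z h k)"
      unfolding a_def by (intro smooth_on_mult smooth_on_minus smooth_on_const O)
    then show ?thesis
      using smooth_on_subset tangent_chart_image[OF c(1)] c(2) by blast
  qed
  moreover have "\<omega> u w = a (snd c' (jet_base u)) (jet_coord (snd c') 1 u) (jet_coord (snd c') 1 w)"
    if "u \<in> jets (tangent_atlas \<A>) 1" "w \<in> jets (tangent_atlas \<A>) 1" "jet_base u \<in> fst c' \<and> jet_base w = jet_base u" for u w
    using \<omega>[OF c(1) that(1,2)] omega_chart_eq[OF that(1,2) c(1)] that(3) c(2)
    by (simp add: a_def tangent_chart_simps(2))
  ultimately have "(\<forall>x\<in>snd c' ` fst c'. bilinear (a x) \<and> (\<forall>v. a x v v = 0)) \<and>
     (\<forall>v w. smooth_on (snd c' ` fst c') (\<lambda>x. a x v w)) \<and>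
     (\<forall>u\<in>jets (tangent_atlas \<A>) 1. \<forall>w\<in>jets (tangent_atlas \<A>) 1. jet_base u \<in> fst c' \<and> jet_base w = jet_base u \<longrightarrow>
        \<omega> u w = a (snd c' (jet_base u)) (jet_coord (snd c') 1 u) (jet_coord (snd c') 1 w))"
    by blast
  then show "case c' of (V, \<psi>) \<Rightarrow> \<exists>a. (\<forall>x\<in>\<psi> ` V. bilinear (a x) \<and> (\<forall>v. a x v v = 0)) \<and>
     (\<forall>v w. smooth_on (\<psi> ` V) (\<lambda>x. a x v w)) \<and>
     (\<forall>u\<in>jets (tangent_atlas \<A>) 1. \<forall>w\<in>jets (tangent_atlas \<A>) 1. jet_base u \<in> V \<and> jet_base w = jet_base u \<longrightarrow>
        \<omega> u w = a (\<psi> (jet_base u)) (jet_coord \<psi> 1 u) (jet_coord \<psi> 1 w))"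
    unfolding case_prod_unfold by (rule exI[of _ a])
qed

end

section \<open>Globality of both forms\<close>

theorem theorem9:
  fixes X :: "'a topology"
    and \<A> :: "('a, (real, 'm::{finite,linorder}) vec) chart set"
    and \<epsilon> :: "(real \<times> 'a jet) jet \<Rightarrow> (real \<times> 'a jet) jet \<Rightarrow> real"
    and A :: "('a, (real, 'm) vec) chart \<Rightarrow> 'm \<Rightarrow> (real, 'm) vec \<times> (real, 'm) vec \<Rightarrow> real"
    and B :: "('a, (real, 'm) vec) chart \<Rightarrow> 'm \<Rightarrow> 'm \<Rightarrow> (real, 'm) vec \<times> (real, 'm) vec \<Rightarrow> real"
  assumes "smooth_manifold X \<A>"
    and "CARD('m) \<ge> 2"
    and "source_form \<A> \<epsilon>"
    and "locally_variational X \<A> \<epsilon>"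
    and "\<forall>c\<in>\<A>. source_expr \<A> c \<epsilon>
           (\<lambda>i (x, v, a). A c i (x, v) + (\<Sum>j\<in>UNIV. B c i j (x, v) * a $ j))"
  shows "(\<forall>c\<in>\<A>. \<forall>d\<in>\<A>. \<forall>u\<in>jets (tangent_atlas \<A>) 1.
            jet_base u \<in> fst (tangent_chart \<A> c) \<inter> fst (tangent_chart \<A> d) \<longrightarrow>
            kappa_chart c (B c) u = kappa_chart d (B d) u) \<and>
         (\<exists>\<kappa>. one_form (tangent_atlas \<A>) \<kappa> \<and>
            (\<forall>c\<in>\<A>. \<forall>u\<in>jets (tangent_atlas \<A>) 1.
               jet_base u \<in> fst (tangent_chart \<A> c) \<longrightarrow> \<kappa> u = kappa_chart c (B c) u)) \<and>
         (\<forall>c\<in>\<A>. \<forall>d\<in>\<A>. \<forall>u\<in>jets (tangent_atlas \<A>) 1. \<forall>w\<in>jets (tangent_atlas \<A>) 1.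
            jet_base w = jet_base u \<and>
            jet_base u \<in> fst (tangent_chart \<A> c) \<inter> fst (tangent_chart \<A> d) \<longrightarrow>
            omega_chart c (A c) u w = omega_chart d (A d) u w) \<and>
         (\<exists>\<omega>. two_form (tangent_atlas \<A>) \<omega> \<and>
            (\<forall>c\<in>\<A>. \<forall>u\<in>jets (tangent_atlas \<A>) 1. \<forall>w\<in>jets (tangent_atlas \<A>) 1.
               jet_base w = jet_base u \<and> jet_base u \<in> fst (tangent_chart \<A> c) \<longrightarrow>
               \<omega> u w = omega_chart c (A c) u w))"
proof -
  interpret variational_source X \<A> \<epsilon> A B
    using assms by unfold_locales auto
  define chart_at where "chart_at q = (SOME c. c \<in> \<A> \<and> q \<in> fst (tangent_chart \<A> c))" for q
  have chart_at: "chart_at q \<in> \<A>" "q \<in> fst (tangent_chart \<A> (chart_at q))"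
    if "c \<in> \<A>" "q \<in> fst (tangent_chart \<A> c)" for c q
    using someI[of "\<lambda>c. c \<in> \<A> \<and> q \<in> fst (tangent_chart \<A> c)" c] that by (simp_all add: chart_at_def)
  define \<kappa> where "\<kappa> u = kappa_chart (chart_at (jet_base u)) (B (chart_at (jet_base u))) u" for u
  define \<omega> where "\<omega> u = omega_chart (chart_at (jet_base u)) (A (chart_at (jet_base u))) u" for u
  have \<kappa>: "\<kappa> u = kappa_chart c (B c) u"
    if "c \<in> \<A>" "u \<in> jets (tangent_atlas \<A>) 1" "jet_base u \<in> fst (tangent_chart \<A> c)" for c u
    unfolding \<kappa>_def using kappa_chart_independent[OF that(2) chart_at[OF that(1,3)] that(1,3)] .
  have \<omega>: "\<omega> u w = omega_chart c (A c) u w"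
    if "c \<in> \<A>" "u \<in> jets (tangent_atlas \<A>) 1" "w \<in> jets (tangent_atlas \<A>) 1"
      "jet_base w = jet_base u" "jet_base u \<in> fst (tangent_chart \<A> c)" for c u w
    unfolding \<omega>_def using omega_chart_independent[OF that(2,3) chart_at[OF that(1,5)] that(1,5,4)] .
  show ?thesis
  proof (intro conjI)
    show "\<exists>\<kappa>. one_form (tangent_atlas \<A>) \<kappa> \<and>
            (\<forall>c\<in>\<A>. \<forall>u\<in>jets (tangent_atlas \<A>) 1.
               jet_base u \<in> fst (tangent_chart \<A> c) \<longrightarrow> \<kappa> u = kappa_chart c (B c) u)"
      using kappa_one_form[OF \<kappa>] \<kappa> by blast
    show "\<exists>\<omega>. two_form (tangent_atlas \<A>) \<omega> \<and>
            (\<forall>c\<in>\<A>. \<forall>u\<in>jets (tangent_atlas \<A>) 1. \<forall>w\<in>jets (tangent_atlas \<A>) 1.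
               jet_base w = jet_base u \<and> jet_base u \<in> fst (tangent_chart \<A> c) \<longrightarrow>
               \<omega> u w = omega_chart c (A c) u w)"
      using omega_two_form[OF \<omega>] \<omega> by blast
  qed (use kappa_chart_independent omega_chart_independent in blast)+
qed

end
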